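(* Let $G=(V,E,m,\omega)$ be a finite or locally finite connected weighted graph satisfying at least one of the following: $(A_1)$ the Laplacian $\Delta$ is bounded on $\ell^2_m$, i.e. $\sup_{x\in V}\frac{\deg(x)}{m(x)}<\infty$; $(A_2)$ $G$ is complete and $m$ is non-degenerate. Suppose $G$ satisfies $CDE'(n,-K)$ for some $n>0$ and some $K>0$, and let $\lambda^*$ be the greatest lower bound of the $\ell^2$-spectrum of the graph Laplacian, i.e. $\lambda^*=\inf\operatorname{spec}(-\Delta)$ on $\ell^2_m$. Then $$\lambda^*\le\frac{Kn}{2}.$$
   Context: Setting: $G=(V,E,m,\omega)$ is a connected weighted graph (loops allowed): $V$ is the vertex set, $E$ a symmetric set of edges, $x\sim y$ means $\{x,y\}\in E$, $m:V\to(0,\infty)$ is a vertex measure, and $\omega_{xy}=\omega_{yx}>0$ is the weight of the edge $\{x,y\}$. Locally finite means that every vertex has finitely many neighbours, so $\deg(x)=\sum_{y\sim x}\omega_{xy}<\infty$ for all $x$. $C_0(V)$ is the set of finitely supported real functions on $V$; $\ell^p_m$ is the $\ell^p$ space on $V$ with respect to $m$. The measure $m$ is non-degenerate if $\inf_{x\in V}m(x)>0$. Laplacian: $\Delta f(x)=\frac{1}{m(x)}\sum_{y\sim x}\omega_{xy}(f(y)-f(x))$. Let $Q(f,g)=\frac12\sum_{x,y\in V}\omega_{xy}(f(y)-f(x))(g(y)-g(x))$ (with $\omega_{xy}=0$ if $x\not\sim y$), with domain $D(Q)$ the completion of $C_0(V)$ under $\|f\|_Q=(\|f\|_{\ell^2_m}^2+Q(f,f))^{1/2}$.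 The associated self-adjoint generator on $\ell^2_m$ is $\Delta$ with domain $D(\Delta)=\{f\in D(Q):\Delta f\in\ell^2_m\}$; with this sign $-\Delta$ is a nonnegative operator. Gradient forms: $\Gamma(f,g)(x)=\frac{1}{2m(x)}\sum_{y\sim x}\omega_{xy}(f(y)-f(x))(g(y)-g(x))$, $\Gamma(f)=\Gamma(f,f)$. For positive $f$, $\widetilde{\Gamma_2}(f)=\frac12\Delta\Gamma(f)-\Gamma\left(f,\frac{\Delta (f^2)}{2f}\right)$. For $\kappa\in\mathbb R$, $G$ satisfies $CDE'(n,\kappa)$ if for every positive function $f:V\to(0,\infty)$ and every $x\in V$, $\widetilde{\Gamma_2}(f)(x)\ge\frac1n f(x)^2(\Delta\log f)(x)^2+\kappa\,\Gamma(f)(x)$. $G$ is complete if there is a non-decreasing sequence $\{\eta_k\}$ in $C_0(V)$ with $\eta_k\to\mathbf 1$ pointwise and $\Gamma(\eta_k)\le\frac1k$ on $V$ for all $k\ge1$. *)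

theory Defs
  imports "HOL-Analysis.Analysis"
begin

text \<open>
  The vertex set \<open>V\<close> is the whole type \<open>'v\<close>.  Since every vertex has positive measure, elements
  of \<open>\<ell>\<^sup>2\<^sub>m\<close> are honest functions on \<open>'v\<close>.
\<close>

record 'v wgraph =
  edges :: "('v \<times> 'v) set"
  vmeas :: "'v \<Rightarrow> real"
  weight :: "'v \<Rightarrow> 'v \<Rightarrow> real"

definition weighted_graph :: "'v wgraph \<Rightarrow> bool" where
  "weighted_graph G \<longleftrightarrow>
     sym (edges G) \<and>
     (\<forall>x. vmeas G x > 0) \<and>
     (\<forall>x y. weight G x y = weight G y x) \<and>
     (\<forall>x y. (x, y) \<in> edges G \<longrightarrow> weight G x y > 0) \<and>
     (\<forall>x y. (x, y) \<notin> edges G \<longrightarrow> weight G x y = 0)"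

definition connected_graph :: "'v wgraph \<Rightarrow> bool" where
  "connected_graph G \<longleftrightarrow> (\<forall>x y. (x, y) \<in> (edges G)\<^sup>*)"

definition nbrs :: "'v wgraph \<Rightarrow> 'v \<Rightarrow> 'v set" where
  "nbrs G x = {y. (x, y) \<in> edges G}"

definition locally_finite :: "'v wgraph \<Rightarrow> bool" where
  "locally_finite G \<longleftrightarrow> (\<forall>x. finite (nbrs G x))"

definition degr :: "'v wgraph \<Rightarrow> 'v \<Rightarrow> real" where
  "degr G x = (\<Sum>y\<in>nbrs G x. weight G x y)"

definition nondegenerate :: "'v wgraph \<Rightarrow> bool" where
  "nondegenerate G \<longleftrightarrow> (INF x. vmeas G x) > 0"

definition laplacian :: "'v wgraph \<Rightarrow> ('v \<Rightarrow> real) \<Rightarrow> 'v \<Rightarrow> real" where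
  "laplacian G f x = (1 / vmeas G x) * (\<Sum>y\<in>nbrs G x. weight G x y * (f y - f x))"

definition Gam :: "'v wgraph \<Rightarrow> ('v \<Rightarrow> real) \<Rightarrow> ('v \<Rightarrow> real) \<Rightarrow> 'v \<Rightarrow> real" where
  "Gam G f g x =
     (1 / (2 * vmeas G x)) * (\<Sum>y\<in>nbrs G x. weight G x y * (f y - f x) * (g y - g x))"

definition Gam2_tilde :: "'v wgraph \<Rightarrow> ('v \<Rightarrow> real) \<Rightarrow> 'v \<Rightarrow> real" where
  "Gam2_tilde G f x =
     (1 / 2) * laplacian G (Gam G f f) x
     - Gam G f (\<lambda>y. laplacian G (\<lambda>z. (f z)\<^sup>2) y / (2 * f y)) x"

definition CDE' :: "'v wgraph \<Rightarrow> real \<Rightarrow> real \<Rightarrow> bool" where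
  "CDE' G n \<kappa> \<longleftrightarrow>
     (\<forall>f. (\<forall>x. f x > 0) \<longrightarrow>
       (\<forall>x. Gam2_tilde G f x \<ge>
              (1 / n) * (f x)\<^sup>2 * (laplacian G (\<lambda>y. ln (f y)) x)\<^sup>2 + \<kappa> * Gam G f f x))"

definition C0 :: "('v \<Rightarrow> real) set" where
  "C0 = {f. finite {x. f x \<noteq> 0}}"

definition complete_graph :: "'v wgraph \<Rightarrow> bool" where
  "complete_graph G \<longleftrightarrow>
     (\<exists>\<eta> :: nat \<Rightarrow> 'v \<Rightarrow> real.
        (\<forall>k\<ge>1. \<eta> k \<in> C0) \<and>
        (\<forall>k\<ge>1. \<forall>x. \<eta> k x \<le> \<eta> (Suc k) x) \<and>
        (\<forall>x. (\<lambda>k. \<eta> k x) \<longlonglongrightarrow> 1) \<and>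
        (\<forall>k\<ge>1. \<forall>x. Gam G (\<eta> k) (\<eta> k) x \<le> 1 / real k))"

definition ell2 :: "'v wgraph \<Rightarrow> ('v \<Rightarrow> real) set" where
  "ell2 G = {f. (\<lambda>x. vmeas G x * (f x)\<^sup>2) summable_on UNIV}"

definition norm2 :: "'v wgraph \<Rightarrow> ('v \<Rightarrow> real) \<Rightarrow> real" where
  "norm2 G f = sqrt (\<Sum>\<^sub>\<infinity>x. vmeas G x * (f x)\<^sup>2)"

text \<open>
  An infinite sum that does not converge has the value 0.  \<open>Qform\<close> and \<open>normQ\<close> are only applied to
  finitely supported functions below, for which (by local finiteness) the sum is finite.
\<close>

definition Qform :: "'v wgraph \<Rightarrow> ('v \<Rightarrow> real) \<Rightarrow> ('v \<Rightarrow> real) \<Rightarrow> real" where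
  "Qform G f g = (1 / 2) * (\<Sum>\<^sub>\<infinity>(x, y). weight G x y * (f y - f x) * (g y - g x))"

definition normQ :: "'v wgraph \<Rightarrow> ('v \<Rightarrow> real) \<Rightarrow> real" where
  "normQ G f = sqrt ((norm2 G f)\<^sup>2 + Qform G f f)"

text \<open>
  The completion of \<open>C0\<close> under \<open>normQ\<close>, realised inside \<open>\<ell>\<^sup>2\<^sub>m\<close>: a \<open>normQ\<close>-Cauchy sequence is
  identified with its \<open>\<ell>\<^sup>2\<^sub>m\<close>-limit.  Because the form is closable, inequivalent Cauchy sequences
  have different limits.
\<close>

definition domQ :: "'v wgraph \<Rightarrow> ('v \<Rightarrow> real) set" where
  "domQ G = {f \<in> ell2 G. \<exists>\<phi> :: nat \<Rightarrow> 'v \<Rightarrow> real.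
     (\<forall>k. \<phi> k \<in> C0) \<and>
     (\<forall>e>0. \<exists>N. \<forall>i\<ge>N. \<forall>j\<ge>N. normQ G (\<lambda>x. \<phi> i x - \<phi> j x) < e) \<and>
     (\<lambda>k. norm2 G (\<lambda>x. \<phi> k x - f x)) \<longlonglongrightarrow> 0}"

definition dom_laplacian :: "'v wgraph \<Rightarrow> ('v \<Rightarrow> real) set" where
  "dom_laplacian G = {f \<in> domQ G. laplacian G f \<in> ell2 G}"

text \<open>
  Resolvent set and spectrum of an operator \<open>A\<close> on the real Hilbert space \<open>\<ell>\<^sup>2\<^sub>m\<close> with domain \<open>D\<close>.
  The spectral parameter is real; for a self-adjoint \<open>A\<close> the spectrum of the complexification is
  real and is the same set.
\<close>

definition resolvent_set ::
  "'v wgraph \<Rightarrow> ('v \<Rightarrow> real) set \<Rightarrow> (('v \<Rightarrow> real) \<Rightarrow> 'v \<Rightarrow> real) \<Rightarrow> real set" where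
  "resolvent_set G D A =
     {z. bij_betw (\<lambda>f x. A f x - z * f x) D (ell2 G) \<and>
         (\<exists>C. \<forall>f\<in>D. norm2 G f \<le> C * norm2 G (\<lambda>x. A f x - z * f x))}"

definition spec ::
  "'v wgraph \<Rightarrow> ('v \<Rightarrow> real) set \<Rightarrow> (('v \<Rightarrow> real) \<Rightarrow> 'v \<Rightarrow> real) \<Rightarrow> real set" where
  "spec G D A = - resolvent_set G D A"

definition lambda_star :: "'v wgraph \<Rightarrow> real" where
  "lambda_star G = Inf (spec G (dom_laplacian G) (\<lambda>f x. - laplacian G f x))"

end

theory Submission
  imports Defs
begin

text \<open>
  Write \<open>\<lambda>\<close> for the bottom of the spectrum and \<open>\<langle>\<cdot>\<rangle>\<close> for summation over the vertices
  against \<open>m\<close>.  The bound is the pointwise maximum-principle argument for positive solutions of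
  \<open>- \<Delta> u = \<lambda> u\<close>, turned into an integral identity so that no maximum has to be attained.

  Let \<open>u > 0\<close> solve \<open>- \<Delta> u = h u\<close>, put \<open>f = \<surd>u\<close> and \<open>F = \<Gamma>(f)\<close>.  Then
  \<open>\<Delta>(f\<^sup>2) / (2 f) = - h f / 2\<close>, so \<open>2 \<Gamma>\<^sub>2~(f) = \<Delta> F + \<Gamma>(f, h f)\<close>.  Since
  \<open>\<Delta> log f \<le> \<Delta> f / f = - (h u / 2 + F) / u\<close>, CDE' and the completion of a square in \<open>F\<close> give
  \<open>(\<Delta> F + \<Gamma>(f, h f)) / 2 \<ge> (K/2) (h - n K / 2) u\<close>.
  Multiply by \<open>u\<close> and sum: Green's formula turns \<open>\<langle>u \<Delta> F\<rangle>\<close> into \<open>- \<langle>h u F\<rangle>\<close>,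
  and what is left of the two terms on the left is the commutator
  \<open>\<langle>u (\<Gamma>(f, h f) - h F)\<rangle> / 2\<close>, which vanishes for constant \<open>h\<close> and is of order \<open>\<epsilon>\<close> when
  \<open>\<Gamma>(h) \<le> \<epsilon>\<^sup>2\<close>.  Hence \<open>\<langle>h u\<^sup>2\<rangle> \<le> (n K / 2 + O(\<epsilon>)) \<langle>u\<^sup>2\<rangle>\<close>
  (\<open>mean_potential_bound\<close>), while a variational choice of \<open>u\<close> makes
  \<open>\<langle>h u\<^sup>2\<rangle> \<ge> \<lambda> \<langle>u\<^sup>2\<rangle>\<close>.

  A positive solution with constant \<open>h = \<lambda>\<close> need not be square summable, and summability is needed
  for Green's formula.  Minimising \<open>\<langle>\<Gamma>(\<phi>) + \<phi>\<^sup>2\<rangle> / \<langle>\<eta> \<phi>\<^sup>2\<rangle>\<close> for a finitely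
  supported cutoff \<open>\<eta>\<close> is a compact problem; its minimiser \<open>u > 0\<close> is square summable and solves
  \<open>- \<Delta> u = (\<theta> \<eta> - 1) u\<close> (\<open>ground_state\<close>).  The potential \<open>h = \<theta> \<eta> - 1\<close> varies as slowly
  as \<open>\<eta>\<close>, and \<open>\<theta>\<close> stays bounded as \<open>\<eta>\<close> increases to 1.  Slowly varying cutoffs are part of the
  definition of completeness; for a bounded Laplacian they are built from balls of large radius.

  Green's formula for \<open>u\<close> and \<open>F\<close> also needs \<open>F \<in> \<ell>\<^sup>2\<close>, which the energy of \<open>u\<close> does
  not give for \<open>f = \<surd>u\<close>.  Working with \<open>f = \<surd>(u + \<tau>)\<close>, \<open>\<tau> > 0\<close>, gives
  \<open>F \<le> \<Gamma>(u) / (4 \<tau>)\<close>, which is summable because \<open>u\<close> has finite energy; with a non-degenerate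
  measure \<open>\<ell>\<^sup>1 \<subseteq> \<ell>\<^sup>2\<close>, and with a bounded Laplacian \<open>F\<^sup>2\<close> is dominated by a multiple of
  \<open>\<Gamma>(u)\<close>.  At the end \<open>\<tau>\<close> tends to 0.

  The Rayleigh bound \<open>\<lambda> \<langle>\<phi>\<^sup>2\<rangle> \<le> \<langle>\<Gamma>(\<phi>)\<rangle>\<close> for finitely supported \<open>\<phi>\<close> has to be extracted from
  the definition of the spectrum by resolvent sets (\<open>lambda_star_le_Rayleigh\<close>): negative numbers
  lie in the resolvent set by minimising a quadratic functional, and the infimum of the Rayleigh
  quotient lies in the spectrum by the Cauchy-Schwarz inequality for the shifted form.
\<close>

section \<open>Real-variable preliminaries\<close>

lemma quadratic_nonneg_discriminant:
  fixes a b c :: real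
  assumes "\<And>t. 0 \<le> a + 2 * t * b + t\<^sup>2 * c"
  shows "b\<^sup>2 \<le> a * c"
proof (cases "c = 0")
  case True
  have "b = 0"
  proof (rule ccontr)
    assume b: "b \<noteq> 0"
    show False using assms[of "- (a + 1) / (2 * b)"] b True by (simp add: field_simps)
  qed
  then show ?thesis using True by simp
next
  case False
  have "c \<ge> 0"
  proof (rule ccontr)
    assume c: "\<not> c \<ge> 0"
    define t where "t = (\<bar>a\<bar> + 1) / \<bar>c\<bar> + 2 * \<bar>b\<bar> / \<bar>c\<bar> + 1"
    have t1: "t \<ge> 1" unfolding t_def by (simp add: add_nonneg_nonneg)
    have "t * \<bar>c\<bar> = \<bar>a\<bar> + 1 + 2 * \<bar>b\<bar> + \<bar>c\<bar>" using c by (simp add: t_def field_simps)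
    then have "t * (t * \<bar>c\<bar>) \<ge> t * (\<bar>a\<bar> + 1 + 2 * \<bar>b\<bar>)" using t1 by (intro mult_left_mono) auto
    also have "t * (\<bar>a\<bar> + 1 + 2 * \<bar>b\<bar>) \<ge> \<bar>a\<bar> + 1 + 2 * t * \<bar>b\<bar>"
      using t1 mult_right_mono[of 1 t "\<bar>a\<bar> + 1"] by (simp add: algebra_simps)
    finally have "t\<^sup>2 * \<bar>c\<bar> \<ge> \<bar>a\<bar> + 1 + 2 * t * \<bar>b\<bar>" by (simp add: power2_eq_square algebra_simps)
    moreover have "t * b \<le> t * \<bar>b\<bar>" using t1 by (intro mult_left_mono) auto
    ultimately have "a + 2 * t * b + t\<^sup>2 * c < 0" using c by (auto simp: abs_if split: if_splits)
    then show False using assms[of t] by simp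
  qed
  then have c: "c > 0" using False by simp
  have "0 \<le> a + 2 * (- b / c) * b + (- b / c)\<^sup>2 * c" by (rule assms)
  then have "0 \<le> a - b\<^sup>2 / c" using c by (simp add: power2_eq_square field_simps)
  then show ?thesis using c by (simp add: field_simps)
qed

lemma finite_convergent_subsequence:
  fixes f :: "nat \<Rightarrow> 'b \<Rightarrow> real"
  assumes "finite S" "\<And>x. x \<in> S \<Longrightarrow> bounded (range (\<lambda>k. f k x))"
  shows "\<exists>r. strict_mono (r :: nat \<Rightarrow> nat) \<and> (\<forall>x\<in>S. convergent (\<lambda>k. f (r k) x))"
  using assms
proof (induction S rule: finite_induct)
  case empty
  show ?case by (intro exI[of _ id]) (auto simp: strict_mono_def)
next
  case (insert z S)
  then obtain r where r: "strict_mono r" "\<forall>x\<in>S. convergent (\<lambda>k. f (r k) x)" by auto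
  have "bounded (range (\<lambda>k. f (r k) z))"
    by (rule bounded_subset[OF insert.prems[of z]]) auto
  then obtain l s where s: "strict_mono (s :: nat \<Rightarrow> nat)" "((\<lambda>k. f (r k) z) \<circ> s) \<longlonglongrightarrow> l"
    using bounded_imp_convergent_subsequence by blast
  have "convergent (\<lambda>k. f (r (s k)) x)" if "x \<in> insert z S" for x
  proof (cases "x = z")
    case True
    then show ?thesis using s(2) by (auto simp: convergent_def o_def)
  next
    case False
    then have "x \<in> S" using that by simp
    then obtain l' where "(\<lambda>k. f (r k) x) \<longlonglongrightarrow> l'" using r(2) unfolding convergent_def by blast
    from LIMSEQ_subseq_LIMSEQ[OF this s(1)] show ?thesis by (auto simp: convergent_def o_def)
  qed
  moreover have "strict_mono (r \<circ> s)" using r(1) s(1) by (rule strict_mono_o)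
  ultimately show ?case by (intro exI[of _ "r \<circ> s"]) (simp add: o_def)
qed

lemma minimizing_sequence:
  fixes F :: "'b \<Rightarrow> real"
  assumes "A \<noteq> {}" and "bdd_below (F ` A)"
  obtains \<phi> :: "nat \<Rightarrow> 'b" where "\<And>k. \<phi> k \<in> A" "(\<lambda>k. F (\<phi> k)) \<longlonglongrightarrow> Inf (F ` A)"
proof -
  have "\<exists>\<phi>\<in>A. F \<phi> < Inf (F ` A) + 1 / real (Suc k)" for k
  proof -
    have "Inf (F ` A) < Inf (F ` A) + 1 / real (Suc k)" by simp
    then show ?thesis using assms cInf_less_iff[of "F ` A"] by blast
  qed
  then obtain \<phi> where \<phi>: "\<And>k. \<phi> k \<in> A" "\<And>k. F (\<phi> k) < Inf (F ` A) + 1 / real (Suc k)" by metis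
  have "(\<lambda>k. F (\<phi> k)) \<longlonglongrightarrow> Inf (F ` A)"
  proof (rule tendsto_sandwich[of "\<lambda>k. Inf (F ` A)" _ _ "\<lambda>k. Inf (F ` A) + 1 / real (Suc k)"])
    show "(\<lambda>k. Inf (F ` A) + 1 / real (Suc k)) \<longlonglongrightarrow> Inf (F ` A)"
      using tendsto_add[OF tendsto_const LIMSEQ_inverse_real_of_nat, of "Inf (F ` A)"]
      by (simp add: inverse_eq_divide)
    show "\<forall>\<^sub>F k in sequentially. Inf (F ` A) \<le> F (\<phi> k)"
      by (rule always_eventually) (use \<phi>(1) assms in \<open>auto intro: cInf_lower\<close>)
    show "\<forall>\<^sub>F k in sequentially. F (\<phi> k) \<le> Inf (F ` A) + 1 / real (Suc k)"
      by (rule always_eventually) (use \<phi>(2) in \<open>auto intro: less_imp_le\<close>)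
  qed auto
  with \<phi>(1) that show ?thesis by blast
qed

text \<open>
  Everything that is used about \<open>f = \<surd>(u + \<tau>)\<close> along an edge with values \<open>a\<close>, \<open>b\<close> of \<open>u\<close>.  The
  bounds with \<open>1 / (4 \<tau>)\<close> and with \<open>\<bar>b - a\<bar>\<close> give the square summability of the gradient, the others
  are uniform in \<open>\<tau>\<close> and survive the limit \<open>\<tau> \<rightarrow> 0\<close>.
\<close>
lemma sqrt_shift_step:
  fixes a b \<tau> :: real
  assumes "a > 0" "b > 0" "\<tau> > 0"
  defines "p \<equiv> sqrt (a + \<tau>)" and "q \<equiv> sqrt (b + \<tau>)"
  shows "p > 0" "q > 0" "p\<^sup>2 = a + \<tau>" "(q - p) * (q + p) = b - a"
    "\<bar>q - p\<bar> * q \<le> \<bar>b - a\<bar>" "a * (q - p)\<^sup>2 \<le> (b - a)\<^sup>2" "(q - p)\<^sup>2 \<le> (b - a)\<^sup>2 / (4 * \<tau>)"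
    "(q - p)\<^sup>2 \<le> \<bar>b - a\<bar>" "\<tau> / (p * q) \<le> 1" "\<tau> / (p * q) \<le> sqrt \<tau> / sqrt a"
proof -
  show p: "p > 0" and q: "q > 0" and pp: "p\<^sup>2 = a + \<tau>" using assms by (auto simp: p_def q_def)
  have qq: "q\<^sup>2 = b + \<tau>" using assms by (auto simp: q_def)
  show qp: "(q - p) * (q + p) = b - a" using pp qq by (simp add: power2_eq_square algebra_simps)
  have ab: "\<bar>b - a\<bar> = \<bar>q - p\<bar> * (q + p)" unfolding qp[symmetric] using p q by (simp add: abs_mult)
  show "\<bar>q - p\<bar> * q \<le> \<bar>b - a\<bar>" unfolding ab using p by (intro mult_left_mono) auto
  have sq: "(b - a)\<^sup>2 = (q - p)\<^sup>2 * (q + p)\<^sup>2" unfolding qp[symmetric] by (simp add: power_mult_distrib)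
  have "p\<^sup>2 \<le> (q + p)\<^sup>2" using p q by (intro power_mono) auto
  then have "a \<le> (q + p)\<^sup>2" using pp assms by simp
  then have "(q - p)\<^sup>2 * a \<le> (q - p)\<^sup>2 * (q + p)\<^sup>2" by (rule mult_left_mono) simp
  then show "a * (q - p)\<^sup>2 \<le> (b - a)\<^sup>2" by (simp add: sq mult.commute)
  have sp: "sqrt \<tau> \<le> p" "sqrt \<tau> \<le> q" using assms by (auto simp: p_def q_def)
  have "2 * sqrt \<tau> \<le> q + p" using sp by simp
  then have "(2 * sqrt \<tau>)\<^sup>2 \<le> (q + p)\<^sup>2" using assms by (intro power_mono) auto
  then have "4 * \<tau> \<le> (q + p)\<^sup>2" using assms by (simp add: power_mult_distrib)
  then have "(q - p)\<^sup>2 * (4 * \<tau>) \<le> (q - p)\<^sup>2 * (q + p)\<^sup>2" by (rule mult_left_mono) simp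
  then show "(q - p)\<^sup>2 \<le> (b - a)\<^sup>2 / (4 * \<tau>)" using assms by (simp add: sq pos_le_divide_eq)
  have "\<bar>q - p\<bar> * \<bar>q - p\<bar> \<le> \<bar>q - p\<bar> * (q + p)" using p q by (intro mult_left_mono) auto
  then show "(q - p)\<^sup>2 \<le> \<bar>b - a\<bar>" unfolding ab by (simp add: power2_eq_square)
  have "\<tau> = sqrt \<tau> * sqrt \<tau>" using assms by simp
  also have "\<dots> \<le> p * q" using sp p q assms by (intro mult_mono) auto
  finally show "\<tau> / (p * q) \<le> 1" using p q by (simp add: divide_le_eq_1)
  have ap: "sqrt a \<le> p" using assms by (simp add: p_def)
  have "\<tau> / (p * q) \<le> \<tau> / (sqrt a * sqrt \<tau>)"
    using ap sp assms p q by (intro divide_left_mono mult_mono mult_pos_pos) auto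
  also have "\<dots> = sqrt \<tau> / sqrt a" using assms by (simp add: field_simps)
  finally show "\<tau> / (p * q) \<le> sqrt \<tau> / sqrt a" .
qed

text \<open>
  For \<open>P > 0\<close> the bound on \<open>L\<close> can be squared, and the claim is that
  \<open>(P - n K v / 2)\<^sup>2 / (n v) \<ge> 0\<close>; for \<open>P \<le> 0\<close> the claimed lower bound is below \<open>- K F\<close>.
\<close>
lemma curvature_square:
  fixes v n K F L P :: real
  assumes "v > 0" "n > 0" "K > 0" and L: "L \<le> - P / v"
  shows "(1/n) * v * L\<^sup>2 - K * F \<ge> K * (P - F) - n * K\<^sup>2 * v / 4"
proof -
  have "(1/n) * v * L\<^sup>2 \<ge> K * P - n * K\<^sup>2 * v / 4"
  proof (cases "P > 0")
    case True
    have "P / v \<le> \<bar>L\<bar>" using L by simp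
    then have "(P / v)\<^sup>2 \<le> L\<^sup>2" using True assms(1) by (metis abs_le_square_iff abs_of_pos divide_pos_pos)
    then have "(v / n) * (P / v)\<^sup>2 \<le> (v / n) * L\<^sup>2" using assms by (intro mult_left_mono) auto
    moreover have "0 \<le> (1 / (n * v)) * (P - n * K * v / 2)\<^sup>2" using assms by simp
    moreover have "(1 / (n * v)) * (P - n * K * v / 2)\<^sup>2 = (v / n) * (P / v)\<^sup>2 - K * P + n * K\<^sup>2 * v / 4"
      using assms by (simp add: power2_eq_square field_simps)
    ultimately show ?thesis by simp
  next
    case False
    then have "K * P \<le> 0" using assms by (simp add: mult_nonneg_nonpos)
    moreover have "n * K\<^sup>2 * v / 4 \<ge> 0" "(1/n) * v * L\<^sup>2 \<ge> 0" using assms by simp_all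
    ultimately show ?thesis by linarith
  qed
  then show ?thesis by (simp add: algebra_simps)
qed

section \<open>Summation over vertices and summation by parts\<close>

locale locally_finite_graph =
  fixes G :: "'v wgraph"
  assumes weighted: "weighted_graph G" and loc_fin: "locally_finite G"
begin

abbreviation m :: "'v \<Rightarrow> real" where "m \<equiv> vmeas G"
abbreviation \<omega> :: "'v \<Rightarrow> 'v \<Rightarrow> real" where "\<omega> \<equiv> weight G"
abbreviation N :: "'v \<Rightarrow> 'v set" where "N \<equiv> nbrs G"
abbreviation \<Delta> :: "('v \<Rightarrow> real) \<Rightarrow> 'v \<Rightarrow> real" where "\<Delta> \<equiv> laplacian G"
abbreviation \<Gamma> :: "('v \<Rightarrow> real) \<Rightarrow> ('v \<Rightarrow> real) \<Rightarrow> 'v \<Rightarrow> real" where "\<Gamma> \<equiv> Gam G"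

lemma m_pos [simp]: "m x > 0" using weighted by (simp add: weighted_graph_def)
lemma m_nonneg [simp]: "m x \<ge> 0" using m_pos[of x] by linarith
lemma m_nonzero [simp]: "m x \<noteq> 0" using m_pos[of x] by linarith
lemma \<omega>_sym: "\<omega> x y = \<omega> y x" using weighted by (simp add: weighted_graph_def)
lemma \<omega>_pos: "y \<in> N x \<Longrightarrow> \<omega> x y > 0"
  using weighted by (simp add: weighted_graph_def nbrs_def)
lemma \<omega>_zero: "y \<notin> N x \<Longrightarrow> \<omega> x y = 0"
  using weighted by (simp add: weighted_graph_def nbrs_def)
lemma \<omega>_nonneg [simp]: "\<omega> x y \<ge> 0"
  using \<omega>_pos[of y x] \<omega>_zero[of y x] by fastforce
lemma N_sym: "y \<in> N x \<longleftrightarrow> x \<in> N y"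
  using weighted by (auto simp: weighted_graph_def nbrs_def sym_def)
lemma finite_N [simp]: "finite (N x)" using loc_fin by (simp add: locally_finite_def)

lemma C0_iff: "f \<in> C0 \<longleftrightarrow> finite {x. f x \<noteq> 0}" by (simp add: C0_def)

lemma C0_vanishing: "f \<in> C0 \<Longrightarrow> (\<And>x. f x = 0 \<Longrightarrow> g x = 0) \<Longrightarrow> g \<in> C0"
  unfolding C0_def by (auto elim!: finite_subset[rotated])

lemma C0_combine:
  "f \<in> C0 \<Longrightarrow> g \<in> C0 \<Longrightarrow> (\<And>x. f x = 0 \<Longrightarrow> g x = 0 \<Longrightarrow> h x = 0) \<Longrightarrow> h \<in> C0"
  unfolding C0_def
  by (auto intro: finite_subset[of _ "{x. f x \<noteq> 0} \<union> {x. g x \<noteq> 0}"])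

lemma C0_add [intro]: "f \<in> C0 \<Longrightarrow> g \<in> C0 \<Longrightarrow> (\<lambda>x. f x + g x) \<in> C0"
  by (rule C0_combine[of f g]) auto
lemma C0_diff [intro]: "f \<in> C0 \<Longrightarrow> g \<in> C0 \<Longrightarrow> (\<lambda>x. f x - g x) \<in> C0"
  by (rule C0_combine[of f g]) auto
lemma C0_mult_left [intro]: "f \<in> C0 \<Longrightarrow> (\<lambda>x. f x * g x) \<in> C0"
  by (rule C0_vanishing[of f]) auto
lemma C0_mult_right [intro]: "g \<in> C0 \<Longrightarrow> (\<lambda>x. f x * g x) \<in> C0"
  by (rule C0_vanishing[of g]) auto
lemma C0_zero [simp, intro]: "(\<lambda>x. 0) \<in> C0" by (simp add: C0_def)
lemma C0_indicator [intro]: "(\<lambda>x. if x = z then c else 0) \<in> C0"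
  unfolding C0_iff by (rule finite_subset[of _ "{z}"]) (auto split: if_splits)

text \<open>
  Gradient and Laplacian of a function supported in \<open>S\<close> live on this set, so all sums that
  involve a finitely supported function reduce to finite sums over a closed neighbourhood.
\<close>
definition closed_nbhd :: "'v set \<Rightarrow> 'v set" where "closed_nbhd S = S \<union> (\<Union>x\<in>S. N x)"

lemma finite_closed_nbhd: "finite S \<Longrightarrow> finite (closed_nbhd S)" by (simp add: closed_nbhd_def)

lemma \<Gamma>_eq_0: "x \<notin> closed_nbhd {y. f y \<noteq> 0} \<Longrightarrow> \<Gamma> f g x = 0"
proof -
  assume x: "x \<notin> closed_nbhd {y. f y \<noteq> 0}"
  then have "f x = 0" and "\<And>y. y \<in> N x \<Longrightarrow> f y = 0" by (auto simp: closed_nbhd_def N_sym)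
  then show ?thesis by (simp add: Gam_def)
qed

lemma \<Gamma>_commute: "\<Gamma> f g x = \<Gamma> g f x" by (simp add: Gam_def mult.assoc mult.left_commute mult.commute)

lemma C0_\<Gamma> [intro]: "f \<in> C0 \<Longrightarrow> \<Gamma> f g \<in> C0"
  unfolding C0_iff
  by (rule finite_subset[OF _ finite_closed_nbhd]) (use \<Gamma>_eq_0 in blast)

lemma C0_\<Delta> [intro]: "f \<in> C0 \<Longrightarrow> \<Delta> f \<in> C0"
proof -
  assume f: "f \<in> C0"
  have "\<Delta> f x = 0" if "x \<notin> closed_nbhd {y. f y \<noteq> 0}" for x
  proof -
    have "f x = 0" and "\<And>y. y \<in> N x \<Longrightarrow> f y = 0" using that by (auto simp: closed_nbhd_def N_sym)
    then show ?thesis by (simp add: laplacian_def)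
  qed
  then have "{x. \<Delta> f x \<noteq> 0} \<subseteq> closed_nbhd {y. f y \<noteq> 0}" by auto
  then show ?thesis using f finite_closed_nbhd finite_subset unfolding C0_iff by metis
qed

lemma nbr_sum_eq_closed_nbhd_sum:
  assumes "finite S" and "\<And>x y. x \<notin> S \<Longrightarrow> y \<notin> S \<Longrightarrow> B x y = 0"
  shows "(\<Sum>y\<in>N x. \<omega> x y * B x y) = (\<Sum>y\<in>closed_nbhd S. \<omega> x y * B x y)"
proof -
  have "(\<Sum>y\<in>N x. \<omega> x y * B x y) = (\<Sum>y\<in>N x \<inter> closed_nbhd S. \<omega> x y * B x y)"
  proof (rule sum.mono_neutral_right)
    show "\<forall>y\<in>N x - N x \<inter> closed_nbhd S. \<omega> x y * B x y = 0"
    proof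
      fix y assume y: "y \<in> N x - N x \<inter> closed_nbhd S"
      then have "x \<notin> S" "y \<notin> S" by (auto simp: closed_nbhd_def)
      then show "\<omega> x y * B x y = 0" using assms by simp
    qed
  qed auto
  also have "\<dots> = (\<Sum>y\<in>closed_nbhd S. \<omega> x y * B x y)"
  proof (rule sum.mono_neutral_left)
    show "\<forall>y\<in>closed_nbhd S - N x \<inter> closed_nbhd S. \<omega> x y * B x y = 0" using \<omega>_zero by auto
  qed (use finite_closed_nbhd[OF assms(1)] in auto)
  finally show ?thesis .
qed

text \<open>
  Symmetrisation over ordered edges; the only source of integration by parts in what follows.
\<close>
lemma edge_sum_swap:
  assumes "finite S" and "\<And>x y. x \<notin> S \<Longrightarrow> y \<notin> S \<Longrightarrow> A x y = 0"
  shows "(\<Sum>x\<in>closed_nbhd S. \<Sum>y\<in>N x. \<omega> x y * A x y) = (\<Sum>x\<in>closed_nbhd S. \<Sum>y\<in>N x. \<omega> x y * A y x)"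
proof -
  have "(\<Sum>x\<in>closed_nbhd S. \<Sum>y\<in>N x. \<omega> x y * A x y) = (\<Sum>x\<in>closed_nbhd S. \<Sum>y\<in>closed_nbhd S. \<omega> x y * A x y)"
    by (intro sum.cong refl nbr_sum_eq_closed_nbhd_sum) (use assms in auto)
  also have "\<dots> = (\<Sum>y\<in>closed_nbhd S. \<Sum>x\<in>closed_nbhd S. \<omega> x y * A x y)" by (rule sum.swap)
  also have "\<dots> = (\<Sum>x\<in>closed_nbhd S. \<Sum>y\<in>closed_nbhd S. \<omega> x y * A y x)"
    by (intro sum.cong refl) (metis \<omega>_sym)
  also have "\<dots> = (\<Sum>x\<in>closed_nbhd S. \<Sum>y\<in>N x. \<omega> x y * A y x)"
    by (rule sum.cong[OF refl], rule nbr_sum_eq_closed_nbhd_sum[symmetric, OF assms(1)], rule assms(2))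
  finally show ?thesis .
qed

definition vsummable :: "('v \<Rightarrow> real) \<Rightarrow> bool" where
  "vsummable f \<longleftrightarrow> (\<lambda>x. m x * f x) summable_on UNIV"

definition vint :: "('v \<Rightarrow> real) \<Rightarrow> real" where
  "vint f = (\<Sum>\<^sub>\<infinity>x. m x * f x)"

lemma vint_finite:
  assumes "finite T" "\<And>x. x \<notin> T \<Longrightarrow> f x = 0"
  shows "vint f = (\<Sum>x\<in>T. m x * f x)" "vsummable f"
proof -
  have "infsum (\<lambda>x. m x * f x) UNIV = infsum (\<lambda>x. m x * f x) T"
    by (rule infsum_cong_neutral) (use assms in auto)
  then show "vint f = (\<Sum>x\<in>T. m x * f x)" using assms by (simp add: vint_def)
  have "((\<lambda>x. m x * f x) summable_on UNIV) = ((\<lambda>x. m x * f x) summable_on T)"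
    by (rule summable_on_cong_neutral) (use assms(2) in auto)
  then show "vsummable f" using assms(1) by (simp add: vsummable_def)
qed

lemma vsummable_C0 [intro]: "f \<in> C0 \<Longrightarrow> vsummable f"
  unfolding C0_iff by (rule vint_finite(2)[of "{x. f x \<noteq> 0}"]) auto

lemma vint_0 [simp]: "vint (\<lambda>x. 0) = 0" "vsummable (\<lambda>x. 0)"
  by (auto simp: vint_def)

lemma vsummable_add: "vsummable f \<Longrightarrow> vsummable g \<Longrightarrow> vsummable (\<lambda>x. f x + g x)"
  unfolding vsummable_def by (simp add: distrib_left summable_on_add)
lemma vint_add: "vsummable f \<Longrightarrow> vsummable g \<Longrightarrow> vint (\<lambda>x. f x + g x) = vint f + vint g"
  unfolding vsummable_def vint_def by (simp add: distrib_left infsum_add)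
lemma vsummable_cmult: "vsummable f \<Longrightarrow> vsummable (\<lambda>x. c * f x)"
  unfolding vsummable_def using summable_on_cmult_right[of "\<lambda>x. m x * f x" UNIV c]
  by (simp add: mult.left_commute)
lemma vint_cmult: "vint (\<lambda>x. c * f x) = c * vint f"
  unfolding vint_def by (subst infsum_cmult_right'[symmetric]) (simp add: mult.left_commute)
lemma vsummable_minus: "vsummable f \<Longrightarrow> vsummable (\<lambda>x. - f x)"
  using vsummable_cmult[of f "-1"] by simp
lemma vint_minus: "vint (\<lambda>x. - f x) = - vint f"
  using vint_cmult[of "-1" f] by simp
lemma vsummable_diff: "vsummable f \<Longrightarrow> vsummable g \<Longrightarrow> vsummable (\<lambda>x. f x - g x)"
  using vsummable_add[of f "\<lambda>x. - g x"] vsummable_minus by simp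
lemma vint_diff: "vsummable f \<Longrightarrow> vsummable g \<Longrightarrow> vint (\<lambda>x. f x - g x) = vint f - vint g"
  using vint_add[of f "\<lambda>x. - g x"] vsummable_minus[of g] vint_minus by simp

lemma vint_linear3:
  assumes "vsummable f" "vsummable g" "vsummable h"
  shows "vint (\<lambda>x. f x + (c * g x + d * h x)) = vint f + (c * vint g + d * vint h)"
  using assms by (simp add: vint_add vsummable_add vsummable_cmult vint_cmult)

lemmas vsummable_intros = vsummable_add vsummable_diff vsummable_cmult vsummable_minus

lemma vint_mono:
  "vsummable f \<Longrightarrow> vsummable g \<Longrightarrow> (\<And>x. f x \<le> g x) \<Longrightarrow> vint f \<le> vint g"
  unfolding vsummable_def vint_def by (rule infsum_mono) (auto intro: mult_left_mono)

lemma vint_nonneg: "(\<And>x. f x \<ge> 0) \<Longrightarrow> vint f \<ge> 0"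
  unfolding vint_def by (rule infsum_nonneg) auto

lemma vsummable_comparison:
  "vsummable g \<Longrightarrow> (\<And>x. \<bar>f x\<bar> \<le> g x) \<Longrightarrow> vsummable f"
proof -
  assume g: "vsummable g" and le: "\<And>x. \<bar>f x\<bar> \<le> g x"
  have s: "(\<lambda>x. norm (m x * g x)) summable_on UNIV"
    using g unfolding vsummable_def by (rule summable_on_iff_abs_summable_on_real[THEN iffD1])
  have le': "norm (m x * f x) \<le> norm (m x * g x)" for x
  proof -
    have "\<bar>f x\<bar> \<le> \<bar>g x\<bar>" using le[of x] by linarith
    then show ?thesis by (simp add: abs_mult mult_left_mono)
  qed
  have "(\<lambda>x. norm (m x * f x)) summable_on UNIV"
    by (rule Infinite_Sum.abs_summable_on_comparison_test[OF s]) (rule le')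
  then show ?thesis unfolding vsummable_def by (rule summable_on_iff_abs_summable_on_real[THEN iffD2])
qed

lemma vint_bounded_finite_sums:
  assumes "\<And>x. f x \<ge> 0" "\<And>A. finite A \<Longrightarrow> (\<Sum>x\<in>A. m x * f x) \<le> C"
  shows "vsummable f" "vint f \<le> C"
proof -
  show s: "vsummable f" unfolding vsummable_def
    by (rule nonneg_bdd_above_summable_on) (use assms in \<open>auto intro!: bdd_aboveI[of _ C]\<close>)
  show "vint f \<le> C" unfolding vint_def
    by (rule infsum_le_finite_sums) (use s assms in \<open>auto simp: vsummable_def\<close>)
qed

lemma finite_sum_le_vint:
  assumes "vsummable f" "\<And>x. f x \<ge> 0" "finite A"
  shows "(\<Sum>x\<in>A. m x * f x) \<le> vint f"
  using assms unfolding vsummable_def vint_def by (intro finite_sum_le_infsum) auto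

lemma summation_by_parts:
  assumes "\<phi> \<in> C0"
  shows "vint (\<Gamma> \<phi> f) = - vint (\<lambda>x. \<phi> x * \<Delta> f x)"
proof -
  define S where "S = {x. \<phi> x \<noteq> 0}"
  have S: "finite S" using assms by (simp add: S_def C0_iff)
  have out: "\<phi> x = 0" if "x \<notin> closed_nbhd S" for x using that by (auto simp: S_def closed_nbhd_def)
  have sw: "(\<Sum>x\<in>closed_nbhd S. \<Sum>y\<in>N x. \<omega> x y * (\<phi> y * (f y - f x)))
      = (\<Sum>x\<in>closed_nbhd S. \<Sum>y\<in>N x. \<omega> x y * (\<phi> x * (f x - f y)))"
    by (rule edge_sum_swap) (use S in \<open>auto simp: S_def\<close>)
  have "vint (\<Gamma> \<phi> f) = (\<Sum>x\<in>closed_nbhd S. m x * \<Gamma> \<phi> f x)"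
    by (rule vint_finite) (use S finite_closed_nbhd \<Gamma>_eq_0 S_def in auto)
  also have "\<dots> = (\<Sum>x\<in>closed_nbhd S. (1/2) * (\<Sum>y\<in>N x. \<omega> x y * (\<phi> y - \<phi> x) * (f y - f x)))"
    by (simp add: Gam_def)
  also have "\<dots> = (1/2) * ((\<Sum>x\<in>closed_nbhd S. \<Sum>y\<in>N x. \<omega> x y * (\<phi> y * (f y - f x)))
                    - (\<Sum>x\<in>closed_nbhd S. \<Sum>y\<in>N x. \<omega> x y * (\<phi> x * (f y - f x))))"
    unfolding sum_subtractf[symmetric] sum_distrib_left
    by (intro sum.cong refl) (simp add: field_simps)
  also have "\<dots> = - (\<Sum>x\<in>closed_nbhd S. \<Sum>y\<in>N x. \<omega> x y * (\<phi> x * (f y - f x)))"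
  proof -
    have "(\<Sum>x\<in>closed_nbhd S. \<Sum>y\<in>N x. \<omega> x y * (\<phi> x * (f x - f y)))
        = - (\<Sum>x\<in>closed_nbhd S. \<Sum>y\<in>N x. \<omega> x y * (\<phi> x * (f y - f x)))"
      unfolding sum_negf[symmetric]
      by (intro sum.cong refl) (metis minus_diff_eq mult_minus_right)
    then show ?thesis unfolding sw by simp
  qed
  also have "(\<Sum>x\<in>closed_nbhd S. \<Sum>y\<in>N x. \<omega> x y * (\<phi> x * (f y - f x)))
      = (\<Sum>x\<in>closed_nbhd S. m x * (\<phi> x * \<Delta> f x))"
    by (simp add: laplacian_def sum_distrib_left mult.left_commute)
  also have "\<dots> = vint (\<lambda>x. \<phi> x * \<Delta> f x)"
    by (rule vint_finite(1)[symmetric]) (use S finite_closed_nbhd out in auto)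
  finally show ?thesis .
qed

section \<open>The quadratic form and its completion\<close>

lemma \<Gamma>_add_left: "\<Gamma> (\<lambda>y. f y + g y) h x = \<Gamma> f h x + \<Gamma> g h x"
proof -
  have "(\<Sum>y\<in>N x. \<omega> x y * (f y + g y - (f x + g x)) * (h y - h x))
      = (\<Sum>y\<in>N x. \<omega> x y * (f y - f x) * (h y - h x)) + (\<Sum>y\<in>N x. \<omega> x y * (g y - g x) * (h y - h x))"
    unfolding sum.distrib[symmetric] by (intro sum.cong refl) (simp add: algebra_simps)
  then show ?thesis by (simp add: Gam_def distrib_left add_divide_distrib)
qed
lemma \<Gamma>_cmult_left: "\<Gamma> (\<lambda>y. c * f y) h x = c * \<Gamma> f h x"
  unfolding Gam_def sum_distrib_left by (intro sum.cong refl) (simp add: algebra_simps)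
lemma \<Gamma>_diff_left: "\<Gamma> (\<lambda>y. f y - g y) h x = \<Gamma> f h x - \<Gamma> g h x"
  using \<Gamma>_add_left[of f "\<lambda>y. - 1 * g y" h x] \<Gamma>_cmult_left[of "-1" g h x] by simp
lemma \<Gamma>_add_right: "\<Gamma> h (\<lambda>y. f y + g y) x = \<Gamma> h f x + \<Gamma> h g x"
  by (simp add: \<Gamma>_commute[of h] \<Gamma>_add_left)
lemma \<Gamma>_cmult_right: "\<Gamma> h (\<lambda>y. c * f y) x = c * \<Gamma> h f x"
  by (simp add: \<Gamma>_commute[of h] \<Gamma>_cmult_left)
lemma \<Gamma>_diff_right: "\<Gamma> h (\<lambda>y. f y - g y) x = \<Gamma> h f x - \<Gamma> h g x"
  by (simp add: \<Gamma>_commute[of h] \<Gamma>_diff_left)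
lemmas \<Gamma>_bilinear = \<Gamma>_add_left \<Gamma>_add_right \<Gamma>_cmult_left \<Gamma>_cmult_right \<Gamma>_diff_left \<Gamma>_diff_right

lemma \<Gamma>_nonneg [simp]: "\<Gamma> f f x \<ge> 0"
proof -
  have "(\<Sum>y\<in>N x. \<omega> x y * ((f y - f x) * (f y - f x))) \<ge> 0"
    by (intro sum_nonneg mult_nonneg_nonneg \<omega>_nonneg zero_le_square)
  then show ?thesis by (simp add: Gam_def mult.assoc)
qed

lemma \<Delta>_add: "\<Delta> (\<lambda>y. f y + g y) x = \<Delta> f x + \<Delta> g x"
proof -
  have "(\<Sum>y\<in>N x. \<omega> x y * (f y + g y - (f x + g x)))
      = (\<Sum>y\<in>N x. \<omega> x y * (f y - f x)) + (\<Sum>y\<in>N x. \<omega> x y * (g y - g x))"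
    unfolding sum.distrib[symmetric] by (intro sum.cong refl) (simp add: algebra_simps)
  then show ?thesis by (simp add: laplacian_def add_divide_distrib)
qed
lemma \<Delta>_cmult: "\<Delta> (\<lambda>y. c * f y) x = c * \<Delta> f x"
  unfolding laplacian_def sum_distrib_left by (intro sum.cong refl) (simp add: algebra_simps)
lemma \<Delta>_tendsto:
  "(\<And>y. (\<lambda>k. \<phi> k y) \<longlonglongrightarrow> f y) \<Longrightarrow> (\<lambda>k. \<Delta> (\<phi> k) x) \<longlonglongrightarrow> \<Delta> f x"
  unfolding laplacian_def by (intro tendsto_intros) auto
lemma \<Gamma>_tendsto:
  "(\<And>y. (\<lambda>k. \<phi> k y) \<longlonglongrightarrow> f y) \<Longrightarrow> (\<lambda>k. \<Gamma> (\<phi> k) (\<phi> k) x) \<longlonglongrightarrow> \<Gamma> f f x"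
  unfolding Gam_def by (intro tendsto_intros) auto

lemma ell2_iff: "f \<in> ell2 G \<longleftrightarrow> vsummable (\<lambda>x. (f x)\<^sup>2)"
  by (simp add: ell2_def vsummable_def)
lemma norm2_eq: "norm2 G f = sqrt (vint (\<lambda>x. (f x)\<^sup>2))"
  by (simp add: norm2_def vint_def)
lemma norm2_sq: "(norm2 G f)\<^sup>2 = vint (\<lambda>x. (f x)\<^sup>2)"
  unfolding norm2_eq by (rule real_sqrt_pow2) (rule vint_nonneg, simp)
lemma norm2_nonneg [simp]: "norm2 G f \<ge> 0"
  unfolding norm2_eq by (simp add: vint_nonneg)

lemma C0_ell2 [intro]: "f \<in> C0 \<Longrightarrow> f \<in> ell2 G"
  unfolding ell2_iff power2_eq_square by auto

lemma ell2_mult: 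
  assumes "f \<in> ell2 G" "g \<in> ell2 G"
  shows "vsummable (\<lambda>x. f x * g x)"
proof (rule vsummable_comparison)
  show "vsummable (\<lambda>x. (f x)\<^sup>2 + (g x)\<^sup>2)" using assms by (simp add: ell2_iff vsummable_add)
  fix x
  have "2 * (\<bar>f x\<bar> * \<bar>g x\<bar>) \<le> (f x)\<^sup>2 + (g x)\<^sup>2"
    using sum_squares_bound[of "\<bar>f x\<bar>" "\<bar>g x\<bar>"] by (simp add: mult.assoc)
  moreover have "\<bar>f x\<bar> * \<bar>g x\<bar> \<ge> 0" by simp
  ultimately show "\<bar>f x * g x\<bar> \<le> (f x)\<^sup>2 + (g x)\<^sup>2" unfolding abs_mult by linarith
qed

lemma ell2_cmult: "f \<in> ell2 G \<Longrightarrow> (\<lambda>x. c * f x) \<in> ell2 G"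
  unfolding ell2_iff power_mult_distrib by (rule vsummable_cmult)
lemma ell2_add:
  assumes "f \<in> ell2 G" "g \<in> ell2 G"
  shows "(\<lambda>x. f x + g x) \<in> ell2 G"
proof -
  have "vsummable (\<lambda>x. (f x)\<^sup>2 + (g x)\<^sup>2 + 2 * (f x * g x))"
    using assms ell2_mult[OF assms] unfolding ell2_iff by (intro vsummable_intros)
  then show ?thesis unfolding ell2_iff power2_sum by (simp add: mult.assoc)
qed
lemma ell2_diff:
  "f \<in> ell2 G \<Longrightarrow> g \<in> ell2 G \<Longrightarrow> (\<lambda>x. f x - g x) \<in> ell2 G"
  using ell2_add[of f "\<lambda>x. -1 * g x"] ell2_cmult[of g "-1"] by simp
lemma Cauchy_Schwarz_vint:
  assumes f: "f \<in> ell2 G" and g: "g \<in> ell2 G"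
  shows "\<bar>vint (\<lambda>x. f x * g x)\<bar> \<le> norm2 G f * norm2 G g"
proof -
  have "(vint (\<lambda>x. f x * g x))\<^sup>2 \<le> vint (\<lambda>x. (f x)\<^sup>2) * vint (\<lambda>x. (g x)\<^sup>2)"
  proof (rule quadratic_nonneg_discriminant)
    fix t :: real
    have "0 \<le> vint (\<lambda>x. (f x + t * g x)\<^sup>2)" by (rule vint_nonneg) simp
    also have "(\<lambda>x. (f x + t * g x)\<^sup>2) = (\<lambda>x. (f x)\<^sup>2 + ((2*t) * (f x * g x) + t\<^sup>2 * (g x)\<^sup>2))"
      by (auto simp: power2_eq_square algebra_simps)
    also have "vint \<dots> = vint (\<lambda>x. (f x)\<^sup>2) + ((2*t) * vint (\<lambda>x. f x * g x) + t\<^sup>2 * vint (\<lambda>x. (g x)\<^sup>2))"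
      using ell2_mult[OF f g] f g unfolding ell2_iff by (intro vint_linear3)
    finally show "0 \<le> vint (\<lambda>x. (f x)\<^sup>2) + 2 * t * vint (\<lambda>x. f x * g x) + t\<^sup>2 * vint (\<lambda>x. (g x)\<^sup>2)"
      by simp
  qed
  also have "\<dots> = (norm2 G f * norm2 G g)\<^sup>2" by (simp add: power_mult_distrib norm2_sq)
  finally show ?thesis by (metis abs_le_square_iff abs_mult abs_of_nonneg norm2_nonneg)
qed

text \<open>
  The square of the form norm, on functions of finite support.
\<close>
definition form :: "('v \<Rightarrow> real) \<Rightarrow> real" where
  "form \<phi> = vint (\<lambda>x. \<Gamma> \<phi> \<phi> x + (\<phi> x)\<^sup>2)"

lemma C0_power2 [intro]: "f \<in> C0 \<Longrightarrow> (\<lambda>x. (f x)\<^sup>2) \<in> C0"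
  unfolding power2_eq_square by blast
lemma C0_cmult [intro]: "f \<in> C0 \<Longrightarrow> (\<lambda>x. c * f x) \<in> C0" by (rule C0_mult_right)

lemma Qform_C0:
  assumes "\<phi> \<in> C0"
  shows "Qform G \<phi> \<phi> = vint (\<Gamma> \<phi> \<phi>)"
proof -
  define S where "S = {x. \<phi> x \<noteq> 0}"
  have S: "finite S" using assms by (simp add: S_def C0_iff)
  define B where "B x y = (\<phi> y - \<phi> x) * (\<phi> y - \<phi> x)" for x y
  have B0: "B x y = 0" if "x \<notin> S" "y \<notin> S" for x y using that by (auto simp: B_def S_def)
  have "(\<Sum>\<^sub>\<infinity>(x, y). \<omega> x y * (\<phi> y - \<phi> x) * (\<phi> y - \<phi> x))
      = infsum (\<lambda>(x, y). \<omega> x y * B x y) (closed_nbhd S \<times> closed_nbhd S)"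
  proof (rule infsum_cong_neutral)
    fix z assume z: "z \<in> UNIV - closed_nbhd S \<times> closed_nbhd S"
    obtain x y where xy: "z = (x, y)" by (cases z)
    have "\<omega> x y * B x y = 0"
    proof (cases "y \<in> N x")
      case True
      then have "x \<notin> S" "y \<notin> S" using z xy N_sym[of y x] by (auto simp: closed_nbhd_def)
      then show ?thesis using B0 by simp
    qed (simp add: \<omega>_zero)
    then show "(case z of (x, y) \<Rightarrow> \<omega> x y * (\<phi> y - \<phi> x) * (\<phi> y - \<phi> x)) = 0"
      by (simp add: xy B_def mult.assoc)
  qed (auto simp: B_def mult.assoc)
  also have "\<dots> = (\<Sum>x\<in>closed_nbhd S. \<Sum>y\<in>closed_nbhd S. \<omega> x y * B x y)"
    using finite_closed_nbhd[OF S] by (simp add: sum.cartesian_product)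
  also have "\<dots> = (\<Sum>x\<in>closed_nbhd S. \<Sum>y\<in>N x. \<omega> x y * B x y)"
    by (rule sum.cong[OF refl], rule nbr_sum_eq_closed_nbhd_sum[symmetric, OF S], rule B0)
  also have "\<dots> = 2 * (\<Sum>x\<in>closed_nbhd S. m x * \<Gamma> \<phi> \<phi> x)"
    by (simp add: Gam_def B_def sum_distrib_left mult.assoc)
  also have "(\<Sum>x\<in>closed_nbhd S. m x * \<Gamma> \<phi> \<phi> x) = vint (\<Gamma> \<phi> \<phi>)"
    by (rule vint_finite(1)[symmetric]) (use S finite_closed_nbhd \<Gamma>_eq_0 S_def in auto)
  finally show ?thesis by (simp add: Qform_def)
qed

lemma form_split: "\<phi> \<in> C0 \<Longrightarrow> form \<phi> = vint (\<Gamma> \<phi> \<phi>) + vint (\<lambda>x. (\<phi> x)\<^sup>2)"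
  unfolding form_def by (rule vint_add) auto

lemma form_nonneg: "form \<phi> \<ge> 0"
  unfolding form_def by (rule vint_nonneg) simp

lemma normQ_C0: "\<phi> \<in> C0 \<Longrightarrow> normQ G \<phi> = sqrt (form \<phi>)"
  by (simp add: normQ_def Qform_C0 form_split norm2_sq)

lemma vint_\<Gamma>_nonneg: "vint (\<Gamma> \<phi> \<phi>) \<ge> 0"
  by (rule vint_nonneg) simp
lemma vint_sq_nonneg: "vint (\<lambda>x. (\<phi> x)\<^sup>2) \<ge> 0"
  by (rule vint_nonneg) simp

lemma form_add_le:
  assumes "\<phi> \<in> C0" "\<psi> \<in> C0"
  shows "form (\<lambda>x. \<phi> x + \<psi> x) \<le> 2 * form \<phi> + 2 * form \<psi>"
proof -
  have "form (\<lambda>x. \<phi> x + \<psi> x)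
      \<le> vint (\<lambda>x. 2 * (\<Gamma> \<phi> \<phi> x + (\<phi> x)\<^sup>2) + 2 * (\<Gamma> \<psi> \<psi> x + (\<psi> x)\<^sup>2))"
    unfolding form_def
  proof (rule vint_mono)
    fix x
    have "0 \<le> \<Gamma> (\<lambda>x. \<phi> x - \<psi> x) (\<lambda>x. \<phi> x - \<psi> x) x" "0 \<le> (\<phi> x - \<psi> x)\<^sup>2" by simp_all
    then show "\<Gamma> (\<lambda>x. \<phi> x + \<psi> x) (\<lambda>x. \<phi> x + \<psi> x) x + (\<phi> x + \<psi> x)\<^sup>2
        \<le> 2 * (\<Gamma> \<phi> \<phi> x + (\<phi> x)\<^sup>2) + 2 * (\<Gamma> \<psi> \<psi> x + (\<psi> x)\<^sup>2)"
      unfolding \<Gamma>_bilinear power2_sum power2_diff by (simp add: \<Gamma>_commute)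
  qed (use assms in \<open>fast+\<close>)
  also have "\<dots> = 2 * form \<phi> + 2 * form \<psi>"
    unfolding form_def vint_cmult[symmetric] by (rule vint_add) (use assms in fast)+
  finally show ?thesis .
qed

lemma form_cmult: "form (\<lambda>x. c * \<phi> x) = c\<^sup>2 * form \<phi>"
  unfolding form_def vint_cmult[symmetric] \<Gamma>_bilinear
  by (simp add: power2_eq_square algebra_simps)

text \<open>
  Cauchy-Schwarz for the energy alone, stated with the full form norm because that is the
  quantity which Cauchy sequences control.
\<close>
lemma Cauchy_Schwarz_energy:
  assumes "\<phi> \<in> C0" "\<psi> \<in> C0"
  shows "\<bar>vint (\<Gamma> \<phi> \<psi>)\<bar> \<le> sqrt (form \<phi>) * sqrt (form \<psi>)"
proof -
  have "(vint (\<Gamma> \<phi> \<psi>))\<^sup>2 \<le> vint (\<Gamma> \<phi> \<phi>) * vint (\<Gamma> \<psi> \<psi>)"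
  proof (rule quadratic_nonneg_discriminant)
    fix t :: real
    have "0 \<le> vint (\<Gamma> (\<lambda>x. \<phi> x + t * \<psi> x) (\<lambda>x. \<phi> x + t * \<psi> x))" by (rule vint_\<Gamma>_nonneg)
    also have "\<Gamma> (\<lambda>x. \<phi> x + t * \<psi> x) (\<lambda>x. \<phi> x + t * \<psi> x)
        = (\<lambda>x. \<Gamma> \<phi> \<phi> x + ((2*t) * \<Gamma> \<phi> \<psi> x + t\<^sup>2 * \<Gamma> \<psi> \<psi> x))"
      by (rule ext) (simp add: \<Gamma>_bilinear \<Gamma>_commute[of \<psi> \<phi>] power2_eq_square algebra_simps)
    also have "vint \<dots> = vint (\<Gamma> \<phi> \<phi>) + ((2*t) * vint (\<Gamma> \<phi> \<psi>) + t\<^sup>2 * vint (\<Gamma> \<psi> \<psi>))"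
      by (rule vint_linear3) (use assms in auto)
    finally show "0 \<le> vint (\<Gamma> \<phi> \<phi>) + 2 * t * vint (\<Gamma> \<phi> \<psi>) + t\<^sup>2 * vint (\<Gamma> \<psi> \<psi>)" by simp
  qed
  also have "\<dots> \<le> form \<phi> * form \<psi>"
    using assms by (intro mult_mono) (auto simp: form_split vint_\<Gamma>_nonneg vint_sq_nonneg add_nonneg_nonneg)
  finally have "sqrt ((vint (\<Gamma> \<phi> \<psi>))\<^sup>2) \<le> sqrt (form \<phi> * form \<psi>)" by (rule real_sqrt_le_mono)
  then show ?thesis by (simp add: real_sqrt_mult)
qed

definition form_Cauchy :: "(nat \<Rightarrow> 'v \<Rightarrow> real) \<Rightarrow> bool" where
  "form_Cauchy \<phi> \<longleftrightarrow> (\<forall>e>0. \<exists>M. \<forall>i\<ge>M. \<forall>j\<ge>M. form (\<lambda>x. \<phi> i x - \<phi> j x) < e)"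

lemma form_CauchyD:
  "form_Cauchy \<phi> \<Longrightarrow> e > 0 \<Longrightarrow> \<exists>M. \<forall>i\<ge>M. \<forall>j\<ge>M. form (\<lambda>x. \<phi> i x - \<phi> j x) < e"
  by (simp add: form_Cauchy_def)

lemma form_CauchyI:
  assumes le: "\<And>i j. form (\<lambda>x. \<phi> i x - \<phi> j x) \<le> c i + c j" and c: "c \<longlonglongrightarrow> 0"
  shows "form_Cauchy \<phi>"
  unfolding form_Cauchy_def
proof (intro allI impI)
  fix e :: real assume "e > 0"
  then have "e / 2 > 0" by simp
  then obtain M where M: "\<And>k. k \<ge> M \<Longrightarrow> \<bar>c k\<bar> < e / 2"
    using LIMSEQ_D[OF c] by (metis diff_zero real_norm_def)
  show "\<exists>M. \<forall>i\<ge>M. \<forall>j\<ge>M. form (\<lambda>x. \<phi> i x - \<phi> j x) < e"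
  proof (intro exI allI impI)
    fix i j assume ij: "i \<ge> M" "j \<ge> M"
    show "form (\<lambda>x. \<phi> i x - \<phi> j x) < e" using le[of i j] M[OF ij(1)] M[OF ij(2)] by argo
  qed
qed

lemma normQ_Cauchy_iff:
  assumes "\<And>k. \<phi> k \<in> C0"
  shows "(\<forall>e>0. \<exists>M. \<forall>i\<ge>M. \<forall>j\<ge>M. normQ G (\<lambda>x. \<phi> i x - \<phi> j x) < e) \<longleftrightarrow> form_Cauchy \<phi>"
proof -
  have eq: "normQ G (\<lambda>x. \<phi> i x - \<phi> j x) = sqrt (form (\<lambda>x. \<phi> i x - \<phi> j x))" for i j
    by (rule normQ_C0) (use assms in blast)
  show ?thesis unfolding eq form_Cauchy_def
  proof safe
    fix e :: real assume "\<forall>e>0. \<exists>M. \<forall>i\<ge>M. \<forall>j\<ge>M. sqrt (form (\<lambda>x. \<phi> i x - \<phi> j x)) < e" "e > 0"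
    then obtain M where "\<forall>i\<ge>M. \<forall>j\<ge>M. sqrt (form (\<lambda>x. \<phi> i x - \<phi> j x)) < sqrt e"
      by (meson real_sqrt_gt_zero)
    then show "\<exists>M. \<forall>i\<ge>M. \<forall>j\<ge>M. form (\<lambda>x. \<phi> i x - \<phi> j x) < e" by auto
  next
    fix e :: real assume "\<forall>e>0. \<exists>M. \<forall>i\<ge>M. \<forall>j\<ge>M. form (\<lambda>x. \<phi> i x - \<phi> j x) < e" "e > 0"
    then obtain M where "\<forall>i\<ge>M. \<forall>j\<ge>M. form (\<lambda>x. \<phi> i x - \<phi> j x) < e\<^sup>2"
      by (meson zero_less_power)
    then show "\<exists>M. \<forall>i\<ge>M. \<forall>j\<ge>M. sqrt (form (\<lambda>x. \<phi> i x - \<phi> j x)) < e" using \<open>e > 0\<close>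
      by (intro exI[of _ M]) (auto intro: real_less_lsqrt)
  qed
qed

lemma pointwise_sq_le_form:
  assumes "\<phi> \<in> C0" shows "m x * (\<phi> x)\<^sup>2 \<le> form \<phi>"
proof -
  have "m x * (\<phi> x)\<^sup>2 = (\<Sum>z\<in>{x}. m z * (\<phi> z)\<^sup>2)" by simp
  also have "\<dots> \<le> vint (\<lambda>x. (\<phi> x)\<^sup>2)"
    by (rule finite_sum_le_vint) (use assms in auto)
  finally show ?thesis using assms vint_\<Gamma>_nonneg[of \<phi>] by (simp add: form_split)
qed

lemma form_Cauchy_pointwise:
  assumes C0: "\<And>k. \<phi> k \<in> C0" and Cau: "form_Cauchy \<phi>"
  shows "convergent (\<lambda>k. \<phi> k x)"
  unfolding Cauchy_convergent_iff[symmetric]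
proof (rule metric_CauchyI)
  fix e :: real assume e: "e > 0"
  then have pos: "m x * e\<^sup>2 > 0" by simp
  then obtain M where M: "\<forall>i\<ge>M. \<forall>j\<ge>M. form (\<lambda>x. \<phi> i x - \<phi> j x) < m x * e\<^sup>2"
    using form_CauchyD[OF Cau pos] by blast
  show "\<exists>M. \<forall>i\<ge>M. \<forall>j\<ge>M. dist (\<phi> i x) (\<phi> j x) < e"
  proof (intro exI allI impI)
    fix i j assume "i \<ge> M" "j \<ge> M"
    then have "m x * (\<phi> i x - \<phi> j x)\<^sup>2 < m x * e\<^sup>2"
      using M pointwise_sq_le_form[of "\<lambda>x. \<phi> i x - \<phi> j x" x, OF C0_diff[OF C0 C0]]
      by (meson le_less_trans)
    then have "(\<phi> i x - \<phi> j x)\<^sup>2 < e\<^sup>2" by simp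
    then have "\<bar>\<phi> i x - \<phi> j x\<bar> < e" using e power2_less_imp_less[of "\<bar>\<phi> i x - \<phi> j x\<bar>" e] by simp
    then show "dist (\<phi> i x) (\<phi> j x) < e" by (simp add: dist_real_def)
  qed
qed

text \<open>
  Completeness of \<open>\<ell>\<^sup>2\<close> in the shape needed here: values at a vertex are controlled by the
  form norm, so pointwise limits exist, and Fatou's lemma for finite partial sums upgrades pointwise
  convergence to convergence in norm.
\<close>
lemma form_Cauchy_limit:
  assumes C0: "\<And>k. \<phi> k \<in> C0" and Cau: "form_Cauchy \<phi>"
    and lim: "\<And>x. (\<lambda>k. \<phi> k x) \<longlonglongrightarrow> u x"
  shows "u \<in> domQ G" and "(\<lambda>k. norm2 G (\<lambda>x. \<phi> k x - u x)) \<longlonglongrightarrow> 0"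
proof -
  have bound: "vsummable (\<lambda>x. (\<phi> i x - u x)\<^sup>2) \<and> vint (\<lambda>x. (\<phi> i x - u x)\<^sup>2) \<le> e"
    if M: "\<forall>i\<ge>M. \<forall>j\<ge>M. form (\<lambda>x. \<phi> i x - \<phi> j x) < e" and i: "i \<ge> M" for M e i
  proof -
    have "(\<Sum>x\<in>A. m x * (\<phi> i x - u x)\<^sup>2) \<le> e" if A: "finite A" for A
    proof (rule LIMSEQ_le_const2)
      show "(\<lambda>j. \<Sum>x\<in>A. m x * (\<phi> i x - \<phi> j x)\<^sup>2) \<longlonglongrightarrow> (\<Sum>x\<in>A. m x * (\<phi> i x - u x)\<^sup>2)"
        by (intro tendsto_intros lim)
      have "(\<Sum>x\<in>A. m x * (\<phi> i x - \<phi> j x)\<^sup>2) \<le> e" if "j \<ge> M" for j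
      proof -
        have d: "(\<lambda>x. \<phi> i x - \<phi> j x) \<in> C0" using C0 by blast
        have "(\<Sum>x\<in>A. m x * (\<phi> i x - \<phi> j x)\<^sup>2) \<le> vint (\<lambda>x. (\<phi> i x - \<phi> j x)\<^sup>2)"
          by (rule finite_sum_le_vint) (use d A in auto)
        also have "\<dots> \<le> form (\<lambda>x. \<phi> i x - \<phi> j x)"
          using d vint_\<Gamma>_nonneg by (simp add: form_split)
        also have "\<dots> \<le> e" using M i that by (meson less_imp_le)
        finally show ?thesis .
      qed
      then show "\<exists>N. \<forall>j\<ge>N. (\<Sum>x\<in>A. m x * (\<phi> i x - \<phi> j x)\<^sup>2) \<le> e" by blast
    qed
    then show ?thesis using vint_bounded_finite_sums[of "\<lambda>x. (\<phi> i x - u x)\<^sup>2" e] by simp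
  qed
  show conv: "(\<lambda>k. norm2 G (\<lambda>x. \<phi> k x - u x)) \<longlonglongrightarrow> 0"
  proof (rule LIMSEQ_I)
    fix r :: real assume r: "r > 0"
    then have pos: "(r/2)\<^sup>2 > 0" by simp
    then obtain M where M: "\<forall>i\<ge>M. \<forall>j\<ge>M. form (\<lambda>x. \<phi> i x - \<phi> j x) < (r/2)\<^sup>2"
      using form_CauchyD[OF Cau pos] by blast
    have "norm2 G (\<lambda>x. \<phi> i x - u x) < r" if "i \<ge> M" for i
    proof -
      have "(norm2 G (\<lambda>x. \<phi> i x - u x))\<^sup>2 \<le> (r/2)\<^sup>2" using bound[OF M that] by (simp add: norm2_sq)
      then have "norm2 G (\<lambda>x. \<phi> i x - u x) \<le> r/2" using r by (simp add: power2_le_iff_abs_le)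
      then show ?thesis using r by linarith
    qed
    then show "\<exists>no. \<forall>n\<ge>no. norm (norm2 G (\<lambda>x. \<phi> n x - u x) - 0) < r" by auto
  qed
  obtain M where M: "\<forall>i\<ge>M. \<forall>j\<ge>M. form (\<lambda>x. \<phi> i x - \<phi> j x) < 1"
    using form_CauchyD[OF Cau, of 1] by auto
  have "(\<lambda>x. \<phi> M x - u x) \<in> ell2 G" using bound[OF M, of M] by (simp add: ell2_iff)
  from ell2_diff[OF C0_ell2[OF C0[of M]] this] have "u \<in> ell2 G" by simp
  then show "u \<in> domQ G" unfolding domQ_def using C0 Cau conv normQ_Cauchy_iff[of \<phi>] by blast
qed

section \<open>Green's formula on the operator domain\<close>

lemma domQ_ell2: "f \<in> domQ G \<Longrightarrow> f \<in> ell2 G" by (simp add: domQ_def)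

lemma norm2_limit_pointwise:
  assumes ell: "\<And>k. (\<lambda>x. \<phi> k x - f x) \<in> ell2 G"
    and lim: "(\<lambda>k. norm2 G (\<lambda>x. \<phi> k x - f x)) \<longlonglongrightarrow> 0"
  shows "(\<lambda>k. \<phi> k x) \<longlonglongrightarrow> f x"
proof -
  have "(\<lambda>k. \<phi> k x - f x) \<longlonglongrightarrow> 0"
  proof (rule Lim_null_comparison)
    show "\<forall>\<^sub>F k in sequentially. norm (\<phi> k x - f x) \<le> norm2 G (\<lambda>x. \<phi> k x - f x) / sqrt (m x)"
    proof (rule always_eventually, rule allI)
      fix k
      have "m x * (\<phi> k x - f x)\<^sup>2 = (\<Sum>z\<in>{x}. m z * (\<phi> k z - f z)\<^sup>2)" by simp
      also have "\<dots> \<le> vint (\<lambda>x. (\<phi> k x - f x)\<^sup>2)"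
        by (rule finite_sum_le_vint) (use ell[of k] in \<open>auto simp: ell2_iff\<close>)
      finally have "sqrt (m x * (\<phi> k x - f x)\<^sup>2) \<le> norm2 G (\<lambda>x. \<phi> k x - f x)"
        unfolding norm2_eq by (rule real_sqrt_le_mono)
      then show "norm (\<phi> k x - f x) \<le> norm2 G (\<lambda>x. \<phi> k x - f x) / sqrt (m x)"
        by (simp add: real_sqrt_mult field_simps)
    qed
    show "(\<lambda>k. norm2 G (\<lambda>x. \<phi> k x - f x) / sqrt (m x)) \<longlonglongrightarrow> 0"
      using tendsto_divide[OF lim tendsto_const[of "sqrt (m x)"]] by simp
  qed
  then show ?thesis by (rule LIM_zero_cancel)
qed

definition approximates :: "(nat \<Rightarrow> 'v \<Rightarrow> real) \<Rightarrow> ('v \<Rightarrow> real) \<Rightarrow> bool" where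
  "approximates \<phi> f \<longleftrightarrow> (\<forall>k. \<phi> k \<in> C0) \<and> form_Cauchy \<phi> \<and>
     (\<lambda>k. norm2 G (\<lambda>x. \<phi> k x - f x)) \<longlonglongrightarrow> 0 \<and> (\<forall>x. (\<lambda>k. \<phi> k x) \<longlonglongrightarrow> f x)"

lemma approximatesD:
  assumes "approximates \<phi> f"
  shows "\<phi> k \<in> C0" "form_Cauchy \<phi>" "(\<lambda>k. norm2 G (\<lambda>x. \<phi> k x - f x)) \<longlonglongrightarrow> 0" "(\<lambda>k. \<phi> k x) \<longlonglongrightarrow> f x"
  using assms by (auto simp: approximates_def)

lemma domQ_approx:
  assumes "f \<in> domQ G"
  shows "\<exists>\<phi>. approximates \<phi> f"
proof -
  obtain \<phi> where \<phi>: "\<And>k. \<phi> k \<in> C0"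
    "\<forall>e>0. \<exists>M. \<forall>i\<ge>M. \<forall>j\<ge>M. normQ G (\<lambda>x. \<phi> i x - \<phi> j x) < e"
    "(\<lambda>k. norm2 G (\<lambda>x. \<phi> k x - f x)) \<longlonglongrightarrow> 0"
    using assms unfolding domQ_def by blast
  have Cau: "form_Cauchy \<phi>" using normQ_Cauchy_iff[of \<phi>] \<phi> by blast
  have "(\<lambda>x. \<phi> k x - f x) \<in> ell2 G" for k by (rule ell2_diff[OF C0_ell2[OF \<phi>(1)] domQ_ell2[OF assms]])
  from norm2_limit_pointwise[OF this \<phi>(3)] show ?thesis
    unfolding approximates_def using \<phi>(1,3) Cau by blast
qed

lemma form_zero: "form (\<lambda>x. 0) = 0"
proof -
  have "\<Gamma> (\<lambda>x. 0) (\<lambda>x. 0) x = 0" for x by (simp add: Gam_def)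
  then show ?thesis by (simp add: form_def)
qed

lemma C0_domQ: assumes "\<phi> \<in> C0" shows "\<phi> \<in> domQ G"
  by (rule form_Cauchy_limit(1)[of "\<lambda>k. \<phi>"]) (use assms in \<open>auto simp: form_Cauchy_def form_zero\<close>)

lemma domQ_lincomb:
  assumes "f \<in> domQ G" "g \<in> domQ G"
  shows "(\<lambda>x. f x + t * g x) \<in> domQ G"
proof -
  obtain \<phi> where "approximates \<phi> f" using domQ_approx[OF assms(1)] by blast
  note \<phi> = approximatesD[OF this]
  obtain \<psi> where "approximates \<psi> g" using domQ_approx[OF assms(2)] by blast
  note \<psi> = approximatesD[OF this]
  define \<xi> where "\<xi> k x = \<phi> k x + t * \<psi> k x" for k x
  have C: "\<xi> k \<in> C0" for k unfolding \<xi>_def by (intro C0_add C0_cmult \<phi> \<psi>)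
  have "form_Cauchy \<xi>" unfolding form_Cauchy_def
  proof (intro allI impI)
    fix e :: real assume e: "e > 0"
    have e1: "e/4 > 0" and e2: "e/(4*(t\<^sup>2+1)) > 0" using e by (auto intro!: divide_pos_pos add_nonneg_pos)
    obtain M1 where M1: "\<forall>i\<ge>M1. \<forall>j\<ge>M1. form (\<lambda>x. \<phi> i x - \<phi> j x) < e/4"
      using form_CauchyD[OF \<phi>(2) e1] by blast
    obtain M2 where M2: "\<forall>i\<ge>M2. \<forall>j\<ge>M2. form (\<lambda>x. \<psi> i x - \<psi> j x) < e/(4*(t\<^sup>2+1))"
      using form_CauchyD[OF \<psi>(2) e2] by blast
    show "\<exists>M. \<forall>i\<ge>M. \<forall>j\<ge>M. form (\<lambda>x. \<xi> i x - \<xi> j x) < e"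
    proof (intro exI allI impI)
      fix i j assume ij: "i \<ge> max M1 M2" "j \<ge> max M1 M2"
      have "(\<lambda>x. \<xi> i x - \<xi> j x) = (\<lambda>x. (\<phi> i x - \<phi> j x) + t * (\<psi> i x - \<psi> j x))"
        by (auto simp: \<xi>_def algebra_simps)
      then have "form (\<lambda>x. \<xi> i x - \<xi> j x)
          \<le> 2 * form (\<lambda>x. \<phi> i x - \<phi> j x) + 2 * form (\<lambda>x. t * (\<psi> i x - \<psi> j x))"
        by (simp only:, intro form_add_le C0_cmult C0_diff \<phi> \<psi>)
      also have "form (\<lambda>x. t * (\<psi> i x - \<psi> j x)) = t\<^sup>2 * form (\<lambda>x. \<psi> i x - \<psi> j x)"
        by (rule form_cmult)
      also have "t\<^sup>2 * form (\<lambda>x. \<psi> i x - \<psi> j x) \<le> t\<^sup>2 * (e/(4*(t\<^sup>2+1)))"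
        using M2 ij by (intro mult_left_mono) (auto intro: less_imp_le)
      also have "\<dots> < e/4" using e by (simp add: field_simps add_pos_nonneg)
      also have "form (\<lambda>x. \<phi> i x - \<phi> j x) < e/4" using M1 ij by auto
      finally show "form (\<lambda>x. \<xi> i x - \<xi> j x) < e" by simp
    qed
  qed
  moreover have "(\<lambda>k. \<xi> k x) \<longlonglongrightarrow> f x + t * g x" for x
    unfolding \<xi>_def by (intro tendsto_intros \<phi>(4) \<psi>(4))
  ultimately show ?thesis by (rule form_Cauchy_limit(1)[OF C])
qed

lemma form_Cauchy_bounded:
  assumes C0: "\<And>k. \<psi> k \<in> C0" and Cau: "form_Cauchy \<psi>"
  obtains B M where "B \<ge> 0" "\<And>k. k \<ge> M \<Longrightarrow> form (\<psi> k) \<le> B"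
proof -
  obtain M where M: "\<forall>i\<ge>M. \<forall>j\<ge>M. form (\<lambda>x. \<psi> i x - \<psi> j x) < 1"
    using form_CauchyD[OF Cau, of 1] by auto
  have "form (\<psi> k) \<le> 2 + 2 * form (\<psi> M)" if "k \<ge> M" for k
  proof -
    have "form (\<lambda>x. (\<psi> k x - \<psi> M x) + \<psi> M x) \<le> 2 * form (\<lambda>x. \<psi> k x - \<psi> M x) + 2 * form (\<psi> M)"
      by (intro form_add_le C0_diff C0)
    moreover have "form (\<lambda>x. \<psi> k x - \<psi> M x) < 1" using M that by simp
    ultimately show ?thesis by simp
  qed
  then show ?thesis using that[of "2 + 2 * form (\<psi> M)" M] form_nonneg[of "\<psi> M"] by simp
qed

lemma vint_mult_tendsto:
  assumes ell: "\<And>k. (\<lambda>x. \<psi> k x - g x) \<in> ell2 G" and g: "g \<in> ell2 G" and h: "h \<in> ell2 G"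
    and lim: "(\<lambda>k. norm2 G (\<lambda>x. \<psi> k x - g x)) \<longlonglongrightarrow> 0"
  shows "(\<lambda>k. vint (\<lambda>x. \<psi> k x * h x)) \<longlonglongrightarrow> vint (\<lambda>x. g x * h x)"
proof -
  have "vint (\<lambda>x. \<psi> k x * h x) - vint (\<lambda>x. g x * h x) = vint (\<lambda>x. (\<psi> k x - g x) * h x)" for k
  proof -
    have "\<psi> k \<in> ell2 G" using ell2_add[OF ell[of k] g] by simp
    then show ?thesis using vint_diff[OF ell2_mult ell2_mult, of "\<psi> k" h g h] g h
      by (simp add: left_diff_distrib)
  qed
  then have le: "norm (vint (\<lambda>x. \<psi> k x * h x) - vint (\<lambda>x. g x * h x))
      \<le> norm2 G (\<lambda>x. \<psi> k x - g x) * norm2 G h" for k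
    using Cauchy_Schwarz_vint[OF ell h] by simp
  have "(\<lambda>k. norm2 G (\<lambda>x. \<psi> k x - g x) * norm2 G h) \<longlonglongrightarrow> 0"
    using tendsto_mult[OF lim tendsto_const[of "norm2 G h"]] by simp
  then have "(\<lambda>k. vint (\<lambda>x. \<psi> k x * h x) - vint (\<lambda>x. g x * h x)) \<longlonglongrightarrow> 0"
    by (rule Lim_null_comparison[rotated]) (use le in \<open>auto intro!: always_eventually\<close>)
  then show ?thesis by (rule LIM_zero_cancel)
qed

text \<open>
  The values of the form on a pair of approximating sequences converge to the pairing of
  the limit of one with the negative Laplacian of the limit of the other.  Freezing \<open>\<psi> k\<close>, summation by
  parts is exact and only finitely many vertices matter, so the limit in
  \<open>\<phi>\<close> may be taken pointwise; the Cauchy property makes the resulting error uniform in \<open>k\<close>.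
\<close>
lemma energy_pairing_tendsto:
  assumes \<phi>: "\<And>k. \<phi> k \<in> C0" "form_Cauchy \<phi>" "\<And>x. (\<lambda>k. \<phi> k x) \<longlonglongrightarrow> f x"
    and \<psi>: "\<And>k. \<psi> k \<in> C0" "form_Cauchy \<psi>" "(\<lambda>k. norm2 G (\<lambda>x. \<psi> k x - g x)) \<longlonglongrightarrow> 0"
    and g: "g \<in> ell2 G" and df: "\<Delta> f \<in> ell2 G"
  shows "(\<lambda>k. vint (\<Gamma> (\<phi> k) (\<psi> k))) \<longlonglongrightarrow> - vint (\<lambda>x. g x * \<Delta> f x)"
proof -
  define r where "r k = vint (\<Gamma> (\<phi> k) (\<psi> k)) + vint (\<lambda>x. \<psi> k x * \<Delta> f x)" for k
  obtain B M0 where B: "B \<ge> 0" "\<And>k. k \<ge> M0 \<Longrightarrow> form (\<psi> k) \<le> B"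
    using form_Cauchy_bounded[OF \<psi>(1,2)] by blast
  have lim: "(\<lambda>j. vint (\<Gamma> (\<lambda>x. \<phi> k x - \<phi> j x) (\<psi> k))) \<longlonglongrightarrow> r k" for k
  proof -
    have fin: "finite {x. \<psi> k x \<noteq> 0}" using \<psi>(1)[of k] by (simp add: C0_iff)
    have sum: "vint (\<lambda>x. \<psi> k x * h x) = (\<Sum>x\<in>{x. \<psi> k x \<noteq> 0}. m x * (\<psi> k x * h x))" for h
      by (rule vint_finite) (use fin in auto)
    have eq: "vint (\<Gamma> (\<lambda>x. \<phi> k x - \<phi> j x) (\<psi> k))
        = vint (\<Gamma> (\<phi> k) (\<psi> k)) + vint (\<lambda>x. \<psi> k x * \<Delta> (\<phi> j) x)" for j
    proof -
      have "vint (\<Gamma> (\<lambda>x. \<phi> k x - \<phi> j x) (\<psi> k)) = vint (\<lambda>x. \<Gamma> (\<phi> k) (\<psi> k) x - \<Gamma> (\<phi> j) (\<psi> k) x)"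
        by (simp add: \<Gamma>_bilinear[abs_def])
      also have "\<dots> = vint (\<Gamma> (\<phi> k) (\<psi> k)) - vint (\<Gamma> (\<phi> j) (\<psi> k))"
        by (intro vint_diff vsummable_C0 C0_\<Gamma> \<phi>)
      also have "vint (\<Gamma> (\<phi> j) (\<psi> k)) = vint (\<Gamma> (\<psi> k) (\<phi> j))"
        by (simp add: \<Gamma>_commute[of "\<phi> j", abs_def])
      finally show ?thesis using summation_by_parts[OF \<psi>(1)] by simp
    qed
    show ?thesis unfolding eq r_def sum by (intro tendsto_intros \<Delta>_tendsto \<phi>)
  qed
  have r0: "r \<longlonglongrightarrow> 0"
  proof (rule LIMSEQ_I)
    fix e :: real assume e: "e > 0"
    define d where "d = (e / (2 * (sqrt B + 1)))\<^sup>2"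
    have sB: "sqrt B \<ge> 0" using B by simp
    then have sB1: "sqrt B + 1 > 0" by (rule add_nonneg_pos) simp
    have "2 * (sqrt B + 1) > 0" using sB1 by simp
    then have "e / (2 * (sqrt B + 1)) > 0" by (rule divide_pos_pos[OF e])
    then have d: "d > 0" unfolding d_def by (rule zero_less_power)
    obtain M1 where M1: "\<forall>i\<ge>M1. \<forall>j\<ge>M1. form (\<lambda>x. \<phi> i x - \<phi> j x) < d"
      using form_CauchyD[OF \<phi>(2) d] by blast
    have "norm (r k - 0) < e" if k: "k \<ge> max M0 M1" for k
    proof -
      have "\<bar>r k\<bar> \<le> e / 2"
      proof (rule LIMSEQ_le_const2)
        show "(\<lambda>j. \<bar>vint (\<Gamma> (\<lambda>x. \<phi> k x - \<phi> j x) (\<psi> k))\<bar>) \<longlonglongrightarrow> \<bar>r k\<bar>"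
          by (intro tendsto_rabs lim)
        have "\<bar>vint (\<Gamma> (\<lambda>x. \<phi> k x - \<phi> j x) (\<psi> k))\<bar> \<le> e/2" if j: "j \<ge> M1" for j
        proof -
          have "\<bar>vint (\<Gamma> (\<lambda>x. \<phi> k x - \<phi> j x) (\<psi> k))\<bar> \<le> sqrt (form (\<lambda>x. \<phi> k x - \<phi> j x)) * sqrt (form (\<psi> k))"
            by (intro Cauchy_Schwarz_energy C0_diff \<phi> \<psi>)
          also have "\<dots> \<le> sqrt d * sqrt B"
            using M1 k j B d by (intro mult_mono real_sqrt_le_mono real_sqrt_ge_zero form_nonneg)
              (auto intro: less_imp_le)
          also have "sqrt d = e / (2 * (sqrt B + 1))" using e sB by (simp add: d_def)
          also have "e / (2 * (sqrt B + 1)) * sqrt B \<le> e / 2"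
          proof -
            have "sqrt B / (sqrt B + 1) \<le> 1" using sB by (intro divide_le_eq_1_pos[THEN iffD2] sB1) simp
            then have "(e / 2) * (sqrt B / (sqrt B + 1)) \<le> (e / 2) * 1"
              using e by (intro mult_left_mono) auto
            then show ?thesis by (simp add: mult.commute)
          qed
          finally show ?thesis .
        qed
        then show "\<exists>N. \<forall>j\<ge>N. \<bar>vint (\<Gamma> (\<lambda>x. \<phi> k x - \<phi> j x) (\<psi> k))\<bar> \<le> e/2" by blast
      qed
      then show ?thesis using e by simp
    qed
    then show "\<exists>no. \<forall>n\<ge>no. norm (r n - 0) < e" by blast
  qed
  have ell: "(\<lambda>x. \<psi> k x - g x) \<in> ell2 G" for k using ell2_diff[OF C0_ell2[OF \<psi>(1)] g] .
  have "(\<lambda>k. r k - vint (\<lambda>x. \<psi> k x * \<Delta> f x)) \<longlonglongrightarrow> 0 - vint (\<lambda>x. g x * \<Delta> f x)"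
    by (intro tendsto_diff r0 vint_mult_tendsto[OF ell g df \<psi>(3)])
  then show ?thesis by (simp add: r_def)
qed

lemma laplacian_symmetric:
  assumes f: "f \<in> dom_laplacian G" and g: "g \<in> dom_laplacian G"
  shows "vint (\<lambda>x. g x * \<Delta> f x) = vint (\<lambda>x. f x * \<Delta> g x)"
proof -
  have fd: "f \<in> domQ G" "\<Delta> f \<in> ell2 G" and gd: "g \<in> domQ G" "\<Delta> g \<in> ell2 G"
    using f g by (auto simp: dom_laplacian_def)
  obtain \<phi> where "approximates \<phi> f" using domQ_approx[OF fd(1)] by blast
  note \<phi> = approximatesD[OF this]
  obtain \<psi> where "approximates \<psi> g" using domQ_approx[OF gd(1)] by blast
  note \<psi> = approximatesD[OF this]
  have 1: "(\<lambda>k. vint (\<Gamma> (\<phi> k) (\<psi> k))) \<longlonglongrightarrow> - vint (\<lambda>x. g x * \<Delta> f x)"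
    by (rule energy_pairing_tendsto[OF \<phi>(1,2,4) \<psi>(1,2,3) domQ_ell2[OF gd(1)] fd(2)])
  have 2: "(\<lambda>k. vint (\<Gamma> (\<psi> k) (\<phi> k))) \<longlonglongrightarrow> - vint (\<lambda>x. f x * \<Delta> g x)"
    by (rule energy_pairing_tendsto[OF \<psi>(1,2,4) \<phi>(1,2,3) domQ_ell2[OF fd(1)] gd(2)])
  have "\<Gamma> (\<phi> k) (\<psi> k) = \<Gamma> (\<psi> k) (\<phi> k)" for k by (rule ext) (rule \<Gamma>_commute)
  then have "(\<lambda>k. vint (\<Gamma> (\<psi> k) (\<phi> k))) \<longlonglongrightarrow> - vint (\<lambda>x. g x * \<Delta> f x)"
    using 1 by simp
  from LIMSEQ_unique[OF this 2] show ?thesis by simp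
qed

lemma Rayleigh_on_domain:
  assumes f: "f \<in> dom_laplacian G"
    and le: "\<And>\<phi>. \<phi> \<in> C0 \<Longrightarrow> c * vint (\<lambda>x. (\<phi> x)\<^sup>2) \<le> vint (\<Gamma> \<phi> \<phi>)"
  shows "c * vint (\<lambda>x. (f x)\<^sup>2) \<le> - vint (\<lambda>x. f x * \<Delta> f x)"
proof -
  have fd: "f \<in> domQ G" "\<Delta> f \<in> ell2 G" using f by (auto simp: dom_laplacian_def)
  note fe = domQ_ell2[OF fd(1)]
  obtain \<phi> where "approximates \<phi> f" using domQ_approx[OF fd(1)] by blast
  note \<phi> = approximatesD[OF this]
  have ell: "(\<lambda>x. \<phi> k x - f x) \<in> ell2 G" for k using ell2_diff[OF C0_ell2[OF \<phi>(1)] fe] .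
  have "vint (\<lambda>x. (\<phi> k x)\<^sup>2)
      = (norm2 G (\<lambda>x. \<phi> k x - f x))\<^sup>2 + (2 * vint (\<lambda>x. \<phi> k x * f x) + (-1) * vint (\<lambda>x. f x * f x))" for k
  proof -
    have "(\<lambda>x. (\<phi> k x)\<^sup>2) = (\<lambda>x. (\<phi> k x - f x)\<^sup>2 + (2 * (\<phi> k x * f x) + (-1) * (f x * f x)))"
      by (auto simp: power2_eq_square algebra_simps)
    then have "vint (\<lambda>x. (\<phi> k x)\<^sup>2) = vint (\<lambda>x. (\<phi> k x - f x)\<^sup>2 + (2 * (\<phi> k x * f x) + (-1) * (f x * f x)))"
      by simp
    also have "\<dots> = vint (\<lambda>x. (\<phi> k x - f x)\<^sup>2) + (2 * vint (\<lambda>x. \<phi> k x * f x) + (-1) * vint (\<lambda>x. f x * f x))"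
      by (intro vint_linear3 ell2_mult fe C0_ell2 \<phi>) (use ell[of k] in \<open>simp add: ell2_iff\<close>)
    finally show ?thesis by (simp add: norm2_sq)
  qed
  moreover have "(\<lambda>k. (norm2 G (\<lambda>x. \<phi> k x - f x))\<^sup>2 + (2 * vint (\<lambda>x. \<phi> k x * f x) + (-1) * vint (\<lambda>x. f x * f x)))
      \<longlonglongrightarrow> 0\<^sup>2 + (2 * vint (\<lambda>x. f x * f x) + (-1) * vint (\<lambda>x. f x * f x))"
    by (intro tendsto_intros \<phi>(3) vint_mult_tendsto[OF ell fe fe \<phi>(3)])
  ultimately have 1: "(\<lambda>k. vint (\<lambda>x. (\<phi> k x)\<^sup>2)) \<longlonglongrightarrow> vint (\<lambda>x. (f x)\<^sup>2)"
    by (simp add: power2_eq_square)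
  have 2: "(\<lambda>k. vint (\<Gamma> (\<phi> k) (\<phi> k))) \<longlonglongrightarrow> - vint (\<lambda>x. f x * \<Delta> f x)"
    by (rule energy_pairing_tendsto[OF \<phi>(1,2,4) \<phi>(1,2,3) fe fd(2)])
  show ?thesis
    by (rule LIMSEQ_le[OF tendsto_mult[OF tendsto_const 1] 2]) (use le \<phi>(1) in blast)
qed

lemma dom_laplacian_lincomb:
  assumes "f \<in> dom_laplacian G" "g \<in> dom_laplacian G"
  shows "(\<lambda>x. f x + t * g x) \<in> dom_laplacian G"
proof -
  have "\<Delta> (\<lambda>x. f x + t * g x) = (\<lambda>x. \<Delta> f x + t * \<Delta> g x)" by (rule ext) (simp add: \<Delta>_add \<Delta>_cmult)
  then show ?thesis using assms domQ_lincomb[of f g t] ell2_add ell2_cmult by (simp add: dom_laplacian_def)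
qed

lemma C0_dom_laplacian: "\<phi> \<in> C0 \<Longrightarrow> \<phi> \<in> dom_laplacian G"
  unfolding dom_laplacian_def using C0_domQ C0_ell2 C0_\<Delta> by blast

text \<open>
  The functional whose critical points solve \<open>- \<Delta> u + p u = g\<close>.  A constant positive potential
  \<open>p\<close> gives the resolvent equation, the choice \<open>p = 1 - \<theta> \<eta>\<close>, \<open>g = 0\<close> gives the weighted eigenvalue
  problem for the ground state.
\<close>
definition variational_energy :: "('v \<Rightarrow> real) \<Rightarrow> ('v \<Rightarrow> real) \<Rightarrow> ('v \<Rightarrow> real) \<Rightarrow> real" where
  "variational_energy p g \<phi> = vint (\<lambda>x. \<Gamma> \<phi> \<phi> x + p x * (\<phi> x)\<^sup>2 - 2 * g x * \<phi> x)"

lemma variational_energy_integrand_C0: "\<phi> \<in> C0 \<Longrightarrow> (\<lambda>x. \<Gamma> \<phi> \<phi> x + p x * (\<phi> x)\<^sup>2 - 2 * g x * \<phi> x) \<in> C0"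
  by (intro C0_add C0_diff C0_\<Gamma> C0_mult_right[of \<phi>] C0_mult_right C0_power2)

text \<open>
  The parallelogram identity for the quadratic part: two near-minimisers are close, because
  their midpoint cannot do better than the infimum.  This makes minimising sequences Cauchy.
\<close>
lemma variational_energy_parallelogram:
  assumes \<phi>: "\<phi> \<in> C0" and \<psi>: "\<psi> \<in> C0" and low: "\<And>\<xi>. \<xi> \<in> C0 \<Longrightarrow> j \<le> variational_energy p g \<xi>"
  shows "vint (\<lambda>x. \<Gamma> (\<lambda>x. \<phi> x - \<psi> x) (\<lambda>x. \<phi> x - \<psi> x) x + p x * (\<phi> x - \<psi> x)\<^sup>2)
     \<le> 2 * (variational_energy p g \<phi> - j) + 2 * (variational_energy p g \<psi> - j)"
proof -
  define \<xi> where "\<xi> x = (1/2) * (\<phi> x + \<psi> x)" for x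
  have \<xi>: "\<xi> \<in> C0" unfolding \<xi>_def by (intro C0_cmult C0_add \<phi> \<psi>)
  define I where "I \<phi> x = \<Gamma> \<phi> \<phi> x + p x * (\<phi> x)\<^sup>2 - 2 * g x * \<phi> x" for \<phi> x
  have I: "vsummable (I \<phi>)" if "\<phi> \<in> C0" for \<phi> unfolding I_def by (intro vsummable_C0 variational_energy_integrand_C0 that)
  have "\<Gamma> (\<lambda>x. \<phi> x - \<psi> x) (\<lambda>x. \<phi> x - \<psi> x) x + p x * (\<phi> x - \<psi> x)\<^sup>2
      = 2 * I \<phi> x + (2 * I \<psi> x + (-4) * I \<xi> x)" for x
    unfolding I_def \<xi>_def[abs_def] \<Gamma>_bilinear
    by (simp add: \<Gamma>_commute[of \<psi> \<phi>] power2_eq_square field_simps)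
  then have "vint (\<lambda>x. \<Gamma> (\<lambda>x. \<phi> x - \<psi> x) (\<lambda>x. \<phi> x - \<psi> x) x + p x * (\<phi> x - \<psi> x)\<^sup>2)
      = vint (\<lambda>x. 2 * I \<phi> x + (2 * I \<psi> x + (-4) * I \<xi> x))" by simp
  also have "\<dots> = vint (\<lambda>x. 2 * I \<phi> x) + (2 * vint (I \<psi>) + (-4) * vint (I \<xi>))"
    by (intro vint_linear3 vsummable_cmult I \<phi> \<psi> \<xi>)
  also have "\<dots> = 2 * variational_energy p g \<phi> + 2 * variational_energy p g \<psi> - 4 * variational_energy p g \<xi>"
    unfolding vint_cmult by (simp add: variational_energy_def I_def[abs_def])
  finally show ?thesis using low[OF \<xi>] by simp
qed

lemma vint_point: "vint (\<lambda>y. (if y = x then 1 else 0) * h y) = m x * h x"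
proof -
  have "vint (\<lambda>y. (if y = x then 1 else 0) * h y) = (\<Sum>y\<in>{x}. m y * ((if y = x then 1 else 0) * h y))"
    by (rule vint_finite) auto
  then show ?thesis by simp
qed

text \<open>
  Perturbing a minimising sequence at one vertex changes the functional by a quadratic
  polynomial in the size of the perturbation; in the limit its linear coefficient must vanish.  A pointwise
  limit is enough, since that coefficient depends on finitely many values.
\<close>
lemma Euler_Lagrange:
  assumes \<phi>: "\<And>k. \<phi> k \<in> C0" and lim: "\<And>x. (\<lambda>k. \<phi> k x) \<longlonglongrightarrow> u x"
    and min: "(\<lambda>k. variational_energy p g (\<phi> k)) \<longlonglongrightarrow> j" and low: "\<And>\<xi>. \<xi> \<in> C0 \<Longrightarrow> j \<le> variational_energy p g \<xi>"
  shows "- \<Delta> u x + p x * u x = g x"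
proof -
  define \<delta> where "\<delta> y = (if y = x then 1 else 0 :: real)" for y
  have \<delta>: "\<delta> \<in> C0" unfolding \<delta>_def by (rule C0_indicator)
  define D where "D \<phi> = m x * (- \<Delta> \<phi> x + p x * \<phi> x - g x)" for \<phi>
  define E where "E = vint (\<lambda>y. \<Gamma> \<delta> \<delta> y + p y * (\<delta> y)\<^sup>2)"
  have exp: "variational_energy p g (\<lambda>y. \<phi> k y + t * \<delta> y) = variational_energy p g (\<phi> k) + (2 * t * D (\<phi> k) + t\<^sup>2 * E)" for k t
  proof -
    define B where "B y = \<Gamma> (\<phi> k) \<delta> y + \<delta> y * (p y * \<phi> k y - g y)" for y
    have B: "vsummable B" unfolding B_def
      by (intro vsummable_C0 C0_add C0_\<Gamma> C0_mult_left \<phi> \<delta>)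
    have "vint B = vint (\<Gamma> (\<phi> k) \<delta>) + vint (\<lambda>y. \<delta> y * (p y * \<phi> k y - g y))" unfolding B_def
      by (intro vint_add vsummable_C0 C0_\<Gamma> C0_mult_left \<phi> \<delta>)
    also have "\<Gamma> (\<phi> k) \<delta> = \<Gamma> \<delta> (\<phi> k)" by (rule ext) (rule \<Gamma>_commute)
    also have "vint (\<Gamma> \<delta> (\<phi> k)) = - (m x * \<Delta> (\<phi> k) x)"
      using summation_by_parts[OF \<delta>, of "\<phi> k"] vint_point[of x "\<Delta> (\<phi> k)"] by (simp add: \<delta>_def)
    also have "vint (\<lambda>y. \<delta> y * (p y * \<phi> k y - g y)) = m x * (p x * \<phi> k x - g x)"
      unfolding \<delta>_def by (rule vint_point)
    finally have BD: "vint B = D (\<phi> k)" by (simp add: D_def algebra_simps)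
    have "variational_energy p g (\<lambda>y. \<phi> k y + t * \<delta> y)
        = vint (\<lambda>x. (\<Gamma> (\<phi> k) (\<phi> k) x + p x * (\<phi> k x)\<^sup>2 - 2 * g x * \<phi> k x)
            + ((2 * t) * B x + t\<^sup>2 * (\<Gamma> \<delta> \<delta> x + p x * (\<delta> x)\<^sup>2)))"
      unfolding variational_energy_def B_def \<Gamma>_bilinear
      by (simp add: \<Gamma>_commute[of \<delta> "\<phi> k"] power2_eq_square algebra_simps)
    also have "\<dots> = variational_energy p g (\<phi> k) + ((2*t) * vint B + t\<^sup>2 * E)"
      unfolding variational_energy_def E_def
      by (rule vint_linear3)
         (intro vsummable_C0 variational_energy_integrand_C0 \<phi> B C0_add C0_\<Gamma> C0_mult_right C0_power2 \<delta>)+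
    finally show ?thesis by (simp add: BD)
  qed
  have D_lim: "(\<lambda>k. D (\<phi> k)) \<longlonglongrightarrow> D u" unfolding D_def by (intro tendsto_intros \<Delta>_tendsto lim)
  have "(D u)\<^sup>2 \<le> 0 * E"
  proof (rule quadratic_nonneg_discriminant)
    fix t :: real
    have "(\<lambda>k. variational_energy p g (\<phi> k) + (2 * t * D (\<phi> k) + t\<^sup>2 * E)) \<longlonglongrightarrow> j + (2 * t * D u + t\<^sup>2 * E)"
      by (intro tendsto_intros min D_lim)
    moreover have "j \<le> variational_energy p g (\<phi> k) + (2 * t * D (\<phi> k) + t\<^sup>2 * E)" for k
      unfolding exp[symmetric] by (intro low C0_add C0_cmult \<phi> \<delta>)
    ultimately have "j \<le> j + (2 * t * D u + t\<^sup>2 * E)" by (intro LIMSEQ_le_const) auto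
    then show "0 \<le> 0 + 2 * t * D u + t\<^sup>2 * E" by simp
  qed
  then have "D u = 0" by simp
  then show ?thesis by (simp add: D_def)
qed

section \<open>The bottom of the spectrum and the Rayleigh quotient\<close>

lemma resolvent_bound:
  assumes a: "a > 0" and f: "f \<in> dom_laplacian G"
  shows "norm2 G f \<le> (1/a) * norm2 G (\<lambda>x. - \<Delta> f x - (- a) * f x)"
proof -
  have fe: "f \<in> ell2 G" "\<Delta> f \<in> ell2 G" using f domQ_ell2 by (auto simp: dom_laplacian_def)
  define h where "h x = - \<Delta> f x - (- a) * f x" for x
  have h: "h \<in> ell2 G"
    using ell2_diff[OF ell2_cmult[OF fe(1), of a] fe(2)] by (simp add: h_def[abs_def] algebra_simps)
  have "0 * vint (\<lambda>x. (f x)\<^sup>2) \<le> - vint (\<lambda>x. f x * \<Delta> f x)"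
    by (rule Rayleigh_on_domain[OF f]) (simp add: vint_\<Gamma>_nonneg)
  moreover have "vint (\<lambda>x. f x * h x) = - vint (\<lambda>x. f x * \<Delta> f x) + a * vint (\<lambda>x. (f x)\<^sup>2)"
  proof -
    have "vint (\<lambda>x. f x * h x) = vint (\<lambda>x. a * (f x)\<^sup>2 - f x * \<Delta> f x)"
      by (simp add: h_def power2_eq_square algebra_simps)
    also have "\<dots> = vint (\<lambda>x. a * (f x)\<^sup>2) - vint (\<lambda>x. f x * \<Delta> f x)"
      using fe by (intro vint_diff vsummable_cmult ell2_mult) (simp_all add: ell2_iff)
    finally show ?thesis by (simp add: vint_cmult)
  qed
  ultimately have "a * (norm2 G f)\<^sup>2 \<le> vint (\<lambda>x. f x * h x)" by (simp add: norm2_sq)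
  also have "\<dots> \<le> norm2 G f * norm2 G h" using Cauchy_Schwarz_vint[OF fe(1) h] by simp
  finally have le: "norm2 G f * (a * norm2 G f) \<le> norm2 G f * norm2 G h" by (simp add: power2_eq_square algebra_simps)
  have "a * norm2 G f \<le> norm2 G h"
  proof (cases "norm2 G f = 0")
    case False
    then have "norm2 G f > 0" using norm2_nonneg[of f] by linarith
    then show ?thesis using le by simp
  qed simp
  then show ?thesis using a by (simp add: h_def[abs_def] field_simps)
qed

lemma norm2_zero: assumes "f \<in> ell2 G" "norm2 G f \<le> 0" shows "f x = 0"
proof -
  have "vint (\<lambda>x. (f x)\<^sup>2) = 0" using assms(2) norm2_nonneg[of f] norm2_sq[of f] by simp
  moreover have "(\<Sum>z\<in>{x}. m z * (f z)\<^sup>2) \<le> vint (\<lambda>x. (f x)\<^sup>2)"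
    by (rule finite_sum_le_vint) (use assms in \<open>auto simp: ell2_iff\<close>)
  ultimately have "m x * (f x)\<^sup>2 \<le> 0" by simp
  then have "(f x)\<^sup>2 \<le> 0" using m_pos[of x] by (simp add: mult_le_0_iff)
  then show ?thesis by simp
qed

text \<open>
  Lax-Milgram by minimisation over finitely supported functions.  The minimising sequence is
  Cauchy in the form norm, so its limit lies in the form domain by the very definition of that domain.
\<close>
lemma resolvent_surjective:
  assumes a: "a > 0" and g: "g \<in> ell2 G"
  obtains u where "u \<in> dom_laplacian G" "\<And>x. - \<Delta> u x + a * u x = g x"
proof -
  let ?J = "variational_energy (\<lambda>x. a) g"
  have low: "- (1/a) * vint (\<lambda>x. (g x)\<^sup>2) \<le> ?J \<phi>" if \<phi>: "\<phi> \<in> C0" for \<phi>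
    unfolding variational_energy_def vint_cmult[symmetric]
  proof (rule vint_mono)
    show "vsummable (\<lambda>x. - (1/a) * (g x)\<^sup>2)" using g unfolding ell2_iff by (rule vsummable_cmult)
    show "vsummable (\<lambda>x. \<Gamma> \<phi> \<phi> x + a * (\<phi> x)\<^sup>2 - 2 * g x * \<phi> x)"
      by (intro vsummable_C0 variational_energy_integrand_C0[of \<phi> "\<lambda>x. a"] \<phi>)
    fix x
    have "0 \<le> (1/a) * (a * \<phi> x - g x)\<^sup>2" using a by simp
    also have "\<dots> = a * (\<phi> x)\<^sup>2 - 2 * g x * \<phi> x + (1/a) * (g x)\<^sup>2"
      using a by (simp add: power2_eq_square field_simps)
    finally have "- (1/a) * (g x)\<^sup>2 \<le> a * (\<phi> x)\<^sup>2 - 2 * g x * \<phi> x" by simp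
    then show "- (1/a) * (g x)\<^sup>2 \<le> \<Gamma> \<phi> \<phi> x + a * (\<phi> x)\<^sup>2 - 2 * g x * \<phi> x"
      using \<Gamma>_nonneg[of \<phi> x] by linarith
  qed
  have bdd: "bdd_below (?J ` C0)" by (rule bdd_belowI2) (rule low)
  define j where "j = Inf (?J ` C0)"
  have ne: "(C0 :: ('v \<Rightarrow> real) set) \<noteq> {}" using C0_zero by blast
  obtain \<phi> where \<phi>: "\<And>k. \<phi> k \<in> C0" "(\<lambda>k. ?J (\<phi> k)) \<longlonglongrightarrow> j"
    unfolding j_def using minimizing_sequence[OF ne bdd] by blast
  have jlow: "j \<le> ?J \<phi>" if "\<phi> \<in> C0" for \<phi> unfolding j_def using bdd that by (intro cInf_lower) auto
  define c where "c = min 1 a"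
  have c: "c > 0" using a by (simp add: c_def)
  have le: "c * form (\<lambda>x. \<phi> i x - \<phi> k x) \<le> 2 * (?J (\<phi> i) - j) + 2 * (?J (\<phi> k) - j)" for i k
  proof -
    have d: "(\<lambda>x. \<phi> i x - \<phi> k x) \<in> C0" by (intro C0_diff \<phi>)
    have "c * form (\<lambda>x. \<phi> i x - \<phi> k x)
       \<le> vint (\<lambda>x. \<Gamma> (\<lambda>x. \<phi> i x - \<phi> k x) (\<lambda>x. \<phi> i x - \<phi> k x) x + a * (\<phi> i x - \<phi> k x)\<^sup>2)"
      unfolding form_def vint_cmult[symmetric]
    proof (rule vint_mono)
      fix x
      have "c * \<Gamma> (\<lambda>x. \<phi> i x - \<phi> k x) (\<lambda>x. \<phi> i x - \<phi> k x) x \<le> 1 * \<Gamma> (\<lambda>x. \<phi> i x - \<phi> k x) (\<lambda>x. \<phi> i x - \<phi> k x) x"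
        by (rule mult_right_mono) (auto simp: c_def)
      moreover have "c * (\<phi> i x - \<phi> k x)\<^sup>2 \<le> a * (\<phi> i x - \<phi> k x)\<^sup>2"
        by (rule mult_right_mono) (auto simp: c_def)
      ultimately show "c * (\<Gamma> (\<lambda>x. \<phi> i x - \<phi> k x) (\<lambda>x. \<phi> i x - \<phi> k x) x + (\<phi> i x - \<phi> k x)\<^sup>2)
          \<le> \<Gamma> (\<lambda>x. \<phi> i x - \<phi> k x) (\<lambda>x. \<phi> i x - \<phi> k x) x + a * (\<phi> i x - \<phi> k x)\<^sup>2"
        by (simp add: distrib_left)
    qed (intro vsummable_C0 C0_cmult C0_add C0_\<Gamma> C0_power2 d)+
    also have "\<dots> \<le> 2 * (?J (\<phi> i) - j) + 2 * (?J (\<phi> k) - j)"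
      by (rule variational_energy_parallelogram[OF \<phi>(1) \<phi>(1) jlow])
    finally show ?thesis .
  qed
  have Cau: "form_Cauchy \<phi>"
  proof (rule form_CauchyI)
    show "form (\<lambda>x. \<phi> i x - \<phi> k x) \<le> 2 / c * (?J (\<phi> i) - j) + 2 / c * (?J (\<phi> k) - j)" for i k
    proof -
      have "form (\<lambda>x. \<phi> i x - \<phi> k x) \<le> (2 * (?J (\<phi> i) - j) + 2 * (?J (\<phi> k) - j)) / c"
        using le[of i k] c by (simp add: pos_le_divide_eq mult.commute)
      then show ?thesis unfolding add_divide_distrib by simp
    qed
    have "(\<lambda>k. 2 / c * (?J (\<phi> k) - j)) \<longlonglongrightarrow> 2 / c * (j - j)" by (intro tendsto_intros \<phi>(2))
    then show "(\<lambda>k. 2 / c * (?J (\<phi> k) - j)) \<longlonglongrightarrow> 0" by simp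
  qed
  define u where "u x = lim (\<lambda>k. \<phi> k x)" for x
  have lim: "(\<lambda>k. \<phi> k x) \<longlonglongrightarrow> u x" for x
    unfolding u_def using form_Cauchy_pointwise[OF \<phi>(1) Cau] by (simp add: convergent_LIMSEQ_iff)
  have uQ: "u \<in> domQ G" by (rule form_Cauchy_limit(1)[OF \<phi>(1) Cau lim])
  have eq: "- \<Delta> u x + a * u x = g x" for x
    using Euler_Lagrange[OF \<phi>(1) lim \<phi>(2) jlow] by simp
  have "\<Delta> u = (\<lambda>x. a * u x - g x)" by (rule ext) (use eq in \<open>smt (verit)\<close>)
  then have "u \<in> dom_laplacian G"
    using uQ ell2_diff[OF ell2_cmult[OF domQ_ell2[OF uQ], of a] g] by (simp add: dom_laplacian_def)
  then show ?thesis using eq that by blast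
qed

lemma negative_in_resolvent_set:
  assumes a: "a > 0"
  shows "- a \<in> resolvent_set G (dom_laplacian G) (\<lambda>f x. - \<Delta> f x)"
proof -
  let ?B = "\<lambda>f x. - \<Delta> f x - (- a) * f x"
  have inj: "inj_on ?B (dom_laplacian G)"
  proof (rule inj_onI)
    fix f g assume f: "f \<in> dom_laplacian G" and g: "g \<in> dom_laplacian G" and eq: "?B f = ?B g"
    have d: "(\<lambda>x. f x + (-1) * g x) \<in> dom_laplacian G" by (rule dom_laplacian_lincomb[OF f g])
    have "?B (\<lambda>x. f x + (-1) * g x) = (\<lambda>x. ?B f x - ?B g x)"
      unfolding \<Delta>_add \<Delta>_cmult by (rule ext) (simp add: algebra_simps)
    also have "\<dots> = (\<lambda>x. 0)" using fun_cong[OF eq] by simp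
    finally have "norm2 G (?B (\<lambda>x. f x + (-1) * g x)) = 0" by (simp add: norm2_eq)
    then have "norm2 G (\<lambda>x. f x + (-1) * g x) \<le> 0" using resolvent_bound[OF a d] by simp
    moreover have "(\<lambda>x. f x + (-1) * g x) \<in> ell2 G"
      by (rule domQ_ell2) (use d in \<open>simp add: dom_laplacian_def\<close>)
    ultimately have "f x + (-1) * g x = 0" for x
      using norm2_zero by blast
    then show "f = g" by (intro ext) (simp add: algebra_simps)
  qed
  have "?B ` dom_laplacian G = ell2 G"
  proof
    show "?B ` dom_laplacian G \<subseteq> ell2 G"
    proof
      fix h assume "h \<in> ?B ` dom_laplacian G"
      then obtain f where f: "f \<in> dom_laplacian G" and h: "h = ?B f" by blast
      then have "f \<in> ell2 G" "\<Delta> f \<in> ell2 G" using domQ_ell2 by (auto simp: dom_laplacian_def)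
      from ell2_diff[OF ell2_cmult[OF this(1), of a] this(2)] show "h \<in> ell2 G"
        by (simp add: h algebra_simps)
    qed
    show "ell2 G \<subseteq> ?B ` dom_laplacian G"
    proof
      fix g assume "g \<in> ell2 G"
      from resolvent_surjective[OF a this] obtain u where
        u: "u \<in> dom_laplacian G" "\<And>x. - \<Delta> u x + a * u x = g x" by blast
      have "?B u = g" by (rule ext) (use u(2) in simp)
      then show "g \<in> ?B ` dom_laplacian G" using u(1) by blast
    qed
  qed
  with inj have "bij_betw ?B (dom_laplacian G) (ell2 G)" by (rule bij_betw_imageI)
  moreover have "\<exists>C. \<forall>f\<in>dom_laplacian G. norm2 G f \<le> C * norm2 G (?B f)"
    using resolvent_bound[OF a] by blast
  ultimately show ?thesis unfolding resolvent_set_def by blast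
qed

text \<open>
  If \<open>B = - \<Delta> - c\<close> had a bounded inverse, take \<open>f\<close> with \<open>B f = \<phi>\<close>.  The form of \<open>B\<close> is
  positive semidefinite, so Cauchy-Schwarz for it gives
  \<open>\<langle>\<phi>, \<phi>\<rangle>\<^sup>2 = \<langle>B f, \<phi>\<rangle>\<^sup>2 \<le> \<langle>B f, f\<rangle> \<langle>B \<phi>, \<phi>\<rangle> \<le> C \<langle>\<phi>, \<phi>\<rangle> \<langle>B \<phi>, \<phi>\<rangle>\<close>,
  and \<open>c + 1 / C\<close> would be a better lower bound for the Rayleigh quotient.
\<close>
lemma Rayleigh_infimum_in_spec:
  assumes low: "\<And>\<phi>. \<phi> \<in> C0 \<Longrightarrow> c * vint (\<lambda>x. (\<phi> x)\<^sup>2) \<le> vint (\<Gamma> \<phi> \<phi>)"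
    and opt: "\<And>d. (\<And>\<phi>. \<phi> \<in> C0 \<Longrightarrow> d * vint (\<lambda>x. (\<phi> x)\<^sup>2) \<le> vint (\<Gamma> \<phi> \<phi>)) \<Longrightarrow> d \<le> c"
  shows "c \<in> spec G (dom_laplacian G) (\<lambda>f x. - \<Delta> f x)"
proof (rule ccontr)
  assume "\<not> ?thesis"
  then have "c \<in> resolvent_set G (dom_laplacian G) (\<lambda>f x. - \<Delta> f x)" by (simp add: spec_def)
  then obtain C' where bij: "bij_betw (\<lambda>f x. - \<Delta> f x - c * f x) (dom_laplacian G) (ell2 G)"
    and C': "\<And>f. f \<in> dom_laplacian G \<Longrightarrow> norm2 G f \<le> C' * norm2 G (\<lambda>x. - \<Delta> f x - c * f x)"
    unfolding resolvent_set_def by blast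
  define B where "B f x = - \<Delta> f x - c * f x" for f x
  define C where "C = \<bar>C'\<bar> + 1"
  have C: "C > 0" by (simp add: C_def)
  have CB: "norm2 G f \<le> C * norm2 G (B f)" if "f \<in> dom_laplacian G" for f
  proof -
    have "norm2 G f \<le> C' * norm2 G (B f)" using C'[OF that] by (simp add: B_def[abs_def])
    also have "\<dots> \<le> C * norm2 G (B f)" by (rule mult_right_mono) (auto simp: C_def)
    finally show ?thesis .
  qed
  have D: "f \<in> ell2 G" "\<Delta> f \<in> ell2 G" "B f \<in> ell2 G" if "f \<in> dom_laplacian G" for f
  proof -
    show f: "f \<in> ell2 G" "\<Delta> f \<in> ell2 G" using that domQ_ell2 by (auto simp: dom_laplacian_def)
    show "B f \<in> ell2 G"
      using ell2_diff[OF ell2_cmult[OF f(2), of "-1"] ell2_cmult[OF f(1), of c]] by (simp add: B_def[abs_def])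
  qed
  have Bv: "vint (\<lambda>x. B f x * g x) = - vint (\<lambda>x. g x * \<Delta> f x) - c * vint (\<lambda>x. f x * g x)"
    if f: "f \<in> dom_laplacian G" and g: "g \<in> ell2 G" for f g
  proof -
    have "vint (\<lambda>x. B f x * g x) = vint (\<lambda>x. - (g x * \<Delta> f x) - c * (f x * g x))"
      by (simp add: B_def algebra_simps)
    also have "\<dots> = vint (\<lambda>x. - (g x * \<Delta> f x)) - vint (\<lambda>x. c * (f x * g x))"
      by (intro vint_diff vsummable_minus vsummable_cmult ell2_mult g D f)
    finally show ?thesis by (simp only: vint_minus vint_cmult)
  qed
  have sym: "vint (\<lambda>x. B f x * g x) = vint (\<lambda>x. B g x * f x)"
    if f: "f \<in> dom_laplacian G" and g: "g \<in> dom_laplacian G" for f g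
    using laplacian_symmetric[OF f g] Bv[OF f D(1)[OF g]] Bv[OF g D(1)[OF f]] by (simp add: mult.commute)
  have pos: "0 \<le> vint (\<lambda>x. B f x * f x)" if f: "f \<in> dom_laplacian G" for f
    using Rayleigh_on_domain[OF f low] Bv[OF f D(1)[OF f]] by (simp add: power2_eq_square)
  have CS: "(vint (\<lambda>x. B f x * g x))\<^sup>2 \<le> vint (\<lambda>x. B f x * f x) * vint (\<lambda>x. B g x * g x)"
    if f: "f \<in> dom_laplacian G" and g: "g \<in> dom_laplacian G" for f g
  proof (rule quadratic_nonneg_discriminant)
    fix t :: real
    have BB: "B (\<lambda>x. f x + t * g x) x = B f x + t * B g x" for x
      by (simp add: B_def \<Delta>_add \<Delta>_cmult algebra_simps)
    have "0 \<le> vint (\<lambda>x. B (\<lambda>x. f x + t * g x) x * (f x + t * g x))"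
      by (rule pos) (rule dom_laplacian_lincomb[OF f g])
    also have "\<dots> = vint (\<lambda>x. B f x * f x + (t * (B f x * g x + B g x * f x) + t\<^sup>2 * (B g x * g x)))"
      unfolding BB by (simp add: power2_eq_square algebra_simps)
    also have "\<dots> = vint (\<lambda>x. B f x * f x) + (t * vint (\<lambda>x. B f x * g x + B g x * f x) + t\<^sup>2 * vint (\<lambda>x. B g x * g x))"
      by (intro vint_linear3 vsummable_add ell2_mult D f g)
    also have "vint (\<lambda>x. B f x * g x + B g x * f x) = vint (\<lambda>x. B f x * g x) + vint (\<lambda>x. B g x * f x)"
      by (intro vint_add ell2_mult D f g)
    finally show "0 \<le> vint (\<lambda>x. B f x * f x) + 2 * t * vint (\<lambda>x. B f x * g x) + t\<^sup>2 * vint (\<lambda>x. B g x * g x)"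
      using sym[OF f g] by simp
  qed
  have "c + 1 / C \<le> c"
  proof (rule opt)
    fix \<phi> :: "'v \<Rightarrow> real" assume \<phi>: "\<phi> \<in> C0"
    note \<phi>D = C0_dom_laplacian[OF \<phi>]
    have "\<phi> \<in> (\<lambda>f x. - \<Delta> f x - c * f x) ` dom_laplacian G"
      using bij C0_ell2[OF \<phi>] by (simp add: bij_betw_def)
    then obtain f where f: "f \<in> dom_laplacian G" and Bf: "B f = \<phi>" by (auto simp: B_def[abs_def])
    define n2 where "n2 = vint (\<lambda>x. (\<phi> x)\<^sup>2)"
    have n2: "n2 = (norm2 G \<phi>)\<^sup>2" by (simp add: n2_def norm2_sq)
    define b where "b = vint (\<lambda>x. B \<phi> x * \<phi> x)"
    have b: "b = vint (\<Gamma> \<phi> \<phi>) - c * n2"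
      using Bv[OF \<phi>D C0_ell2[OF \<phi>]] summation_by_parts[OF \<phi>, of \<phi>] by (simp add: b_def n2_def power2_eq_square)
    have "n2 = vint (\<lambda>x. B f x * \<phi> x)" by (simp add: n2_def Bf power2_eq_square)
    then have "n2\<^sup>2 \<le> vint (\<lambda>x. B f x * f x) * b" using CS[OF f \<phi>D] by (simp add: b_def)
    also have "vint (\<lambda>x. B f x * f x) = vint (\<lambda>x. \<phi> x * f x)" by (simp add: Bf)
    also have "\<dots> * b \<le> (C * n2) * b"
    proof (rule mult_right_mono)
      show "0 \<le> b" unfolding b_def by (rule pos[OF \<phi>D])
      have "vint (\<lambda>x. \<phi> x * f x) \<le> norm2 G \<phi> * norm2 G f"
        using Cauchy_Schwarz_vint[OF C0_ell2[OF \<phi>] D(1)[OF f]] by simp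
      also have "\<dots> \<le> norm2 G \<phi> * (C * norm2 G \<phi>)" using CB[OF f] by (intro mult_left_mono) (auto simp: Bf)
      finally show "vint (\<lambda>x. \<phi> x * f x) \<le> C * n2" by (simp add: n2 power2_eq_square algebra_simps)
    qed
    finally have le: "n2 * n2 \<le> n2 * (C * b)" by (simp add: power2_eq_square algebra_simps)
    have "n2 \<le> C * b"
    proof (cases "n2 = 0")
      case True
      then show ?thesis using C pos[OF \<phi>D] by (simp add: b_def)
    next
      case False
      then have "n2 > 0" using n2 by simp
      then show ?thesis using le by simp
    qed
    then have "(1/C) * n2 \<le> b" using C by (simp add: field_simps)
    then show "(c + 1 / C) * vint (\<lambda>x. (\<phi> x)\<^sup>2) \<le> vint (\<Gamma> \<phi> \<phi>)"
      unfolding n2_def[symmetric] b by (simp add: algebra_simps)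
  qed
  then show False using C by simp
qed

text \<open>
  Membership of the Rayleigh infimum in the spectrum is not enough: the infimum of a set of
  reals is meaningful only if the set is bounded below, which is where negative resolvent points are used.
\<close>
lemma lambda_star_le_Rayleigh:
  assumes \<phi>: "\<phi> \<in> C0"
  shows "lambda_star G * vint (\<lambda>x. (\<phi> x)\<^sup>2) \<le> vint (\<Gamma> \<phi> \<phi>)"
proof -
  let ?R = "{vint (\<Gamma> \<phi> \<phi>) / vint (\<lambda>x. (\<phi> x)\<^sup>2) | \<phi>. \<phi> \<in> C0 \<and> vint (\<lambda>x. (\<phi> x)\<^sup>2) > 0}"
  define c where "c = Inf ?R"
  have bdd: "bdd_below ?R" by (rule bdd_belowI[of _ 0]) (auto simp: vint_\<Gamma>_nonneg)
  have zero: "vint (\<Gamma> \<phi> \<phi>) \<ge> 0" "vint (\<lambda>x. (\<phi> x)\<^sup>2) \<ge> 0" for \<phi> by (rule vint_\<Gamma>_nonneg vint_sq_nonneg)+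
  have low: "c * vint (\<lambda>x. (\<phi> x)\<^sup>2) \<le> vint (\<Gamma> \<phi> \<phi>)" if "\<phi> \<in> C0" for \<phi>
  proof (cases "vint (\<lambda>x. (\<phi> x)\<^sup>2) > 0")
    case True
    have "c \<le> vint (\<Gamma> \<phi> \<phi>) / vint (\<lambda>x. (\<phi> x)\<^sup>2)"
      unfolding c_def by (rule cInf_lower[OF _ bdd]) (use that True in blast)
    then show ?thesis using True by (simp add: field_simps)
  next
    case False
    then have "vint (\<lambda>x. (\<phi> x)\<^sup>2) = 0" using zero(2)[of \<phi>] by linarith
    then show ?thesis using zero(1)[of \<phi>] by simp
  qed
  have ne: "?R \<noteq> {}"
  proof -
    fix z :: 'v
    have "vint (\<lambda>y. (if y = z then 1 else 0) * (if y = z then 1 else 0)) = m z * (if z = z then 1 else 0)"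
      by (rule vint_point)
    then have "vint (\<lambda>y. (if y = z then 1 else 0 :: real)\<^sup>2) > 0" by (simp add: power2_eq_square)
    moreover have "(\<lambda>y. if y = z then 1 else 0 :: real) \<in> C0" by (rule C0_indicator)
    ultimately show ?thesis by blast
  qed
  have "c \<in> spec G (dom_laplacian G) (\<lambda>f x. - \<Delta> f x)"
  proof (rule Rayleigh_infimum_in_spec[OF low])
    fix d assume d: "\<And>\<phi>. \<phi> \<in> C0 \<Longrightarrow> d * vint (\<lambda>x. (\<phi> x)\<^sup>2) \<le> vint (\<Gamma> \<phi> \<phi>)"
    show "d \<le> c" unfolding c_def
      by (rule cInf_greatest[OF ne]) (use d in \<open>auto simp: field_simps\<close>)
  qed
  moreover have "bdd_below (spec G (dom_laplacian G) (\<lambda>f x. - \<Delta> f x))"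
  proof (rule bdd_belowI)
    fix z assume z: "z \<in> spec G (dom_laplacian G) (\<lambda>f x. - \<Delta> f x)"
    show "0 \<le> z"
    proof (rule ccontr)
      assume "\<not> 0 \<le> z"
      then show False using negative_in_resolvent_set[of "- z"] z by (simp add: spec_def)
    qed
  qed
  ultimately have "lambda_star G \<le> c" unfolding lambda_star_def by (rule cInf_lower)
  then have "lambda_star G * vint (\<lambda>x. (\<phi> x)\<^sup>2) \<le> c * vint (\<lambda>x. (\<phi> x)\<^sup>2)"
    by (rule mult_right_mono) (rule zero)
  also have "\<dots> \<le> vint (\<Gamma> \<phi> \<phi>)" by (rule low[OF \<phi>])
  finally show ?thesis .
qed

section \<open>Cutoff functions\<close>

text \<open>
  Cutoffs with gradient bound \<open>\<delta> k\<close>.  It is strictly positive because it serves as the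
  weight in the inequality between arithmetic and geometric means.
\<close>
definition cutoffs :: "(nat \<Rightarrow> 'v \<Rightarrow> real) \<Rightarrow> (nat \<Rightarrow> real) \<Rightarrow> bool" where
  "cutoffs \<xi> \<delta> \<longleftrightarrow> (\<forall>k. \<xi> k \<in> C0) \<and> (\<forall>k x. 0 \<le> \<xi> k x \<and> \<xi> k x \<le> 1) \<and> (\<forall>x. (\<lambda>k. \<xi> k x) \<longlonglongrightarrow> 1) \<and>
     (\<forall>k x. \<Gamma> (\<xi> k) (\<xi> k) x \<le> (\<delta> k)\<^sup>2) \<and> (\<forall>k. \<delta> k > 0) \<and> \<delta> \<longlonglongrightarrow> 0"

lemma cutoffsD:
  assumes "cutoffs \<xi> \<delta>"
  shows "\<xi> k \<in> C0" "0 \<le> \<xi> k x" "\<xi> k x \<le> 1" "(\<lambda>k. \<xi> k x) \<longlonglongrightarrow> 1" "\<Gamma> (\<xi> k) (\<xi> k) x \<le> (\<delta> k)\<^sup>2"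
    "\<delta> k > 0" "\<delta> \<longlonglongrightarrow> 0"
  using assms by (auto simp: cutoffs_def)

lemma \<Gamma>_contraction:
  assumes "\<And>y. \<bar>g y - g x\<bar> \<le> \<bar>f y - f x\<bar>"
  shows "\<Gamma> g g x \<le> \<Gamma> f f x"
  unfolding Gam_def mult.assoc
proof (intro mult_left_mono sum_mono)
  fix y
  show "(g y - g x) * (g y - g x) \<le> (f y - f x) * (f y - f x)"
    using assms[of y] by (simp add: abs_le_square_iff power2_eq_square)
qed auto

text \<open>
  The functions in the definition of completeness increase to 1, hence are at most 1, but they may be
  negative; taking positive parts does not increase the gradient.
\<close>
lemma complete_cutoffs:
  assumes "complete_graph G"
  shows "\<exists>\<xi> \<delta>. cutoffs \<xi> \<delta>"
proof -
  obtain \<eta> where \<eta>: "\<And>k. k \<ge> 1 \<Longrightarrow> \<eta> k \<in> C0" "\<And>k x. k \<ge> 1 \<Longrightarrow> \<eta> k x \<le> \<eta> (Suc k) x"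
    "\<And>x. (\<lambda>k. \<eta> k x) \<longlonglongrightarrow> 1" "\<And>k x. k \<ge> 1 \<Longrightarrow> \<Gamma> (\<eta> k) (\<eta> k) x \<le> 1 / real k"
    using assms unfolding complete_graph_def by blast
  have lim: "(\<lambda>k. \<eta> (Suc k) x) \<longlonglongrightarrow> 1" for x using \<eta>(3)[of x] by (rule LIMSEQ_Suc)
  have le1: "\<eta> (Suc k) x \<le> 1" for k x
  proof (rule incseq_le[OF _ lim])
    show "incseq (\<lambda>k. \<eta> (Suc k) x)" by (rule incseq_SucI) (rule \<eta>(2), simp)
  qed
  define \<xi> where "\<xi> k x = max 0 (\<eta> (Suc k) x)" for k x
  define \<delta> where "\<delta> k = sqrt (1 / real (Suc k))" for k
  have "cutoffs \<xi> \<delta>" unfolding cutoffs_def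
  proof (intro conjI allI)
    fix k x
    show "\<xi> k \<in> C0" unfolding \<xi>_def by (rule C0_vanishing[OF \<eta>(1)[of "Suc k"]]) auto
    show "0 \<le> \<xi> k x" "\<xi> k x \<le> 1" using le1[of k x] by (auto simp: \<xi>_def)
    have "(\<lambda>k. max 0 (\<eta> (Suc k) x)) \<longlonglongrightarrow> max 0 1" by (intro tendsto_intros lim)
    then show "(\<lambda>k. \<xi> k x) \<longlonglongrightarrow> 1" by (simp add: \<xi>_def)
    have "\<Gamma> (\<xi> k) (\<xi> k) x \<le> \<Gamma> (\<eta> (Suc k)) (\<eta> (Suc k)) x"
      by (rule \<Gamma>_contraction) (simp add: \<xi>_def max_def)
    also have "\<dots> \<le> 1 / real (Suc k)" by (rule \<eta>(4)) simp
    finally show "\<Gamma> (\<xi> k) (\<xi> k) x \<le> (\<delta> k)\<^sup>2" by (simp add: \<delta>_def)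
    show "\<delta> k > 0" by (simp add: \<delta>_def)
    have "(\<lambda>k. sqrt (1 / real (Suc k))) \<longlonglongrightarrow> sqrt 0"
      using LIMSEQ_inverse_real_of_nat by (intro tendsto_intros) (simp add: inverse_eq_divide)
    then show "\<delta> \<longlonglongrightarrow> 0" by (simp add: \<delta>_def[abs_def])
  qed
  then show ?thesis by blast
qed

fun hop_ball :: "'v \<Rightarrow> nat \<Rightarrow> 'v set" where
  "hop_ball z 0 = {z}"
| "hop_ball z (Suc j) = closed_nbhd (hop_ball z j)"

lemma hop_ball_mono: "hop_ball z j \<subseteq> hop_ball z (j + i)"
  by (induction i) (auto simp: closed_nbhd_def)

lemma finite_hop_ball: "finite (hop_ball z j)"
  by (induction j) (auto simp: finite_closed_nbhd)

lemma hop_ball_exhausts: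
  assumes "connected_graph G"
  shows "\<exists>j. x \<in> hop_ball z j"
proof -
  have "(z, x) \<in> (edges G)\<^sup>*" using assms by (simp add: connected_graph_def)
  then show ?thesis
  proof (induction rule: rtrancl_induct)
    case base
    have "z \<in> hop_ball z 0" by simp
    then show ?case by blast
  next
    case (step y w)
    then obtain j where "y \<in> hop_ball z j" by blast
    then have "w \<in> hop_ball z (Suc j)" using step(2) by (auto simp: closed_nbhd_def nbrs_def)
    then show ?case by blast
  qed
qed

text \<open>
  Average the indicators of the balls of radius \<open>0, \<dots>, k\<close>: along an edge the average changes
  by at most \<open>1 / (k + 1)\<close>, and the bound on \<open>deg / m\<close> turns this into a bound on the gradient.
\<close>
lemma bounded_cutoffs:
  assumes con: "connected_graph G" and bdd: "bdd_above (range (\<lambda>x. degr G x / m x))"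
  shows "\<exists>\<xi> \<delta>. cutoffs \<xi> \<delta>"
proof -
  fix z :: 'v
  obtain D0 where D0: "\<And>x. degr G x / m x \<le> D0" using bdd by (auto simp: bdd_above_def)
  define D where "D = \<bar>D0\<bar> + 1"
  have D: "degr G x / m x \<le> D" "D > 0" for x using D0[of x] by (auto simp: D_def)
  define c where "c k x = (\<Sum>j\<le>k. if x \<in> hop_ball z j then 1 else 0 :: real)" for k x
  define \<xi> where "\<xi> k x = c k x / real (Suc k)" for k x
  define \<delta> where "\<delta> k = sqrt D / real (Suc k)" for k
  have c_le: "0 \<le> c k x" "c k x \<le> real (Suc k)" for k x
  proof -
    show "0 \<le> c k x" unfolding c_def by (rule sum_nonneg) auto
    have "c k x \<le> (\<Sum>j\<le>k. 1)" unfolding c_def by (rule sum_mono) auto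
    then show "c k x \<le> real (Suc k)" by simp
  qed
  have c_lip: "c k x \<le> c k y + 1" if "y \<in> N x" for k x y
  proof -
    have "c k x \<le> (\<Sum>j\<le>k. if y \<in> hop_ball z (Suc j) then 1 else 0)"
      unfolding c_def using that by (intro sum_mono) (auto simp: closed_nbhd_def)
    also have "\<dots> \<le> (\<Sum>j\<le>Suc k. if y \<in> hop_ball z j then 1 else 0)"
      by (subst sum.atMost_Suc_shift) simp
    also have "\<dots> \<le> c k y + 1" by (simp add: c_def)
    finally show ?thesis .
  qed
  have "cutoffs \<xi> \<delta>" unfolding cutoffs_def
  proof (intro conjI allI)
    fix k x
    have "c k x = 0" if "x \<notin> hop_ball z k" for k x
    proof -
      have "x \<notin> hop_ball z j" if "j \<le> k" for j
        using hop_ball_mono[of z j "k - j"] \<open>x \<notin> hop_ball z k\<close> that by auto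
      then show ?thesis by (simp add: c_def)
    qed
    then have "{x. \<xi> k x \<noteq> 0} \<subseteq> hop_ball z k" by (auto simp: \<xi>_def)
    then show "\<xi> k \<in> C0" unfolding C0_iff using finite_hop_ball by (rule finite_subset)
    show "0 \<le> \<xi> k x" "\<xi> k x \<le> 1" using c_le[where k = k and x = x] by (auto simp: \<xi>_def divide_le_eq)
    show "(\<lambda>k. \<xi> k x) \<longlonglongrightarrow> 1"
    proof -
      obtain i where i: "x \<in> hop_ball z i" using hop_ball_exhausts[OF con] by blast
      have low: "1 - real i * (1 / real (Suc k)) \<le> \<xi> k x" for k
      proof -
        have "(\<Sum>j\<le>k. 1 - (if j < i then 1 else 0 :: real)) \<le> c k x" unfolding c_def
        proof (rule sum_mono)
          fix j
          show "1 - (if j < i then 1 else 0 :: real) \<le> (if x \<in> hop_ball z j then 1 else 0)"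
            using hop_ball_mono[of z i "j - i"] i by auto
        qed
        moreover have "(\<Sum>j\<le>k. (if j < i then 1 else 0 :: real)) \<le> real i"
        proof -
          have "(\<Sum>j\<le>k. (if j < i then 1 else 0 :: real)) = (\<Sum>j\<in>{..k} \<inter> {..<i}. 1)"
            by (rule sum.mono_neutral_cong_right) auto
          also have "\<dots> = real (card ({..k} \<inter> {..<i}))" by simp
          also have "card ({..k} \<inter> {..<i}) \<le> card {..<i}" by (rule card_mono) auto
          finally show ?thesis by simp
        qed
        ultimately have "real (Suc k) - real i \<le> c k x" by (simp add: sum_subtractf)
        then have "(real (Suc k) - real i) / real (Suc k) \<le> \<xi> k x"
          unfolding \<xi>_def by (rule divide_right_mono) simp
        then show ?thesis by (simp add: diff_divide_distrib)
      qed
      have "(\<lambda>k. 1 - real i * (1 / real (Suc k))) \<longlonglongrightarrow> 1 - real i * 0"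
        using LIMSEQ_inverse_real_of_nat by (intro tendsto_intros) (simp add: inverse_eq_divide)
      then have l: "(\<lambda>k. 1 - real i * (1 / real (Suc k))) \<longlonglongrightarrow> 1" by simp
      show ?thesis
        by (rule tendsto_sandwich[OF _ _ l tendsto_const])
           (use low c_le in \<open>auto intro!: always_eventually simp: \<xi>_def divide_le_eq\<close>)
    qed
    have "\<Gamma> (\<xi> k) (\<xi> k) x \<le> (1 / (2 * m x)) * (\<Sum>y\<in>N x. \<omega> x y * (1 / real (Suc k))\<^sup>2)"
      unfolding Gam_def
    proof (intro mult_left_mono sum_mono)
      fix y assume y: "y \<in> N x"
      have "\<bar>c k y - c k x\<bar> \<le> 1" using c_lip[OF y, of k] c_lip[of x y k] y N_sym by fastforce
      then have "\<bar>\<xi> k y - \<xi> k x\<bar> \<le> \<bar>1 / real (Suc k)\<bar>"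
        by (simp add: \<xi>_def diff_divide_distrib[symmetric] abs_divide divide_right_mono)
      then have "(\<xi> k y - \<xi> k x)\<^sup>2 \<le> (1 / real (Suc k))\<^sup>2" by (simp only: abs_le_square_iff)
      from mult_left_mono[OF this, of "\<omega> x y"]
      show "\<omega> x y * (\<xi> k y - \<xi> k x) * (\<xi> k y - \<xi> k x) \<le> \<omega> x y * (1 / real (Suc k))\<^sup>2"
        by (simp only: power2_eq_square mult.assoc \<omega>_nonneg simp_thms)
    qed simp
    also have "\<dots> = (1/2) * (degr G x / m x) * (1 / real (Suc k))\<^sup>2"
      by (simp add: sum_distrib_right[symmetric] degr_def)
    also have "\<dots> \<le> D * (1 / real (Suc k))\<^sup>2"
    proof (rule mult_right_mono)
      have "degr G x / m x \<ge> 0" unfolding degr_def by (intro divide_nonneg_nonneg sum_nonneg) auto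
      then show "(1/2) * (degr G x / m x) \<le> D" using D(1)[of x] by linarith
    qed simp
    also have "\<dots> = (\<delta> k)\<^sup>2" using D(2) by (simp add: \<delta>_def power_divide)
    finally show "\<Gamma> (\<xi> k) (\<xi> k) x \<le> (\<delta> k)\<^sup>2" .
    show "\<delta> k > 0" using D(2) by (simp add: \<delta>_def)
    have "(\<lambda>k. sqrt D * (1 / real (Suc k))) \<longlonglongrightarrow> sqrt D * 0"
      using LIMSEQ_inverse_real_of_nat by (intro tendsto_intros) (simp add: inverse_eq_divide)
    then show "\<delta> \<longlonglongrightarrow> 0" by (simp add: \<delta>_def[abs_def])
  qed
  then show ?thesis by blast
qed

section \<open>A positive solution with a slowly varying potential\<close>

text \<open>
  The strong maximum principle: at a zero of a nonnegative function the Laplacian is a sum of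
  nonnegative terms, one for each neighbour.
\<close>
lemma vanishing_spreads:
  assumes con: "connected_graph G" and u0: "\<And>x. u x \<ge> 0"
    and eq: "\<And>x. u x = 0 \<Longrightarrow> \<Delta> u x = 0" and z: "u z = 0"
  shows "u x = 0"
proof -
  have "(z, x) \<in> (edges G)\<^sup>*" using con by (simp add: connected_graph_def)
  then show ?thesis
  proof (induction rule: rtrancl_induct)
    case (step y w)
    have "\<Delta> u y = 0" by (rule eq) (rule step)
    then have "(\<Sum>v\<in>N y. \<omega> y v * u v) = 0" using step(3) by (simp add: laplacian_def)
    moreover have "w \<in> N y" using step(2) by (simp add: nbrs_def)
    ultimately have "\<omega> y w * u w = 0"
      using sum_nonneg_eq_0_iff[of "N y" "\<lambda>v. \<omega> y v * u v"] u0 by simp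
    then show ?case using \<omega>_pos[of w y] step(2) by (simp add: nbrs_def)
  qed (rule z)
qed

lemma form_ge_Rayleigh:
  assumes lam: "\<And>\<phi>. \<phi> \<in> C0 \<Longrightarrow> c * vint (\<lambda>x. (\<phi> x)\<^sup>2) \<le> vint (\<Gamma> \<phi> \<phi>)" and "\<phi> \<in> C0"
  shows "(c + 1) * vint (\<lambda>x. (\<phi> x)\<^sup>2) \<le> form \<phi>"
  using assms by (simp add: form_split algebra_simps)

text \<open>
  The minimiser of \<open>form \<phi> / \<langle>\<eta> \<phi>\<^sup>2\<rangle>\<close>, with minimal value \<open>\<theta>\<close>.  The denominator
  sees finitely many vertices, so after passing to a subsequence it converges along a minimising
  sequence, and the parallelogram identity gives convergence in the form norm.  The last conclusion
  holds because \<open>\<theta> = lim form (\<psi> k) \<ge> (c + 1) \<langle>u\<^sup>2\<rangle>\<close> under the normalisation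
  \<open>\<langle>\<eta> u\<^sup>2\<rangle> = 1\<close>.  Testing with a point mass at \<open>z\<close> bounds \<open>\<theta>\<close> in terms of \<open>\<eta> z\<close> only.
\<close>
lemma ground_state:
  assumes con: "connected_graph G" and \<eta>: "\<eta> \<in> C0" and \<eta>01: "\<And>x. 0 \<le> \<eta> x" "\<And>x. \<eta> x \<le> 1"
    and z: "\<eta> z > 0"
    and lam: "\<And>\<phi>. \<phi> \<in> C0 \<Longrightarrow> c * vint (\<lambda>x. (\<phi> x)\<^sup>2) \<le> vint (\<Gamma> \<phi> \<phi>)" and c: "c \<ge> 0"
  obtains \<theta> u where "\<theta> \<ge> 0" "\<theta> * (m z * \<eta> z) \<le> form (\<lambda>y. if y = z then 1 else 0)"
    "\<And>x. u x > 0" "u \<in> ell2 G" "vsummable (\<Gamma> u u)" "vint (\<Gamma> u u) \<le> \<theta> * vint (\<lambda>x. (u x)\<^sup>2)"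
    "\<And>x. - \<Delta> u x = (\<theta> * \<eta> x - 1) * u x"
    "c * vint (\<lambda>x. (u x)\<^sup>2) \<le> vint (\<lambda>x. (\<theta> * \<eta> x - 1) * (u x)\<^sup>2)"
proof -
  define Nn where "Nn \<phi> = vint (\<lambda>x. \<eta> x * (\<phi> x)\<^sup>2)" for \<phi>
  define S where "S = {x. \<eta> x \<noteq> 0}"
  have S: "finite S" using \<eta> by (simp add: S_def C0_iff)
  have Nn_sum: "Nn \<phi> = (\<Sum>x\<in>S. m x * (\<eta> x * (\<phi> x)\<^sup>2))" for \<phi>
    unfolding Nn_def by (rule vint_finite) (use S in \<open>auto simp: S_def\<close>)
  have Nn_nonneg: "Nn \<phi> \<ge> 0" for \<phi> unfolding Nn_def by (rule vint_nonneg) (simp add: \<eta>01)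
  have Nn_cmult: "Nn (\<lambda>x. a * \<phi> x) = a\<^sup>2 * Nn \<phi>" for a \<phi>
    unfolding Nn_def vint_cmult[symmetric] by (simp add: power_mult_distrib mult.left_commute)
  define \<delta> where "\<delta> y = (if y = z then 1 else 0 :: real)" for y
  have \<delta>: "\<delta> \<in> C0" unfolding \<delta>_def by (rule C0_indicator)
  have "Nn \<delta> = vint (\<lambda>y. (if y = z then 1 else 0) * (\<eta> y * \<delta> y))"
    unfolding Nn_def by (rule arg_cong[of _ _ vint]) (auto simp: \<delta>_def)
  then have N\<delta>: "Nn \<delta> = m z * \<eta> z" unfolding vint_point by (simp add: \<delta>_def)
  define A where "A = {\<phi> \<in> C0. Nn \<phi> = 1}"
  have scale: "(\<lambda>x. (1 / sqrt (Nn \<phi>)) * \<phi> x) \<in> A" if "\<phi> \<in> C0" "Nn \<phi> > 0" for \<phi>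
  proof -
    have "(1 / sqrt (Nn \<phi>))\<^sup>2 * Nn \<phi> = 1" using that by (simp add: power_divide)
    then show ?thesis unfolding A_def mem_Collect_eq Nn_cmult using C0_cmult[OF that(1)] by blast
  qed
  have ne: "A \<noteq> {}" using scale[OF \<delta>] z by (auto simp: N\<delta>)
  have bdd: "bdd_below (form ` A)" by (rule bdd_belowI2[of _ 0]) (rule form_nonneg)
  define \<theta> where "\<theta> = Inf (form ` A)"
  have \<theta>0: "\<theta> \<ge> 0" unfolding \<theta>_def using ne by (intro cInf_greatest) (auto simp: form_nonneg)
  have \<theta>A: "\<theta> \<le> form \<phi>" if "\<phi> \<in> A" for \<phi> unfolding \<theta>_def using bdd that by (intro cInf_lower) auto
  have \<theta>: "\<theta> * Nn \<phi> \<le> form \<phi>" if \<phi>: "\<phi> \<in> C0" for \<phi>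
  proof (cases "Nn \<phi> > 0")
    case True
    from \<theta>A[OF scale[OF \<phi> this]] have "\<theta> \<le> form \<phi> / Nn \<phi>"
      using True unfolding form_cmult by (simp add: power_divide)
    then show ?thesis using True by (simp add: field_simps)
  next
    case False
    then have "Nn \<phi> = 0" using Nn_nonneg[of \<phi>] by linarith
    then show ?thesis using form_nonneg[of \<phi>] by simp
  qed
  obtain \<phi>0 where \<phi>0: "\<And>k. \<phi>0 k \<in> A" "(\<lambda>k. form (\<phi>0 k)) \<longlonglongrightarrow> \<theta>"
    unfolding \<theta>_def using minimizing_sequence[OF ne bdd] by blast
  \<comment> \<open>Absolute values do not increase the energy, so the minimising sequence may be taken nonnegative.\<close>
  define \<phi> where "\<phi> k x = \<bar>\<phi>0 k x\<bar>" for k x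
  have \<phi>A: "\<phi> k \<in> A" for k
    using \<phi>0(1)[of k] C0_vanishing[of "\<phi>0 k" "\<phi> k"] by (auto simp: A_def Nn_def \<phi>_def)
  have \<phi>C: "\<phi> k \<in> C0" for k using \<phi>A by (simp add: A_def)
  have \<phi>lim: "(\<lambda>k. form (\<phi> k)) \<longlonglongrightarrow> \<theta>"
  proof (rule tendsto_sandwich[OF _ _ tendsto_const \<phi>0(2)])
    show "\<forall>\<^sub>F k in sequentially. \<theta> \<le> form (\<phi> k)" by (rule always_eventually) (use \<theta>A \<phi>A in blast)
    have "form (\<phi> k) \<le> form (\<phi>0 k)" for k unfolding form_def
    proof (rule vint_mono)
      have C: "\<phi>0 k \<in> C0" using \<phi>0(1) by (simp add: A_def)
      show "vsummable (\<lambda>x. \<Gamma> (\<phi> k) (\<phi> k) x + (\<phi> k x)\<^sup>2)" "vsummable (\<lambda>x. \<Gamma> (\<phi>0 k) (\<phi>0 k) x + (\<phi>0 k x)\<^sup>2)"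
        by (intro vsummable_C0 C0_add C0_\<Gamma> C0_power2 C \<phi>C)+
      fix x
      have "\<Gamma> (\<phi> k) (\<phi> k) x \<le> \<Gamma> (\<phi>0 k) (\<phi>0 k) x"
        by (rule \<Gamma>_contraction) (simp add: \<phi>_def abs_triangle_ineq3)
      then show "\<Gamma> (\<phi> k) (\<phi> k) x + (\<phi> k x)\<^sup>2 \<le> \<Gamma> (\<phi>0 k) (\<phi>0 k) x + (\<phi>0 k x)\<^sup>2" by (simp add: \<phi>_def)
    qed
    then show "\<forall>\<^sub>F k in sequentially. form (\<phi> k) \<le> form (\<phi>0 k)" by simp
  qed
  obtain B where B: "\<And>k. form (\<phi> k) \<le> B"
    using convergent_imp_Bseq[OF convergentI[OF \<phi>lim]] unfolding Bseq_def
    by (metis abs_ge_self dual_order.trans real_norm_def)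
  have "bounded (range (\<lambda>k. \<phi> k x))" for x
  proof (rule boundedI)
    fix v assume "v \<in> range (\<lambda>k. \<phi> k x)"
    then obtain k where v: "v = \<phi> k x" by blast
    have "m x * (\<phi> k x)\<^sup>2 \<le> B" using pointwise_sq_le_form[OF \<phi>C] B order_trans by blast
    then have "v\<^sup>2 \<le> B / m x" by (simp add: v field_simps)
    then show "norm v \<le> sqrt (B / m x)" using real_le_rsqrt[of "\<bar>v\<bar>"] by simp
  qed
  then obtain r where r: "strict_mono (r :: nat \<Rightarrow> nat)" "\<forall>x\<in>S. convergent (\<lambda>k. \<phi> (r k) x)"
    using finite_convergent_subsequence[OF S, of \<phi>] by blast
  define \<psi> where "\<psi> k = \<phi> (r k)" for k
  have \<psi>C: "\<psi> k \<in> C0" and N\<psi>: "Nn (\<psi> k) = 1" and \<psi>0: "\<psi> k x \<ge> 0" for k x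
    using \<phi>A[of "r k"] by (auto simp: \<psi>_def A_def \<phi>_def)
  have \<psi>lim: "(\<lambda>k. form (\<psi> k)) \<longlonglongrightarrow> \<theta>"
    using LIMSEQ_subseq_LIMSEQ[OF \<phi>lim r(1)] by (simp add: \<psi>_def o_def)
  define p where "p x = 1 - \<theta> * \<eta> x" for x
  have J_eq: "variational_energy p (\<lambda>x. 0) \<phi> = form \<phi> - \<theta> * Nn \<phi>" if "\<phi> \<in> C0" for \<phi>
  proof -
    have "variational_energy p (\<lambda>x. 0) \<phi> = vint (\<lambda>x. (\<Gamma> \<phi> \<phi> x + (\<phi> x)\<^sup>2) - \<theta> * (\<eta> x * (\<phi> x)\<^sup>2))"
      unfolding variational_energy_def p_def by (simp add: algebra_simps)
    also have "\<dots> = vint (\<lambda>x. \<Gamma> \<phi> \<phi> x + (\<phi> x)\<^sup>2) - vint (\<lambda>x. \<theta> * (\<eta> x * (\<phi> x)\<^sup>2))"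
      by (intro vint_diff vsummable_C0 C0_add C0_\<Gamma> C0_power2 C0_mult_right that)
    finally show ?thesis by (simp add: form_def Nn_def vint_cmult)
  qed
  have low: "0 \<le> variational_energy p (\<lambda>x. 0) \<phi>" if "\<phi> \<in> C0" for \<phi> using \<theta>[OF that] J_eq[OF that] by simp
  have variational_energy\<psi>: "variational_energy p (\<lambda>x. 0) (\<psi> k) = form (\<psi> k) - \<theta>" for k using J_eq[OF \<psi>C] N\<psi> by simp
  have Jlim: "(\<lambda>k. variational_energy p (\<lambda>x. 0) (\<psi> k)) \<longlonglongrightarrow> 0"
    unfolding variational_energy\<psi> using tendsto_diff[OF \<psi>lim tendsto_const[of \<theta>]] by simp
  \<comment> \<open>So far convergence is known on the support of \<open>\<eta>\<close> only; elsewhere \<open>v\<close> is a junk value, which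
    \<open>Nn\<close> does not see.\<close>
  define v where "v x = lim (\<lambda>k. \<psi> k x)" for x
  have vlim: "(\<lambda>k. \<psi> k x) \<longlonglongrightarrow> v x" if "x \<in> S" for x
    unfolding v_def using r(2) that by (simp add: convergent_LIMSEQ_iff \<psi>_def)
  define a where "a k = 2 * variational_energy p (\<lambda>x. 0) (\<psi> k) + 2 * \<theta> * Nn (\<lambda>x. \<psi> k x - v x)" for k
  have Cau: "form_Cauchy \<psi>"
  proof (rule form_CauchyI)
    fix i j
    have d: "(\<lambda>x. \<psi> i x - \<psi> j x) \<in> C0" by (intro C0_diff \<psi>C)
    have "form (\<lambda>x. \<psi> i x - \<psi> j x) = variational_energy p (\<lambda>x. 0) (\<lambda>x. \<psi> i x - \<psi> j x) + \<theta> * Nn (\<lambda>x. \<psi> i x - \<psi> j x)"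
      by (simp add: J_eq[OF d])
    also have "variational_energy p (\<lambda>x. 0) (\<lambda>x. \<psi> i x - \<psi> j x) \<le> 2 * variational_energy p (\<lambda>x. 0) (\<psi> i) + 2 * variational_energy p (\<lambda>x. 0) (\<psi> j)"
      using variational_energy_parallelogram[OF \<psi>C \<psi>C low, of i j] by (simp add: variational_energy_def)
    also have "\<theta> * Nn (\<lambda>x. \<psi> i x - \<psi> j x)
        \<le> \<theta> * (2 * Nn (\<lambda>x. \<psi> i x - v x) + 2 * Nn (\<lambda>x. \<psi> j x - v x))"
    proof (rule mult_left_mono[OF _ \<theta>0])
      show "Nn (\<lambda>x. \<psi> i x - \<psi> j x) \<le> 2 * Nn (\<lambda>x. \<psi> i x - v x) + 2 * Nn (\<lambda>x. \<psi> j x - v x)"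
        unfolding Nn_sum sum_distrib_left sum.distrib[symmetric]
      proof (rule sum_mono)
        fix x
        have "(\<psi> i x - \<psi> j x)\<^sup>2 \<le> 2 * (\<psi> i x - v x)\<^sup>2 + 2 * (\<psi> j x - v x)\<^sup>2"
          using zero_le_power2[of "(\<psi> i x - v x) + (\<psi> j x - v x)"] by (simp add: power2_eq_square algebra_simps)
        then have "(m x * \<eta> x) * (\<psi> i x - \<psi> j x)\<^sup>2 \<le> (m x * \<eta> x) * (2 * (\<psi> i x - v x)\<^sup>2 + 2 * (\<psi> j x - v x)\<^sup>2)"
          by (rule mult_left_mono) (simp add: \<eta>01)
        then show "m x * (\<eta> x * (\<psi> i x - \<psi> j x)\<^sup>2)
           \<le> 2 * (m x * (\<eta> x * (\<psi> i x - v x)\<^sup>2)) + 2 * (m x * (\<eta> x * (\<psi> j x - v x)\<^sup>2))"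
          by (simp add: algebra_simps)
      qed
    qed
    finally show "form (\<lambda>x. \<psi> i x - \<psi> j x) \<le> a i + a j" by (simp add: a_def algebra_simps)
  next
    have "(\<lambda>k. Nn (\<lambda>x. \<psi> k x - v x)) \<longlonglongrightarrow> (\<Sum>x\<in>S. m x * (\<eta> x * (v x - v x)\<^sup>2))"
      unfolding Nn_sum by (intro tendsto_intros vlim)
    then have "(\<lambda>k. Nn (\<lambda>x. \<psi> k x - v x)) \<longlonglongrightarrow> 0" by simp
    then have "a \<longlonglongrightarrow> 2 * 0 + 2 * \<theta> * 0" unfolding a_def by (intro tendsto_intros Jlim)
    then show "a \<longlonglongrightarrow> 0" by simp
  qed
  define u where "u x = lim (\<lambda>k. \<psi> k x)" for x
  have lim: "(\<lambda>k. \<psi> k x) \<longlonglongrightarrow> u x" for x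
    unfolding u_def using form_Cauchy_pointwise[OF \<psi>C Cau] by (simp add: convergent_LIMSEQ_iff)
  have ue: "u \<in> ell2 G" by (rule domQ_ell2) (rule form_Cauchy_limit(1)[OF \<psi>C Cau lim])
  have u0: "u x \<ge> 0" for x by (rule LIMSEQ_le_const[OF lim]) (use \<psi>0 in blast)
  have "(\<lambda>k. Nn (\<psi> k)) \<longlonglongrightarrow> Nn u" unfolding Nn_sum by (intro tendsto_intros lim)
  then have Nu: "Nn u = 1" using N\<psi> LIMSEQ_unique[OF _ tendsto_const] by simp
  have eq: "- \<Delta> u x = (\<theta> * \<eta> x - 1) * u x" for x
    using Euler_Lagrange[OF \<psi>C lim Jlim low, of x] by (simp add: p_def algebra_simps)
  have "(\<Sum>x\<in>A. m x * \<Gamma> u u x) \<le> \<theta>" if A: "finite A" for A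
  proof (rule LIMSEQ_le[OF _ \<psi>lim])
    show "(\<lambda>k. \<Sum>x\<in>A. m x * \<Gamma> (\<psi> k) (\<psi> k) x) \<longlonglongrightarrow> (\<Sum>x\<in>A. m x * \<Gamma> u u x)"
      by (intro tendsto_intros \<Gamma>_tendsto lim)
    have "(\<Sum>x\<in>A. m x * \<Gamma> (\<psi> k) (\<psi> k) x) \<le> form (\<psi> k)" for k
    proof -
      have "(\<Sum>x\<in>A. m x * \<Gamma> (\<psi> k) (\<psi> k) x) \<le> vint (\<Gamma> (\<psi> k) (\<psi> k))"
        by (rule finite_sum_le_vint) (use A \<psi>C in auto)
      then show ?thesis using vint_sq_nonneg[of "\<psi> k"] \<psi>C by (simp add: form_split)
    qed
    then show "\<exists>M. \<forall>k\<ge>M. (\<Sum>x\<in>A. m x * \<Gamma> (\<psi> k) (\<psi> k) x) \<le> form (\<psi> k)" by blast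
  qed
  then have energy: "vsummable (\<Gamma> u u)" "vint (\<Gamma> u u) \<le> \<theta>"
    using vint_bounded_finite_sums[of "\<Gamma> u u" \<theta>] by auto
  have "(\<Sum>x\<in>A. m x * (u x)\<^sup>2) \<le> \<theta> / (c + 1)" if A: "finite A" for A
  proof (rule LIMSEQ_le)
    show "(\<lambda>k. \<Sum>x\<in>A. m x * (\<psi> k x)\<^sup>2) \<longlonglongrightarrow> (\<Sum>x\<in>A. m x * (u x)\<^sup>2)" by (intro tendsto_intros lim)
    show "(\<lambda>k. form (\<psi> k) / (c + 1)) \<longlonglongrightarrow> \<theta> / (c + 1)" using c by (intro tendsto_intros \<psi>lim) simp
    have "(\<Sum>x\<in>A. m x * (\<psi> k x)\<^sup>2) \<le> form (\<psi> k) / (c + 1)" for k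
    proof -
      have "(\<Sum>x\<in>A. m x * (\<psi> k x)\<^sup>2) \<le> vint (\<lambda>x. (\<psi> k x)\<^sup>2)"
        by (rule finite_sum_le_vint) (use A \<psi>C in auto)
      also have "\<dots> \<le> form (\<psi> k) / (c + 1)"
        using form_ge_Rayleigh[OF lam \<psi>C, of k] c by (simp add: field_simps)
      finally show ?thesis .
    qed
    then show "\<exists>M. \<forall>k\<ge>M. (\<Sum>x\<in>A. m x * (\<psi> k x)\<^sup>2) \<le> form (\<psi> k) / (c + 1)" by blast
  qed
  then have "vint (\<lambda>x. (u x)\<^sup>2) \<le> \<theta> / (c + 1)"
    using vint_bounded_finite_sums[of "\<lambda>x. (u x)\<^sup>2"] by auto
  then have mass: "c * vint (\<lambda>x. (u x)\<^sup>2) \<le> \<theta> - vint (\<lambda>x. (u x)\<^sup>2)" using c by (simp add: field_simps)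
  have su: "vsummable (\<lambda>x. (u x)\<^sup>2)" using ue by (simp add: ell2_iff)
  have s\<eta>: "vsummable (\<lambda>x. \<eta> x * (u x)\<^sup>2)" by (intro vsummable_C0 C0_mult_left \<eta>)
  have "vint (\<lambda>x. (\<theta> * \<eta> x - 1) * (u x)\<^sup>2) = vint (\<lambda>x. \<theta> * (\<eta> x * (u x)\<^sup>2) - (u x)\<^sup>2)"
    by (simp add: algebra_simps)
  also have "\<dots> = \<theta> * Nn u - vint (\<lambda>x. (u x)\<^sup>2)"
    unfolding Nn_def vint_cmult[symmetric] by (intro vint_diff vsummable_cmult s\<eta> su)
  finally have hu: "vint (\<lambda>x. (\<theta> * \<eta> x - 1) * (u x)\<^sup>2) = \<theta> - vint (\<lambda>x. (u x)\<^sup>2)" by (simp add: Nu)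
  have "Nn u \<le> vint (\<lambda>x. (u x)\<^sup>2)" unfolding Nn_def
  proof (rule vint_mono[OF s\<eta> su])
    show "\<eta> x * (u x)\<^sup>2 \<le> (u x)\<^sup>2" for x using mult_right_mono[OF \<eta>01(2)[of x], of "(u x)\<^sup>2"] by simp
  qed
  then have "\<theta> * 1 \<le> \<theta> * vint (\<lambda>x. (u x)\<^sup>2)" using \<theta>0 Nu by (intro mult_left_mono) auto
  then have en: "vint (\<Gamma> u u) \<le> \<theta> * vint (\<lambda>x. (u x)\<^sup>2)" using energy(2) by simp
  have pos: "u x > 0" for x
  proof (rule ccontr)
    assume "\<not> u x > 0"
    then have "u x = 0" using u0[of x] by linarith
    have "u y = 0" for y
    proof (rule vanishing_spreads[where u = u, OF con u0])
      show "\<Delta> u y = 0" if "u y = 0" for y using eq[of y] that by simp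
    qed (rule \<open>u x = 0\<close>)
    then show False using Nu by (simp add: Nn_def)
  qed
  have "\<theta> * (m z * \<eta> z) \<le> form (\<lambda>y. if y = z then 1 else 0)"
    using \<theta>[OF \<delta>] N\<delta> by (simp add: \<delta>_def[abs_def])
  from that[OF \<theta>0 this pos ue energy(1) en eq] show ?thesis using mass hu by simp
qed

section \<open>Caccioppoli and Green estimates with cutoffs\<close>

text \<open>
  The weighted sum over the neighbours normalised as in the gradient form, so that inequalities
  between gradients can be checked edge by edge.
\<close>
definition edge_mean :: "'v \<Rightarrow> ('v \<Rightarrow> real) \<Rightarrow> real" where
  "edge_mean x A = (1 / (2 * m x)) * (\<Sum>y\<in>N x. \<omega> x y * A y)"

lemma \<Gamma>_edge_mean: "\<Gamma> f g x = edge_mean x (\<lambda>y. (f y - f x) * (g y - g x))"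
  by (simp add: Gam_def edge_mean_def mult.assoc)

lemma edge_mean_mono: "(\<And>y. A y \<le> B y) \<Longrightarrow> edge_mean x A \<le> edge_mean x B"
  unfolding edge_mean_def by (intro mult_left_mono sum_mono) auto

lemma edge_mean_add: "edge_mean x (\<lambda>y. A y + B y) = edge_mean x A + edge_mean x B"
  by (simp add: edge_mean_def distrib_left sum.distrib add_divide_distrib)

lemma edge_mean_cmult: "edge_mean x (\<lambda>y. c * A y) = c * edge_mean x A"
  by (simp add: edge_mean_def sum_distrib_left mult.left_commute)

lemma vint_edge_swap:
  assumes S: "finite S" and A: "\<And>x y. x \<notin> S \<Longrightarrow> y \<notin> S \<Longrightarrow> A x y = 0"
  shows "vint (\<lambda>x. edge_mean x (A x)) = vint (\<lambda>x. edge_mean x (\<lambda>y. A y x))"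
    and "vsummable (\<lambda>x. edge_mean x (A x))"
proof -
  have *: "vint (\<lambda>x. edge_mean x (A x)) = (1/2) * (\<Sum>x\<in>closed_nbhd S. \<Sum>y\<in>N x. \<omega> x y * A x y)
      \<and> vsummable (\<lambda>x. edge_mean x (A x))"
    if A: "\<And>x y. x \<notin> S \<Longrightarrow> y \<notin> S \<Longrightarrow> A x y = 0" for A
  proof -
    have out: "edge_mean x (A x) = 0" if "x \<notin> closed_nbhd S" for x
    proof -
      have "x \<notin> S" and "\<And>y. y \<in> N x \<Longrightarrow> y \<notin> S" using that N_sym by (auto simp: closed_nbhd_def)
      then show ?thesis using A by (simp add: edge_mean_def)
    qed
    have "vint (\<lambda>x. edge_mean x (A x)) = (\<Sum>x\<in>closed_nbhd S. m x * edge_mean x (A x))"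
      by (rule vint_finite(1)[OF finite_closed_nbhd[OF S]]) (rule out)
    also have "\<dots> = (\<Sum>x\<in>closed_nbhd S. (1/2) * (\<Sum>y\<in>N x. \<omega> x y * A x y))"
      by (intro sum.cong refl) (simp add: edge_mean_def)
    finally have "vint (\<lambda>x. edge_mean x (A x)) = (1/2) * (\<Sum>x\<in>closed_nbhd S. \<Sum>y\<in>N x. \<omega> x y * A x y)"
      by (simp only: sum_distrib_left)
    moreover have "vsummable (\<lambda>x. edge_mean x (A x))"
      by (rule vint_finite(2)[OF finite_closed_nbhd[OF S]]) (rule out)
    ultimately show ?thesis by blast
  qed
  show "vsummable (\<lambda>x. edge_mean x (A x))" using *[OF A] by simp
  have "vint (\<lambda>x. edge_mean x (A x)) = (1/2) * (\<Sum>x\<in>closed_nbhd S. \<Sum>y\<in>N x. \<omega> x y * A x y)"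
    using *[OF A] by simp
  also have "\<dots> = (1/2) * (\<Sum>x\<in>closed_nbhd S. \<Sum>y\<in>N x. \<omega> x y * A y x)"
    by (rule arg_cong[of _ _ "\<lambda>t. (1/2) * t"]) (rule edge_sum_swap[OF S A])
  also have "\<dots> = vint (\<lambda>x. edge_mean x (\<lambda>y. A y x))"
    by (rule *[THEN conjunct1, symmetric]) (rule A)
  finally show "vint (\<lambda>x. edge_mean x (A x)) = vint (\<lambda>x. edge_mean x (\<lambda>y. A y x))" .
qed

lemma weighted_\<Gamma>_le:
  assumes s: "s > 0"
  shows "\<bar>a * \<Gamma> f g x\<bar> \<le> (1/2) * (s * \<Gamma> g g x + a\<^sup>2 / s * \<Gamma> f f x)"
proof -
  have key: "a * \<Gamma> f g x \<le> (1/2) * (s * \<Gamma> g g x + a\<^sup>2 / s * \<Gamma> f f x)" for a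
  proof -
    have "edge_mean x (\<lambda>y. a * ((f y - f x) * (g y - g x)))
        \<le> edge_mean x (\<lambda>y. (s/2) * ((g y - g x) * (g y - g x)) + (a\<^sup>2 / (2 * s)) * ((f y - f x) * (f y - f x)))"
    proof (rule edge_mean_mono)
      fix y
      define p where "p = f y - f x"
      define q where "q = g y - g x"
      have "0 \<le> (1 / (2 * s)) * (s * q - a * p)\<^sup>2" using s by simp
      also have "\<dots> = (s/2) * (q * q) + (a\<^sup>2 / (2 * s)) * (p * p) - a * (p * q)"
        using s by (simp add: power2_eq_square field_simps)
      finally show "a * ((f y - f x) * (g y - g x))
        \<le> (s/2) * ((g y - g x) * (g y - g x)) + (a\<^sup>2 / (2 * s)) * ((f y - f x) * (f y - f x))"
        by (simp add: p_def q_def)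
    qed
    then show ?thesis unfolding edge_mean_add edge_mean_cmult \<Gamma>_edge_mean by simp
  qed
  show ?thesis using key[of a] key[of "-a"] by simp
qed

lemma \<Delta>_power2: "\<Delta> (\<lambda>z. (f z)\<^sup>2) x = 2 * f x * \<Delta> f x + 2 * \<Gamma> f f x"
proof -
  have "(\<Sum>y\<in>N x. \<omega> x y * ((f y)\<^sup>2 - (f x)\<^sup>2))
      = 2 * f x * (\<Sum>y\<in>N x. \<omega> x y * (f y - f x)) + (\<Sum>y\<in>N x. \<omega> x y * (f y - f x) * (f y - f x))"
    unfolding sum_distrib_left sum.distrib[symmetric]
    by (intro sum.cong refl) (simp add: power2_eq_square algebra_simps)
  then show ?thesis by (simp add: laplacian_def Gam_def distrib_left add_divide_distrib)
qed

text \<open>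
  The elementary inequality \<open>ln s \<le> s - 1\<close>, applied to \<open>s = f y / f x\<close>.
\<close>
lemma \<Delta>_ln_le:
  assumes "\<And>y. f y > 0"
  shows "\<Delta> (\<lambda>y. ln (f y)) x \<le> \<Delta> f x / f x"
proof -
  have "\<Delta> (\<lambda>y. ln (f y)) x \<le> \<Delta> (\<lambda>y. (1 / f x) * f y) x"
    unfolding laplacian_def
  proof (intro mult_left_mono sum_mono)
    fix y
    have "ln (f y) - ln (f x) = ln (f y / f x)" using assms[of x] assms[of y] by (simp add: ln_div)
    also have "\<dots> \<le> f y / f x - 1" using assms[of x] assms[of y] by (intro ln_le_minus_one) simp
    finally show "ln (f y) - ln (f x) \<le> (1 / f x) * f y - (1 / f x) * f x" using assms[of x] by simp
  qed auto
  also have "\<dots> = \<Delta> f x / f x" unfolding \<Delta>_cmult by simp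
  finally show ?thesis .
qed

text \<open>
  Test the differential inequality with \<open>\<xi>\<^sup>2 F\<close>.  On an edge,
  \<open>(\<xi>'F' - \<xi> F)\<^sup>2 = (\<xi>'\<^sup>2 F' - \<xi>\<^sup>2 F) (F' - F) + F F' (\<xi>' - \<xi>)\<^sup>2\<close>, and the error
  term is symmetric, so it can be moved to one endpoint and bounded by \<open>F\<^sup>2 \<Gamma>(\<xi>)\<close>.
\<close>
lemma Caccioppoli:
  assumes F0: "\<And>x. F x \<ge> 0" and F: "F \<in> ell2 G" and w: "w \<in> ell2 G"
    and sub: "\<And>x. - \<Delta> F x \<le> w x" and w0: "\<And>x. w x \<ge> 0" and cut: "cutoffs \<xi> \<delta>"
  shows "vsummable (\<Gamma> F F)"
proof -
  note \<xi> = cutoffsD[OF cut]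
  obtain B where B: "\<And>k. \<bar>\<delta> k\<bar> \<le> B"
    using convergent_imp_Bseq[OF convergentI[OF \<xi>(7)]] unfolding Bseq_def by (auto simp: real_norm_def)
  define C where "C = vint (\<lambda>x. F x * w x) + B\<^sup>2 * vint (\<lambda>x. (F x)\<^sup>2)"
  have en: "vint (\<Gamma> (\<lambda>x. \<xi> k x * F x) (\<lambda>x. \<xi> k x * F x)) \<le> C" for k
  proof -
    define A where "A x y = F x * F y * (\<xi> k y - \<xi> k x)\<^sup>2" for x y
    define S where "S = {x. \<xi> k x \<noteq> 0}"
    have S: "finite S" using \<xi>(1)[of k] by (simp add: S_def C0_iff)
    have A0: "A x y = 0" if "x \<notin> S" "y \<notin> S" for x y using that by (auto simp: A_def S_def)
    define A' where "A' x y = (F x)\<^sup>2 * (\<xi> k y - \<xi> k x)\<^sup>2" for x y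
    have A'0: "A' x y = 0" if "x \<notin> S" "y \<notin> S" for x y using that by (auto simp: A'_def S_def)
    have C1: "(\<lambda>x. (\<xi> k x)\<^sup>2 * F x) \<in> C0" by (intro C0_mult_left C0_power2 \<xi>)
    have "\<Gamma> (\<lambda>x. \<xi> k x * F x) (\<lambda>x. \<xi> k x * F x) x
        = \<Gamma> (\<lambda>x. (\<xi> k x)\<^sup>2 * F x) F x + edge_mean x (A x)" for x
      unfolding \<Gamma>_edge_mean edge_mean_add[symmetric] A_def
      by (rule arg_cong[of _ _ "edge_mean x"]) (auto simp: power2_eq_square algebra_simps)
    then have "vint (\<Gamma> (\<lambda>x. \<xi> k x * F x) (\<lambda>x. \<xi> k x * F x))
        = vint (\<lambda>x. \<Gamma> (\<lambda>x. (\<xi> k x)\<^sup>2 * F x) F x + edge_mean x (A x))" by (intro arg_cong[of _ _ vint] ext)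
    also have "\<dots> = vint (\<Gamma> (\<lambda>x. (\<xi> k x)\<^sup>2 * F x) F) + vint (\<lambda>x. edge_mean x (A x))"
      by (intro vint_add vsummable_C0 C0_\<Gamma> C1 vint_edge_swap(2)[OF S A0])
    also have "vint (\<Gamma> (\<lambda>x. (\<xi> k x)\<^sup>2 * F x) F) = vint (\<lambda>x. (\<xi> k x)\<^sup>2 * F x * - \<Delta> F x)"
      unfolding summation_by_parts[OF C1] by (simp add: vint_minus[symmetric])
    also have "\<dots> \<le> vint (\<lambda>x. F x * w x)"
    proof (rule vint_mono)
      show "vsummable (\<lambda>x. (\<xi> k x)\<^sup>2 * F x * - \<Delta> F x)" by (intro vsummable_C0 C0_mult_left[OF C1])
      show "vsummable (\<lambda>x. F x * w x)" by (rule ell2_mult[OF F w])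
      fix x
      have "(\<xi> k x)\<^sup>2 * F x * - \<Delta> F x \<le> (\<xi> k x)\<^sup>2 * F x * w x"
        using F0 sub by (intro mult_left_mono) auto
      also have "\<dots> \<le> 1 * (F x * w x)"
        unfolding mult.assoc using F0 w0 \<xi>(2,3)[of k x] by (intro mult_right_mono) (auto simp: power_le_one)
      finally show "(\<xi> k x)\<^sup>2 * F x * - \<Delta> F x \<le> F x * w x" by simp
    qed
    also have "vint (\<lambda>x. edge_mean x (A x)) \<le> vint (\<lambda>x. edge_mean x (\<lambda>y. (1/2) * A' x y + (1/2) * A' y x))"
    proof (rule vint_mono[OF vint_edge_swap(2)[OF S A0] vint_edge_swap(2)[OF S]])
      fix x
      show "edge_mean x (A x) \<le> edge_mean x (\<lambda>y. (1/2) * A' x y + (1/2) * A' y x)"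
      proof (rule edge_mean_mono)
        fix y
        have "F x * F y \<le> (1/2) * (F x)\<^sup>2 + (1/2) * (F y)\<^sup>2" using sum_squares_bound[of "F x" "F y"] by simp
        from mult_right_mono[OF this, of "(\<xi> k y - \<xi> k x)\<^sup>2"]
        show "A x y \<le> (1/2) * A' x y + (1/2) * A' y x"
          by (simp add: A_def A'_def power2_commute[of "\<xi> k x"] distrib_right mult.assoc)
      qed
    next
      fix x y assume "x \<notin> S" "y \<notin> S"
      then show "(1/2) * A' x y + (1/2) * A' y x = 0" using A'0 by simp
    qed
    also have "\<dots> = vint (\<lambda>x. (1/2) * edge_mean x (A' x) + (1/2) * edge_mean x (\<lambda>y. A' y x))"
      unfolding edge_mean_add edge_mean_cmult ..
    also have "\<dots> = (1/2) * vint (\<lambda>x. edge_mean x (A' x)) + (1/2) * vint (\<lambda>x. edge_mean x (\<lambda>y. A' y x))"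
      unfolding vint_cmult[symmetric]
      by (intro vint_add vsummable_cmult vint_edge_swap(2)[OF S] A'0)
    also have "vint (\<lambda>x. edge_mean x (\<lambda>y. A' y x)) = vint (\<lambda>x. edge_mean x (A' x))"
      by (rule vint_edge_swap(1)[OF S, symmetric]) (rule A'0)
    also have "(1/2) * vint (\<lambda>x. edge_mean x (A' x)) + (1/2) * vint (\<lambda>x. edge_mean x (A' x))
        = vint (\<lambda>x. edge_mean x (A' x))" by simp
    also have "\<dots> \<le> vint (\<lambda>x. B\<^sup>2 * (F x)\<^sup>2)"
    proof (rule vint_mono[OF vint_edge_swap(2)[OF S A'0]])
      show "vsummable (\<lambda>x. B\<^sup>2 * (F x)\<^sup>2)" using F by (intro vsummable_cmult) (simp add: ell2_iff)
      fix x
      have "edge_mean x (A' x) = (F x)\<^sup>2 * \<Gamma> (\<xi> k) (\<xi> k) x"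
        unfolding A'_def \<Gamma>_edge_mean edge_mean_cmult by (simp add: power2_eq_square)
      also have "\<dots> \<le> (F x)\<^sup>2 * (\<delta> k)\<^sup>2" by (intro mult_left_mono \<xi>) simp
      also have "\<dots> \<le> (F x)\<^sup>2 * B\<^sup>2"
        using B[of k] \<xi>(6)[of k] by (intro mult_left_mono power_mono) auto
      finally show "edge_mean x (A' x) \<le> B\<^sup>2 * (F x)\<^sup>2" by (simp add: mult.commute)
    qed
    finally show ?thesis by (simp add: C_def vint_cmult)
  qed
  have "(\<Sum>x\<in>X. m x * \<Gamma> F F x) \<le> C" if X: "finite X" for X
  proof (rule LIMSEQ_le_const2)
    have "(\<lambda>k. \<xi> k y * F y) \<longlonglongrightarrow> F y" for y using tendsto_mult[OF \<xi>(4) tendsto_const] by simp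
    then show "(\<lambda>k. \<Sum>x\<in>X. m x * \<Gamma> (\<lambda>x. \<xi> k x * F x) (\<lambda>x. \<xi> k x * F x) x) \<longlonglongrightarrow> (\<Sum>x\<in>X. m x * \<Gamma> F F x)"
      by (intro tendsto_intros \<Gamma>_tendsto)
    have "(\<Sum>x\<in>X. m x * \<Gamma> (\<lambda>x. \<xi> k x * F x) (\<lambda>x. \<xi> k x * F x) x) \<le> C" for k
    proof (rule order_trans[OF finite_sum_le_vint en])
      show "vsummable (\<Gamma> (\<lambda>x. \<xi> k x * F x) (\<lambda>x. \<xi> k x * F x))"
        by (intro vsummable_C0 C0_\<Gamma> C0_mult_left \<xi>)
    qed (use X in auto)
    then show "\<exists>M. \<forall>k\<ge>M. (\<Sum>x\<in>X. m x * \<Gamma> (\<lambda>x. \<xi> k x * F x) (\<lambda>x. \<xi> k x * F x) x) \<le> C" by blast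
  qed
  then show ?thesis using vint_bounded_finite_sums(1)[of "\<Gamma> F F" C] by simp
qed

text \<open>
  The commutator \<open>\<Gamma>(\<xi> u, F) - \<Gamma>(\<xi> F, u) = u \<Gamma>(\<xi>, F) - F \<Gamma>(\<xi>, u)\<close> contains no gradient
  product of \<open>u\<close> and \<open>F\<close>: the factor at the far endpoint may be replaced by the one at \<open>x\<close>.
\<close>
lemma Green_cutoff:
  assumes u: "u \<in> ell2 G" "vsummable (\<Gamma> u u)" and F: "F \<in> ell2 G" "vsummable (\<Gamma> F F)"
    and cut: "cutoffs \<xi> \<delta>"
  shows "vint (\<lambda>x. \<xi> k x * (u x * \<Delta> F x - F x * \<Delta> u x))
     \<le> \<delta> k / 2 * vint (\<lambda>x. ((u x)\<^sup>2 + \<Gamma> F F x) + ((F x)\<^sup>2 + \<Gamma> u u x))"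
proof -
  note \<xi> = cutoffsD[OF cut]
  define \<eta> where "\<eta> = \<xi> k"
  have \<eta>: "\<eta> \<in> C0" using \<xi> by (simp add: \<eta>_def)
  define d where "d = \<delta> k"
  have d: "d > 0" "\<Gamma> \<eta> \<eta> x \<le> d\<^sup>2" for x using \<xi>(5)[of k x] \<xi>(6)[of k] by (auto simp: d_def \<eta>_def)
  have Cu: "(\<lambda>x. \<eta> x * u x) \<in> C0" and CF: "(\<lambda>x. \<eta> x * F x) \<in> C0" by (intro C0_mult_left \<eta>)+
  have "vint (\<lambda>x. \<eta> x * (u x * \<Delta> F x - F x * \<Delta> u x))
      = vint (\<lambda>x. (\<eta> x * u x) * \<Delta> F x - (\<eta> x * F x) * \<Delta> u x)" by (simp add: algebra_simps)
  also have "\<dots> = vint (\<lambda>x. (\<eta> x * u x) * \<Delta> F x) - vint (\<lambda>x. (\<eta> x * F x) * \<Delta> u x)"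
    by (intro vint_diff vsummable_C0 C0_mult_left[OF Cu] C0_mult_left[OF CF])
  also have "\<dots> = vint (\<Gamma> (\<lambda>x. \<eta> x * F x) u) - vint (\<Gamma> (\<lambda>x. \<eta> x * u x) F)"
    using summation_by_parts[OF Cu, of F] summation_by_parts[OF CF, of u] by simp
  also have "\<dots> = vint (\<lambda>x. \<Gamma> (\<lambda>x. \<eta> x * F x) u x - \<Gamma> (\<lambda>x. \<eta> x * u x) F x)"
    by (intro vint_diff[symmetric] vsummable_C0 C0_\<Gamma> Cu CF)
  also have "(\<lambda>x. \<Gamma> (\<lambda>x. \<eta> x * F x) u x - \<Gamma> (\<lambda>x. \<eta> x * u x) F x) = (\<lambda>x. F x * \<Gamma> \<eta> u x - u x * \<Gamma> \<eta> F x)"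
  proof
    fix x
    have "\<Gamma> (\<lambda>x. \<eta> x * F x) u x + u x * \<Gamma> \<eta> F x = \<Gamma> (\<lambda>x. \<eta> x * u x) F x + F x * \<Gamma> \<eta> u x"
      unfolding \<Gamma>_edge_mean edge_mean_add[symmetric] edge_mean_cmult[symmetric]
      by (rule arg_cong[of _ _ "edge_mean x"]) (auto simp: algebra_simps)
    then show "\<Gamma> (\<lambda>x. \<eta> x * F x) u x - \<Gamma> (\<lambda>x. \<eta> x * u x) F x = F x * \<Gamma> \<eta> u x - u x * \<Gamma> \<eta> F x" by simp
  qed
  also have "vint \<dots> \<le> vint (\<lambda>x. (d/2) * (((u x)\<^sup>2 + \<Gamma> F F x) + ((F x)\<^sup>2 + \<Gamma> u u x)))"
  proof (rule vint_mono)
    show "vsummable (\<lambda>x. F x * \<Gamma> \<eta> u x - u x * \<Gamma> \<eta> F x)" by (intro vsummable_C0 C0_diff C0_mult_right C0_\<Gamma> \<eta>)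
    show "vsummable (\<lambda>x. (d/2) * (((u x)\<^sup>2 + \<Gamma> F F x) + ((F x)\<^sup>2 + \<Gamma> u u x)))"
      using u F by (intro vsummable_intros) (simp_all add: ell2_iff)
    fix x
    have *: "\<bar>a * \<Gamma> \<eta> f x\<bar> \<le> (d/2) * (a\<^sup>2 + \<Gamma> f f x)" for a f
    proof -
      have "a\<^sup>2 / d * \<Gamma> \<eta> \<eta> x \<le> a\<^sup>2 / d * d\<^sup>2" using d by (intro mult_left_mono) auto
      also have "\<dots> = d * a\<^sup>2" using d by (simp add: power2_eq_square)
      finally show ?thesis using weighted_\<Gamma>_le[OF d(1), of a \<eta> f x] by (simp add: algebra_simps)
    qed
    show "F x * \<Gamma> \<eta> u x - u x * \<Gamma> \<eta> F x \<le> (d/2) * (((u x)\<^sup>2 + \<Gamma> F F x) + ((F x)\<^sup>2 + \<Gamma> u u x))"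
      using *[of "F x" u] *[of "u x" F] by (simp add: algebra_simps abs_le_iff)
  qed
  finally show ?thesis by (simp only: vint_cmult \<eta>_def d_def)
qed

end

section \<open>The curvature inequality for a slowly varying potential\<close>

text \<open>
  A positive solution of a Schroedinger equation with bounded potential \<open>h\<close>, whose gradient is at
  most \<open>\<epsilon>\<close>.
\<close>
locale slowly_varying = locally_finite_graph +
  fixes u h :: "'a \<Rightarrow> real" and H \<epsilon> :: real
  assumes u_pos: "\<And>x. u x > 0" and u_ell2: "u \<in> ell2 G" and u_energy: "vsummable (\<Gamma> u u)"
    and eq: "\<And>x. - \<Delta> u x = h x * u x"
    and h_bound: "\<And>x. \<bar>h x\<bar> \<le> H" and h_slow: "\<And>x. \<Gamma> h h x \<le> \<epsilon>\<^sup>2" and \<epsilon>_pos: "\<epsilon> > 0"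
begin

text \<open>
  CDE' is applied to \<open>f\<close>; \<open>F\<close> is its squared gradient, and \<open>- g / 2\<close> is the quotient
  \<open>\<Delta>(f\<^sup>2) / (2 f)\<close> from the definition of the modified iterated gradient.
\<close>
definition f :: "real \<Rightarrow> 'a \<Rightarrow> real" where "f \<tau> x = sqrt (u x + \<tau>)"
definition F :: "real \<Rightarrow> 'a \<Rightarrow> real" where "F \<tau> = \<Gamma> (f \<tau>) (f \<tau>)"
definition g :: "real \<Rightarrow> 'a \<Rightarrow> real" where "g \<tau> x = h x * u x / f \<tau> x"

lemma F_nonneg: "F \<tau> x \<ge> 0" by (simp add: F_def)
lemma H_nonneg: "H \<ge> 0" using h_bound[of undefined] by linarith

lemma f_step:
  assumes "\<tau> > 0"
  shows "f \<tau> x > 0" "(f \<tau> x)\<^sup>2 = u x + \<tau>"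
    "\<bar>f \<tau> y - f \<tau> x\<bar> * f \<tau> y \<le> \<bar>u y - u x\<bar>" "u x * (f \<tau> y - f \<tau> x)\<^sup>2 \<le> (u y - u x)\<^sup>2"
    "(f \<tau> y - f \<tau> x)\<^sup>2 \<le> (u y - u x)\<^sup>2 / (4 * \<tau>)" "(f \<tau> y - f \<tau> x)\<^sup>2 \<le> \<bar>u y - u x\<bar>"
    "\<tau> / (f \<tau> x * f \<tau> y) \<le> 1" "\<tau> / (f \<tau> x * f \<tau> y) \<le> sqrt \<tau> / sqrt (u x)"
  unfolding f_def using sqrt_shift_step[OF u_pos[of x] u_pos[of y] assms] by auto

lemma \<Delta>_f_square: "\<tau> > 0 \<Longrightarrow> \<Delta> (\<lambda>z. (f \<tau> z)\<^sup>2) x = - h x * u x"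
proof -
  assume "\<tau> > 0"
  then have "(\<lambda>z. (f \<tau> z)\<^sup>2) = (\<lambda>z. u z + \<tau>)" using f_step(2) by auto
  then have "\<Delta> (\<lambda>z. (f \<tau> z)\<^sup>2) x = \<Delta> u x" by (simp add: laplacian_def)
  then show ?thesis using eq[of x] by simp
qed

lemma Gam2_f:
  assumes "\<tau> > 0"
  shows "Gam2_tilde G (f \<tau>) x = (1/2) * \<Delta> (F \<tau>) x + (1/2) * \<Gamma> (f \<tau>) (g \<tau>) x"
proof -
  have "(\<lambda>y. \<Delta> (\<lambda>z. (f \<tau> z)\<^sup>2) y / (2 * f \<tau> y)) = (\<lambda>y. (-1/2) * g \<tau> y)"
    by (rule ext) (simp add: \<Delta>_f_square[OF assms] g_def)
  then show ?thesis unfolding Gam2_tilde_def by (simp only: \<Gamma>_cmult_right F_def)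
qed

text \<open>
  The first bound is sharp where \<open>\<tau>\<close> is small against \<open>u\<close>.  The second is crude, but
  multiplied by \<open>u\<close> it is dominated by \<open>\<Gamma>(u)\<close> uniformly in \<open>\<tau>\<close>, and serves on the complement of a finite
  set.
\<close>
lemma curvature_lower_bounds:
  assumes CDE: "CDE' G n (- K)" and n: "n > 0" and K: "K > 0" and \<tau>: "\<tau> > 0"
  shows "(1/2) * \<Delta> (F \<tau>) x + (1/2) * \<Gamma> (f \<tau>) (g \<tau>) x \<ge> (K/2) * (h x * u x - (n * K / 2) * (u x + \<tau>))"
    and "(1/2) * \<Delta> (F \<tau>) x + (1/2) * \<Gamma> (f \<tau>) (g \<tau>) x \<ge> - K * F \<tau> x"
proof -
  define L where "L = \<Delta> (\<lambda>y. ln (f \<tau> y)) x"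
  define v where "v = u x + \<tau>"
  have v: "v > 0" using u_pos[of x] \<tau> by (simp add: v_def)
  have "Gam2_tilde G (f \<tau>) x \<ge> (1/n) * (f \<tau> x)\<^sup>2 * L\<^sup>2 + (- K) * \<Gamma> (f \<tau>) (f \<tau>) x"
    using CDE f_step(1)[OF \<tau>] unfolding CDE'_def L_def by blast
  then have lower: "(1/2) * \<Delta> (F \<tau>) x + (1/2) * \<Gamma> (f \<tau>) (g \<tau>) x \<ge> (1/n) * v * L\<^sup>2 - K * F \<tau> x"
    unfolding Gam2_f[OF \<tau>] f_step(2)[OF \<tau>] v_def F_def by simp
  define P where "P = h x * u x / 2 + F \<tau> x"
  have "- h x * u x = 2 * f \<tau> x * \<Delta> (f \<tau>) x + 2 * F \<tau> x"
    using \<Delta>_power2[of "f \<tau>" x] \<Delta>_f_square[OF \<tau>, of x] by (simp add: F_def)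
  then have "f \<tau> x * \<Delta> (f \<tau>) x = - P" by (simp add: P_def)
  then have "\<Delta> (f \<tau>) x / f \<tau> x = - P / (f \<tau> x)\<^sup>2" using f_step(1)[OF \<tau>, of x] by (simp add: power2_eq_square field_simps)
  then have L: "L \<le> - P / v"
    using \<Delta>_ln_le[of "f \<tau>" x, OF f_step(1)[OF \<tau>]] unfolding f_step(2)[OF \<tau>] v_def L_def by simp
  have "K * (P - F \<tau> x) - n * K\<^sup>2 * v / 4 = (K/2) * (h x * u x - (n * K / 2) * (u x + \<tau>))"
    by (simp add: P_def v_def power2_eq_square field_simps)
  then show "(1/2) * \<Delta> (F \<tau>) x + (1/2) * \<Gamma> (f \<tau>) (g \<tau>) x \<ge> (K/2) * (h x * u x - (n * K / 2) * (u x + \<tau>))"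
    using curvature_square[OF v n K L, of "F \<tau> x"] lower by linarith
  have "(1/n) * v * L\<^sup>2 \<ge> 0" using n v by simp
  then show "(1/2) * \<Delta> (F \<tau>) x + (1/2) * \<Gamma> (f \<tau>) (g \<tau>) x \<ge> - K * F \<tau> x" using lower by linarith
qed

lemma u_F_le: assumes \<tau>: "\<tau> > 0" shows "u x * F \<tau> x \<le> \<Gamma> u u x"
  unfolding F_def \<Gamma>_edge_mean edge_mean_cmult[symmetric]
  by (rule edge_mean_mono) (use f_step(4)[OF \<tau>, of x] in \<open>simp add: power2_eq_square\<close>)

lemma F_le_energy: assumes \<tau>: "\<tau> > 0" shows "F \<tau> x \<le> (1 / (4 * \<tau>)) * \<Gamma> u u x"
  unfolding F_def \<Gamma>_edge_mean edge_mean_cmult[symmetric]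
  by (rule edge_mean_mono) (use f_step(5)[OF \<tau>, of _ x] in \<open>simp add: power2_eq_square\<close>)

text \<open>
  On an edge, \<open>g' - g\<close> is \<open>h (f' - f) (1 + \<tau> / (f f'))\<close> plus \<open>(h' - h) u' / f'\<close>.  The part
  \<open>h (f' - f)\<close> cancels against \<open>h F\<close>, the shift produces the term with \<open>t\<close>, and in the last part
  \<open>u' / f' \<le> f'\<close> together with \<open>\<bar>f' - f\<bar> f' \<le> \<bar>u' - u\<bar>\<close> trades the gradient of \<open>f\<close> for that of \<open>u\<close>.
\<close>
lemma commutator_upper:
  assumes \<tau>: "\<tau> > 0" and t: "\<And>y. \<tau> / (f \<tau> x * f \<tau> y) \<le> t" and t0: "t \<ge> 0"
  shows "u x * (\<Gamma> (f \<tau>) (g \<tau>) x - h x * F \<tau> x) \<le> (\<epsilon>/2) * (\<Gamma> u u x + (u x)\<^sup>2) + H * t * \<Gamma> u u x"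
proof -
  have "edge_mean x (\<lambda>y. u x * ((f \<tau> y - f \<tau> x) * (g \<tau> y - g \<tau> x)))
      \<le> edge_mean x (\<lambda>y. (u x * h x) * ((f \<tau> y - f \<tau> x) * (f \<tau> y - f \<tau> x))
            + ((\<epsilon>/2 + H * t) * ((u y - u x) * (u y - u x)) + ((u x)\<^sup>2 / (2 * \<epsilon>)) * ((h y - h x) * (h y - h x))))"
  proof (rule edge_mean_mono)
    fix y
    define a b p q df dh du where ab: "a = u x" "b = u y" "p = f \<tau> x" "q = f \<tau> y"
      "df = q - p" "dh = h y - h x" "du = b - a"
    have a0: "a > 0" and b0: "b > 0" using u_pos by (auto simp: ab)
    have p0: "p > 0" and q0: "q > 0" using f_step(1)[OF \<tau>] by (auto simp: ab)
    have pp: "p\<^sup>2 = a + \<tau>" and qq: "q\<^sup>2 = b + \<tau>" using f_step(2)[OF \<tau>] by (auto simp: ab)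
    have e1: "b / q = q - \<tau> / q" and e2: "a / p = p - \<tau> / p"
      using pp qq p0 q0 by (simp_all add: power2_eq_square field_simps)
    have e3: "\<tau> / p - \<tau> / q = (\<tau> / (p * q)) * df" using p0 q0 by (simp add: ab field_simps)
    have "g \<tau> y - g \<tau> x = (h x + dh) * (b / q) - h x * (a / p)" by (simp add: g_def ab)
    also have "\<dots> = dh * (b / q) + h x * (b / q - a / p)" by (simp add: algebra_simps)
    also have "b / q - a / p = df + (\<tau> / (p * q)) * df" unfolding e1 e2 e3[symmetric] by (simp add: ab)
    finally have dg: "g \<tau> y - g \<tau> x = dh * (b / q) + h x * (df + (\<tau> / (p * q)) * df)" .
    have "b / q \<le> q" unfolding e1 using \<tau> q0 by simp
    then have "\<bar>df\<bar> * (b / q) \<le> \<bar>df\<bar> * q" by (rule mult_left_mono) simp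
    also have "\<dots> \<le> \<bar>du\<bar>" using f_step(3)[OF \<tau>, of y x] by (simp add: ab)
    finally have d1: "\<bar>df\<bar> * (b / q) \<le> \<bar>du\<bar>" .
    have "a * (df * (dh * (b / q))) \<le> \<bar>a * (df * (dh * (b / q)))\<bar>" by (rule abs_ge_self)
    also have "\<dots> = a * \<bar>dh\<bar> * (\<bar>df\<bar> * (b / q))" using a0 b0 q0 by (simp add: abs_mult)
    also have "\<dots> \<le> a * \<bar>dh\<bar> * \<bar>du\<bar>" using a0 by (intro mult_left_mono d1) auto
    also have "\<dots> \<le> (\<epsilon>/2) * (du * du) + (a\<^sup>2 / (2 * \<epsilon>)) * (dh * dh)"
    proof -
      have "0 \<le> (1 / (2 * \<epsilon>)) * (\<epsilon> * \<bar>du\<bar> - a * \<bar>dh\<bar>)\<^sup>2" using \<epsilon>_pos by simp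
      also have "\<dots> = (\<epsilon>/2) * (\<bar>du\<bar> * \<bar>du\<bar>) + (a\<^sup>2 / (2 * \<epsilon>)) * (\<bar>dh\<bar> * \<bar>dh\<bar>) - a * \<bar>dh\<bar> * \<bar>du\<bar>"
        using \<epsilon>_pos by (simp add: power2_eq_square field_simps)
      finally show ?thesis by simp
    qed
    finally have part1: "a * (df * (dh * (b / q))) \<le> (\<epsilon>/2) * (du * du) + (a\<^sup>2 / (2 * \<epsilon>)) * (dh * dh)" .
    have tpq: "0 \<le> \<tau> / (p * q)" "\<tau> / (p * q) \<le> t" using \<tau> p0 q0 t[of y] by (auto simp: ab)
    have part2: "h x * ((\<tau> / (p * q)) * (a * (df * df))) \<le> H * (t * (du * du))"
    proof (rule order_trans[OF mult_right_mono mult_left_mono])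
      show "h x \<le> H" using h_bound[of x] by simp
      show "0 \<le> \<tau> / (p * q) * (a * (df * df))" using a0 by (intro mult_nonneg_nonneg[OF tpq(1)]) simp
      show "\<tau> / (p * q) * (a * (df * df)) \<le> t * (du * du)"
      proof (rule mult_mono[OF tpq(2) _ t0])
        show "a * (df * df) \<le> du * du" using f_step(4)[OF \<tau>, of x y] by (simp add: ab power2_eq_square)
      qed (use a0 in simp)
    qed (rule H_nonneg)
    have "u x * ((f \<tau> y - f \<tau> x) * (g \<tau> y - g \<tau> x))
        = (a * h x) * (df * df) + (a * (df * (dh * (b / q))) + h x * ((\<tau> / (p * q)) * (a * (df * df))))"
    proof -
      have "f \<tau> y - f \<tau> x = df" "u x = a" by (simp_all add: ab)
      moreover have "a * (df * (dh * r + h x * (df + \<rho> * df)))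
          = (a * h x) * (df * df) + (a * (df * (dh * r)) + h x * (\<rho> * (a * (df * df))))" for r \<rho>
        by (simp add: algebra_simps)
      ultimately show ?thesis unfolding dg by (simp only:)
    qed
    also have "\<dots> \<le> (a * h x) * (df * df) + ((\<epsilon>/2) * (du * du) + (a\<^sup>2 / (2 * \<epsilon>)) * (dh * dh) + H * (t * (du * du)))"
      using part1 part2 by simp
    finally show "u x * ((f \<tau> y - f \<tau> x) * (g \<tau> y - g \<tau> x))
      \<le> (u x * h x) * ((f \<tau> y - f \<tau> x) * (f \<tau> y - f \<tau> x))
            + ((\<epsilon>/2 + H * t) * ((u y - u x) * (u y - u x)) + ((u x)\<^sup>2 / (2 * \<epsilon>)) * ((h y - h x) * (h y - h x)))"
      by (simp add: ab algebra_simps)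
  qed
  then have "u x * \<Gamma> (f \<tau>) (g \<tau>) x
      \<le> (u x * h x) * F \<tau> x + ((\<epsilon>/2 + H * t) * \<Gamma> u u x + ((u x)\<^sup>2 / (2 * \<epsilon>)) * \<Gamma> h h x)"
    unfolding edge_mean_add edge_mean_cmult \<Gamma>_edge_mean[symmetric] F_def .
  also have "((u x)\<^sup>2 / (2 * \<epsilon>)) * \<Gamma> h h x \<le> ((u x)\<^sup>2 / (2 * \<epsilon>)) * \<epsilon>\<^sup>2"
    using h_slow[of x] \<epsilon>_pos by (intro mult_left_mono) auto
  also have "\<dots> = (\<epsilon>/2) * (u x)\<^sup>2" using \<epsilon>_pos by (simp add: power2_eq_square)
  finally show ?thesis by (simp add: algebra_simps)
qed

text \<open>
  Here the difference \<open>g' - g\<close> is split with \<open>u / f\<close> taken at \<open>x\<close> and \<open>h\<close> at the far endpoint,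
  so that the right-hand side depends on \<open>u\<close> at \<open>x\<close> only; this is the form needed for a
  differential inequality \<open>- \<Delta> F \<le> C (F + u)\<close>.
\<close>
lemma gradient_pairing_bound:
  assumes \<tau>: "\<tau> > 0"
  shows "\<Gamma> (f \<tau>) (g \<tau>) x \<le> (2 * H + 1/2) * F \<tau> x + (\<epsilon>\<^sup>2 / 2) * u x"
proof -
  have "edge_mean x (\<lambda>y. (f \<tau> y - f \<tau> x) * (g \<tau> y - g \<tau> x))
      \<le> edge_mean x (\<lambda>y. (2 * H + 1/2) * ((f \<tau> y - f \<tau> x) * (f \<tau> y - f \<tau> x)) + (u x / 2) * ((h y - h x) * (h y - h x)))"
  proof (rule edge_mean_mono)
    fix y
    define a b p q df dh where ab: "a = u x" "b = u y" "p = f \<tau> x" "q = f \<tau> y"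
      "df = q - p" "dh = h y - h x"
    have a0: "a > 0" and b0: "b > 0" using u_pos by (auto simp: ab)
    have p0: "p > 0" and q0: "q > 0" using f_step(1)[OF \<tau>] by (auto simp: ab)
    have pp: "p\<^sup>2 = a + \<tau>" and qq: "q\<^sup>2 = b + \<tau>" using f_step(2)[OF \<tau>] by (auto simp: ab)
    have e1: "b / q = q - \<tau> / q" and e2: "a / p = p - \<tau> / p"
      using pp qq p0 q0 by (simp_all add: power2_eq_square field_simps)
    have e3: "\<tau> / p - \<tau> / q = (\<tau> / (p * q)) * df" using p0 q0 by (simp add: ab field_simps)
    have "g \<tau> y - g \<tau> x = h y * (b / q) - (h y - dh) * (a / p)" by (simp add: g_def ab)
    also have "\<dots> = dh * (a / p) + h y * (b / q - a / p)" by (simp add: algebra_simps)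
    also have "b / q - a / p = (1 + \<tau> / (p * q)) * df" unfolding e1 e2 distrib_right e3[symmetric] by (simp add: ab)
    finally have dg: "g \<tau> y - g \<tau> x = dh * (a / p) + h y * ((1 + \<tau> / (p * q)) * df)" .
    have tpq: "0 \<le> \<tau> / (p * q)" "\<tau> / (p * q) \<le> 1" using \<tau> p0 q0 f_step(7)[OF \<tau>, of x y] by (auto simp: ab)
    have part1: "h y * ((1 + \<tau> / (p * q)) * (df * df)) \<le> H * (2 * (df * df))"
    proof (rule order_trans[OF mult_right_mono mult_left_mono])
      show "h y \<le> H" using h_bound[of y] by simp
      show "0 \<le> (1 + \<tau> / (p * q)) * (df * df)" using tpq by simp
      show "(1 + \<tau> / (p * q)) * (df * df) \<le> 2 * (df * df)" using tpq by (intro mult_right_mono) auto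
    qed (rule H_nonneg)
    have "(a / p)\<^sup>2 \<le> a"
    proof -
      have "a * a \<le> a * p\<^sup>2" unfolding pp using a0 \<tau> by (intro mult_left_mono) auto
      then show ?thesis using p0 by (simp add: power_divide power2_eq_square pos_divide_le_eq)
    qed
    then have sq: "(dh * (a / p))\<^sup>2 \<le> dh\<^sup>2 * a" unfolding power_mult_distrib by (rule mult_left_mono) simp
    have "df * z \<le> (1/2) * (df * df) + (1/2) * z\<^sup>2" for z
      using sum_squares_bound[of df z] by (simp add: power2_eq_square)
    then have "df * (dh * (a / p)) \<le> (1/2) * (df * df) + (1/2) * (dh * (a / p))\<^sup>2" .
    also have "\<dots> \<le> (1/2) * (df * df) + (a / 2) * (dh * dh)"
    proof -
      have "(a / 2) * (dh * dh) = (1/2) * (dh\<^sup>2 * a)" by (simp add: power2_eq_square)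
      then show ?thesis using sq by linarith
    qed
    finally have part2: "df * (dh * (a / p)) \<le> (1/2) * (df * df) + (a / 2) * (dh * dh)" .
    have "(f \<tau> y - f \<tau> x) * (g \<tau> y - g \<tau> x) = h y * ((1 + \<tau> / (p * q)) * (df * df)) + df * (dh * (a / p))"
    proof -
      have "f \<tau> y - f \<tau> x = df" by (simp add: ab)
      moreover have "df * (dh * r + h y * ((1 + \<rho>) * df)) = h y * ((1 + \<rho>) * (df * df)) + df * (dh * r)" for r \<rho>
        by (simp add: algebra_simps)
      ultimately show ?thesis unfolding dg by (simp only:)
    qed
    also have "\<dots> \<le> H * (2 * (df * df)) + ((1/2) * (df * df) + (a / 2) * (dh * dh))"
      using part1 part2 by (rule add_mono)
    finally show "(f \<tau> y - f \<tau> x) * (g \<tau> y - g \<tau> x)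
      \<le> (2 * H + 1/2) * ((f \<tau> y - f \<tau> x) * (f \<tau> y - f \<tau> x)) + (u x / 2) * ((h y - h x) * (h y - h x))"
      by (simp add: ab algebra_simps)
  qed
  then have "\<Gamma> (f \<tau>) (g \<tau>) x \<le> (2 * H + 1/2) * F \<tau> x + (u x / 2) * \<Gamma> h h x"
    unfolding edge_mean_add edge_mean_cmult \<Gamma>_edge_mean[symmetric] F_def .
  also have "(u x / 2) * \<Gamma> h h x \<le> (u x / 2) * \<epsilon>\<^sup>2" using h_slow[of x] u_pos[of x] by (intro mult_left_mono) auto
  finally show ?thesis by (simp add: mult.commute)
qed

lemma F_ell2_nondegenerate:
  assumes \<tau>: "\<tau> > 0" and nd: "nondegenerate G"
  shows "F \<tau> \<in> ell2 G"
proof -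
  define c where "c = (INF x. m x)"
  have c: "c > 0" using nd by (simp add: nondegenerate_def c_def)
  have cm: "c \<le> m x" for x unfolding c_def by (rule cINF_lower) (auto intro: bdd_belowI2[of _ 0])
  have sF: "vsummable (F \<tau>)"
  proof (rule vsummable_comparison)
    show "vsummable (\<lambda>x. (1 / (4 * \<tau>)) * \<Gamma> u u x)" by (intro vsummable_cmult u_energy)
    show "\<bar>F \<tau> x\<bar> \<le> (1 / (4 * \<tau>)) * \<Gamma> u u x" for x using F_nonneg[of \<tau> x] F_le_energy[OF \<tau>] by simp
  qed
  have le: "F \<tau> x \<le> vint (F \<tau>) / c" for x
  proof -
    have "c * F \<tau> x \<le> m x * F \<tau> x" by (intro mult_right_mono cm F_nonneg)
    also have "\<dots> = (\<Sum>z\<in>{x}. m z * F \<tau> z)" by simp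
    also have "\<dots> \<le> vint (F \<tau>)" by (rule finite_sum_le_vint[OF sF F_nonneg]) simp
    finally show ?thesis using c by (simp add: field_simps)
  qed
  show ?thesis unfolding ell2_iff
  proof (rule vsummable_comparison)
    show "vsummable (\<lambda>x. (vint (F \<tau>) / c) * F \<tau> x)" by (rule vsummable_cmult[OF sF])
    show "\<bar>(F \<tau> x)\<^sup>2\<bar> \<le> (vint (F \<tau>) / c) * F \<tau> x" for x
      using mult_right_mono[OF le[of x] F_nonneg[of \<tau> x]] by (simp add: power2_eq_square)
  qed
qed

text \<open>
  \<open>F\<close> is at most the mean of \<open>\<bar>u' - u\<bar>\<close>, whose square is at most \<open>\<Gamma>(u)\<close> times half of \<open>deg / m\<close>.
\<close>
lemma F_ell2_bounded:
  assumes \<tau>: "\<tau> > 0" and bdd: "bdd_above (range (\<lambda>x. degr G x / m x))"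
  shows "F \<tau> \<in> ell2 G"
proof -
  obtain D where D: "\<And>x. degr G x / m x \<le> D" using bdd by (auto simp: bdd_above_def)
  show ?thesis unfolding ell2_iff
  proof (rule vsummable_comparison)
    show "vsummable (\<lambda>x. (D/2) * \<Gamma> u u x)" by (intro vsummable_cmult u_energy)
    fix x
    define M where "M = edge_mean x (\<lambda>y. \<bar>u y - u x\<bar>)"
    have "F \<tau> x \<le> M" unfolding F_def \<Gamma>_edge_mean M_def
      by (rule edge_mean_mono) (use f_step(6)[OF \<tau>, of _ x] in \<open>simp add: power2_eq_square\<close>)
    then have "(F \<tau> x)\<^sup>2 \<le> M\<^sup>2" using F_nonneg by (intro power_mono) auto
    also have "\<dots> \<le> \<Gamma> u u x * edge_mean x (\<lambda>y. 1)"
    proof (rule quadratic_nonneg_discriminant)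
      fix t :: real
      have "edge_mean x (\<lambda>y. 0) \<le> edge_mean x (\<lambda>y. (u y - u x) * (u y - u x) + ((2 * t) * \<bar>u y - u x\<bar> + t\<^sup>2 * 1))"
      proof (rule edge_mean_mono)
        fix y
        have "0 \<le> (\<bar>u y - u x\<bar> + t)\<^sup>2" by simp
        then show "0 \<le> (u y - u x) * (u y - u x) + ((2 * t) * \<bar>u y - u x\<bar> + t\<^sup>2 * 1)"
          by (simp add: power2_sum power2_eq_square algebra_simps)
      qed
      then show "0 \<le> \<Gamma> u u x + 2 * t * M + t\<^sup>2 * edge_mean x (\<lambda>y. 1)"
        unfolding edge_mean_add edge_mean_cmult by (simp add: \<Gamma>_edge_mean M_def edge_mean_def)
    qed
    also have "edge_mean x (\<lambda>y. 1) = (1/2) * (degr G x / m x)" by (simp add: edge_mean_def degr_def)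
    also have "\<Gamma> u u x * ((1/2) * (degr G x / m x)) \<le> \<Gamma> u u x * (D/2)" using D[of x] by (intro mult_left_mono) auto
    finally show "\<bar>(F \<tau> x)\<^sup>2\<bar> \<le> (D/2) * \<Gamma> u u x" by (simp add: mult.commute)
  qed
qed

text \<open>
  Pair the curvature inequality with \<open>\<xi> k * u\<close> and let \<open>k\<close> tend to infinity.  On \<open>S\<close> the sharp
  estimates are used; off \<open>S\<close> the crude ones cost \<open>(K + H/2) \<Gamma>(u)\<close>.  This cost is added on both
  sides: over all vertices on the right, over \<open>S\<close> on the left, so that it cancels as \<open>S\<close> grows.
\<close>
lemma finite_part_bound:
  assumes CDE: "CDE' G n (- K)" and n: "n > 0" and K: "K > 0" and cut: "cutoffs \<xi> \<delta>"
    and \<tau>: "\<tau> > 0" and Fe: "F \<tau> \<in> ell2 G" and S: "finite S"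
  shows "(\<Sum>x\<in>S. m x * ((K/2) * (u x * (h x * u x - (n * K / 2) * (u x + \<tau>)))
              - (H/2) * (sqrt \<tau> / sqrt (u x)) * \<Gamma> u u x + (K + H/2) * \<Gamma> u u x))
     \<le> vint (\<lambda>x. (K + H/2) * \<Gamma> u u x + (\<epsilon>/4) * (\<Gamma> u u x + (u x)\<^sup>2))"
    (is "(\<Sum>x\<in>S. m x * ?T x) \<le> vint ?q")
proof -
  note \<xi> = cutoffsD[OF cut]
  define C where "C = 2 * K + 2 * H + 1 + \<epsilon>\<^sup>2"
  have C: "C \<ge> 0" using K H_nonneg by (simp add: C_def)
  have FG: "vsummable (\<Gamma> (F \<tau>) (F \<tau>))"
  proof (rule Caccioppoli[OF F_nonneg Fe _ _ _ cut])
    show "(\<lambda>x. C * (F \<tau> x + u x)) \<in> ell2 G" by (intro ell2_cmult ell2_add Fe u_ell2)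
    show "C * (F \<tau> x + u x) \<ge> 0" for x using C F_nonneg[of \<tau> x] u_pos[of x] by simp
    fix x
    have "- \<Delta> (F \<tau>) x \<le> 2 * K * F \<tau> x + \<Gamma> (f \<tau>) (g \<tau>) x"
      using curvature_lower_bounds(2)[OF CDE n K \<tau>, of x] by simp
    also have "\<dots> \<le> (2 * K + 2 * H + 1/2) * F \<tau> x + (\<epsilon>\<^sup>2 / 2) * u x"
      using gradient_pairing_bound[OF \<tau>, of x] by (simp add: algebra_simps)
    also have "\<dots> \<le> C * F \<tau> x + C * u x"
      using F_nonneg[of \<tau> x] u_pos[of x] K H_nonneg by (intro add_mono mult_right_mono) (auto simp: C_def)
    finally show "- \<Delta> (F \<tau>) x \<le> C * (F \<tau> x + u x)" by (simp add: distrib_left)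
  qed
  define M where "M = vint (\<lambda>x. ((u x)\<^sup>2 + \<Gamma> (F \<tau>) (F \<tau>) x) + ((F \<tau> x)\<^sup>2 + \<Gamma> u u x))"
  have su: "vsummable (\<lambda>x. (u x)\<^sup>2)" using u_ell2 by (simp add: ell2_iff)
  have q: "vsummable ?q" by (intro vsummable_intros u_energy su)
  have q0: "?q x \<ge> 0" for x using K H_nonneg \<epsilon>_pos by (intro add_nonneg_nonneg mult_nonneg_nonneg) auto
  define T where "T x = (if x \<in> S then ?T x else 0)" for x
  have point: "T x - ?q x \<le> (1/2) * (u x * \<Delta> (F \<tau>) x - F \<tau> x * \<Delta> u x)" for x
  proof -
    have uF: "u x * (K * F \<tau> x) \<le> K * \<Gamma> u u x" using mult_left_mono[OF u_F_le[OF \<tau>, of x], of K] K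
      by (simp add: algebra_simps)
    define Y where "Y = (1/2) * \<Delta> (F \<tau>) x + (1/2) * \<Gamma> (f \<tau>) (g \<tau>) x"
    have split: "(1/2) * (u x * \<Delta> (F \<tau>) x - F \<tau> x * \<Delta> u x)
        = u x * Y - (1/2) * (u x * (\<Gamma> (f \<tau>) (g \<tau>) x - h x * F \<tau> x))"
    proof -
      have "\<Delta> u x = - (h x * u x)" using eq[of x] by linarith
      then show ?thesis by (simp add: Y_def algebra_simps)
    qed
    show ?thesis
    proof (cases "x \<in> S")
      case True
      define W where "W = H * (sqrt \<tau> / sqrt (u x)) * \<Gamma> u u x"
      define E where "E = (\<epsilon>/2) * (\<Gamma> u u x + (u x)\<^sup>2)"
      define X where "X = u x * ((K/2) * (h x * u x - (n * K / 2) * (u x + \<tau>)))"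
      have "X \<le> u x * Y" unfolding X_def
        unfolding Y_def using u_pos[of x] by (intro mult_left_mono curvature_lower_bounds(1)[OF CDE n K \<tau>]) auto
      moreover have "u x * (\<Gamma> (f \<tau>) (g \<tau>) x - h x * F \<tau> x)
          \<le> E + W" unfolding E_def W_def
        by (rule commutator_upper[OF \<tau> f_step(8)[OF \<tau>]]) (use \<tau> u_pos[of x] in simp)
      moreover have "T x - ?q x = X - W / 2 - E / 2"
        unfolding T_def X_def W_def E_def using True by (simp add: algebra_simps)
      ultimately show ?thesis unfolding split by linarith
    next
      case False
      have "u x * (- K * F \<tau> x) \<le> u x * Y"
        unfolding Y_def using u_pos[of x] by (intro mult_left_mono curvature_lower_bounds(2)[OF CDE n K \<tau>]) auto
      moreover have "u x * (\<Gamma> (f \<tau>) (g \<tau>) x - h x * F \<tau> x)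
          \<le> (\<epsilon>/2) * (\<Gamma> u u x + (u x)\<^sup>2) + H * 1 * \<Gamma> u u x"
        by (rule commutator_upper[OF \<tau> f_step(7)[OF \<tau>]]) simp
      ultimately show ?thesis unfolding split T_def using False uF by (simp add: algebra_simps)
    qed
  qed
  have ineq: "(\<Sum>x\<in>S. m x * (\<xi> k x * ?T x)) - vint ?q \<le> \<delta> k / 4 * M" for k
  proof -
    have T_sum: "vint (\<lambda>x. \<xi> k x * T x) = (\<Sum>x\<in>S. m x * (\<xi> k x * ?T x))" and sT: "vsummable (\<lambda>x. \<xi> k x * T x)"
      using vint_finite[OF S, of "\<lambda>x. \<xi> k x * T x"] by (auto simp: T_def)
    have "(\<Sum>x\<in>S. m x * (\<xi> k x * ?T x)) - vint ?q = vint (\<lambda>x. \<xi> k x * T x - ?q x)"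
      unfolding T_sum[symmetric] by (rule vint_diff[symmetric, OF sT q])
    also have "\<dots> \<le> vint (\<lambda>x. (1/2) * (\<xi> k x * (u x * \<Delta> (F \<tau>) x - F \<tau> x * \<Delta> u x)))"
    proof (rule vint_mono)
      show "vsummable (\<lambda>x. \<xi> k x * T x - ?q x)" by (rule vsummable_diff[OF sT q])
      show "vsummable (\<lambda>x. (1/2) * (\<xi> k x * (u x * \<Delta> (F \<tau>) x - F \<tau> x * \<Delta> u x)))"
        by (intro vsummable_C0 C0_cmult C0_mult_left \<xi>)
      fix x
      have "\<xi> k x * ?q x \<le> 1 * ?q x" by (rule mult_right_mono[OF \<xi>(3) q0])
      then have "\<xi> k x * T x - ?q x \<le> \<xi> k x * (T x - ?q x)" by (simp add: right_diff_distrib)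
      also have "\<dots> \<le> \<xi> k x * ((1/2) * (u x * \<Delta> (F \<tau>) x - F \<tau> x * \<Delta> u x))"
        by (rule mult_left_mono[OF point \<xi>(2)])
      finally show "\<xi> k x * T x - ?q x \<le> (1/2) * (\<xi> k x * (u x * \<Delta> (F \<tau>) x - F \<tau> x * \<Delta> u x))" by simp
    qed
    also have "\<dots> \<le> (1/2) * (\<delta> k / 2 * M)"
      unfolding vint_cmult M_def by (intro mult_left_mono Green_cutoff[OF u_ell2 u_energy Fe FG cut]) simp
    finally show ?thesis by simp
  qed
  have "(\<lambda>k. (\<Sum>x\<in>S. m x * (\<xi> k x * ?T x)) - vint ?q) \<longlonglongrightarrow> (\<Sum>x\<in>S. m x * (1 * ?T x)) - vint ?q"
    by (intro tendsto_intros \<xi>(4))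
  moreover have "(\<lambda>k. \<delta> k / 4 * M) \<longlonglongrightarrow> 0 / 4 * M" by (intro tendsto_intros \<xi>(7)) simp
  ultimately have "(\<Sum>x\<in>S. m x * (1 * ?T x)) - vint ?q \<le> 0 / 4 * M"
    by (rule LIMSEQ_le) (use ineq in blast)
  then show ?thesis by simp
qed

text \<open>
  First \<open>\<tau> \<rightarrow> 0\<close> for a fixed finite set \<open>S\<close>, then \<open>S\<close> exhausts the vertices.
\<close>
lemma mean_potential_bound:
  assumes CDE: "CDE' G n (- K)" and n: "n > 0" and K: "K > 0" and cut: "cutoffs \<xi> \<delta>"
    and Fe: "\<And>\<tau>. \<tau> > 0 \<Longrightarrow> F \<tau> \<in> ell2 G"
  shows "(K/2) * (vint (\<lambda>x. h x * (u x)\<^sup>2) - (n * K / 2) * vint (\<lambda>x. (u x)\<^sup>2))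
     \<le> (\<epsilon>/4) * (vint (\<Gamma> u u) + vint (\<lambda>x. (u x)\<^sup>2))"
proof -
  define c where "c = K + H/2"
  define q where "q x = c * \<Gamma> u u x + (\<epsilon>/4) * (\<Gamma> u u x + (u x)\<^sup>2)" for x
  define T where "T x = (K/2) * (h x * (u x)\<^sup>2 - (n * K / 2) * (u x)\<^sup>2) + c * \<Gamma> u u x" for x
  have su: "vsummable (\<lambda>x. (u x)\<^sup>2)" using u_ell2 by (simp add: ell2_iff)
  have shu: "vsummable (\<lambda>x. h x * (u x)\<^sup>2)"
  proof (rule vsummable_comparison[OF vsummable_cmult[OF su, of H]])
    show "\<bar>h x * (u x)\<^sup>2\<bar> \<le> H * (u x)\<^sup>2" for x using h_bound[of x] by (simp add: abs_mult mult_right_mono)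
  qed
  have part: "(\<Sum>x\<in>S. m x * T x) \<le> vint q" if S: "finite S" for S
  proof -
    define \<tau> where "\<tau> k = 1 / real (Suc k)" for k
    have \<tau>0: "\<tau> k > 0" for k by (simp add: \<tau>_def)
    have \<tau>lim: "\<tau> \<longlonglongrightarrow> 0" unfolding \<tau>_def using LIMSEQ_inverse_real_of_nat by (simp add: inverse_eq_divide)
    have pos: "sqrt (u x) \<noteq> 0" for x using u_pos[of x] by simp
    have "(\<lambda>k. \<Sum>x\<in>S. m x * ((K/2) * (u x * (h x * u x - (n * K / 2) * (u x + \<tau> k)))
              - (H/2) * (sqrt (\<tau> k) / sqrt (u x)) * \<Gamma> u u x + (K + H/2) * \<Gamma> u u x))
       \<longlonglongrightarrow> (\<Sum>x\<in>S. m x * ((K/2) * (u x * (h x * u x - (n * K / 2) * (u x + 0)))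
              - (H/2) * (sqrt 0 / sqrt (u x)) * \<Gamma> u u x + (K + H/2) * \<Gamma> u u x))"
      by (intro tendsto_intros \<tau>lim pos)
    also have "(\<Sum>x\<in>S. m x * ((K/2) * (u x * (h x * u x - (n * K / 2) * (u x + 0)))
              - (H/2) * (sqrt 0 / sqrt (u x)) * \<Gamma> u u x + (K + H/2) * \<Gamma> u u x)) = (\<Sum>x\<in>S. m x * T x)"
      by (intro sum.cong refl) (simp add: T_def c_def power2_eq_square algebra_simps)
    finally show ?thesis
    proof (rule LIMSEQ_le_const2, intro exI allI impI)
      fix k
      show "(\<Sum>x\<in>S. m x * ((K/2) * (u x * (h x * u x - (n * K / 2) * (u x + \<tau> k)))
              - (H/2) * (sqrt (\<tau> k) / sqrt (u x)) * \<Gamma> u u x + (K + H/2) * \<Gamma> u u x)) \<le> vint q"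
        unfolding q_def c_def by (rule finite_part_bound[OF CDE n K cut \<tau>0 Fe[OF \<tau>0] S])
    qed
  qed
  have sT: "vsummable T" unfolding T_def by (intro vsummable_intros shu su u_energy)
  have "vint T \<le> vint q" unfolding vint_def[of T]
    by (rule infsum_le_finite_sums) (use sT part in \<open>auto simp: vsummable_def\<close>)
  also have "vint T = vint (\<lambda>x. (K/2) * (h x * (u x)\<^sup>2 - (n * K / 2) * (u x)\<^sup>2)) + vint (\<lambda>x. c * \<Gamma> u u x)"
    unfolding T_def by (intro vint_add vsummable_intros shu su u_energy)
  also have "vint (\<lambda>x. (K/2) * (h x * (u x)\<^sup>2 - (n * K / 2) * (u x)\<^sup>2))
      = (K/2) * (vint (\<lambda>x. h x * (u x)\<^sup>2) - (n * K / 2) * vint (\<lambda>x. (u x)\<^sup>2))"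
    unfolding vint_cmult vint_diff[OF shu vsummable_cmult[OF su]] ..
  also have "vint q = vint (\<lambda>x. c * \<Gamma> u u x) + vint (\<lambda>x. (\<epsilon>/4) * (\<Gamma> u u x + (u x)\<^sup>2))"
    unfolding q_def by (intro vint_add vsummable_intros su u_energy)
  also have "vint (\<lambda>x. (\<epsilon>/4) * (\<Gamma> u u x + (u x)\<^sup>2)) = (\<epsilon>/4) * (vint (\<Gamma> u u) + vint (\<lambda>x. (u x)\<^sup>2))"
    unfolding vint_cmult vint_add[OF u_energy su] ..
  finally show ?thesis by simp
qed

end

section \<open>The eigenvalue bound\<close>

theorem theorem1p4:
  fixes G :: "'v wgraph" and n K :: real
  assumes "weighted_graph G" and "connected_graph G" and "locally_finite G"
    and "bdd_above (range (\<lambda>x. degr G x / vmeas G x)) \<or> (complete_graph G \<and> nondegenerate G)"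
    and "n > 0" and "K > 0"
    and "CDE' G n (- K)"
  shows "lambda_star G \<le> K * n / 2"
proof -
  interpret locally_finite_graph G using assms(1,3) by unfold_locales
  define c where "c = lambda_star G"
  have "\<exists>\<xi> \<delta>. cutoffs \<xi> \<delta>"
    using assms(4)
  proof
    assume "bdd_above (range (\<lambda>x. degr G x / m x))"
    then show ?thesis by (rule bounded_cutoffs[OF assms(2)])
  next
    assume "complete_graph G \<and> nondegenerate G"
    then show ?thesis by (intro complete_cutoffs) simp
  qed
  then obtain \<xi> \<delta> where cut: "cutoffs \<xi> \<delta>" by blast
  note \<xi> = cutoffsD[OF cut]
  show ?thesis
  proof (cases "c \<ge> 0")
    case False
    then show ?thesis using assms(5,6) by (simp add: c_def) (smt (verit) mult_pos_pos divide_nonneg_nonneg)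
  next
    case True
    fix z :: 'v
    \<comment> \<open>A bound for the minimal values \<open>\<theta>\<close> which does not depend on the cutoff, valid as soon as the cutoff
      is at least \<open>1/2\<close> at \<open>z\<close>.\<close>
    define \<Theta> where "\<Theta> = 2 * form (\<lambda>y. if y = z then 1 else 0) / m z"
    have \<Theta>0: "\<Theta> \<ge> 0" by (simp add: \<Theta>_def form_nonneg)
    have step: "(K/2) * (c - n * K / 2) \<le> (\<Theta> + 1)\<^sup>2 * \<delta> k / 4" if k: "\<xi> k z \<ge> 1/2" for k
    proof -
      have z0: "\<xi> k z > 0" using k by linarith
      obtain \<theta> u where \<theta>: "\<theta> \<ge> 0" "\<theta> * (m z * \<xi> k z) \<le> form (\<lambda>y. if y = z then 1 else 0)"
        and u: "\<And>x. u x > 0" "u \<in> ell2 G" "vsummable (\<Gamma> u u)" "vint (\<Gamma> u u) \<le> \<theta> * vint (\<lambda>x. (u x)\<^sup>2)"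
        and eq: "\<And>x. - \<Delta> u x = (\<theta> * \<xi> k x - 1) * u x"
        and mean: "c * vint (\<lambda>x. (u x)\<^sup>2) \<le> vint (\<lambda>x. (\<theta> * \<xi> k x - 1) * (u x)\<^sup>2)"
        using ground_state[OF assms(2) \<xi>(1) \<xi>(2) \<xi>(3) z0 lambda_star_le_Rayleigh True[unfolded c_def], folded c_def]
        by blast
      have "\<theta> * (m z * (1/2)) \<le> \<theta> * (m z * \<xi> k z)" using k \<theta>(1) by (intro mult_left_mono) auto
      then have "\<theta> * (m z * (1/2)) \<le> form (\<lambda>y. if y = z then 1 else 0)" using \<theta>(2) by linarith
      then have \<theta>\<Theta>: "\<theta> \<le> \<Theta>" by (simp add: \<Theta>_def field_simps)
      define \<epsilon> where "\<epsilon> = (\<Theta> + 1) * \<delta> k"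
      have \<epsilon>: "\<epsilon> > 0" using \<Theta>0 \<xi>(6)[of k] by (simp add: \<epsilon>_def)
      define h where "h x = \<theta> * \<xi> k x - 1" for x
      interpret slowly_varying G u h "\<Theta> + 1" \<epsilon>
      proof unfold_locales
        fix x
        show "u x > 0" "- \<Delta> u x = h x * u x" using u(1) eq by (auto simp: h_def)
        have "0 \<le> \<theta> * \<xi> k x" using \<theta>(1) \<xi>(2)[of k x] by simp
        moreover have "\<theta> * \<xi> k x \<le> \<Theta> * 1" by (rule mult_mono[OF \<theta>\<Theta> \<xi>(3) \<Theta>0 \<xi>(2)])
        ultimately show "\<bar>h x\<bar> \<le> \<Theta> + 1" by (simp add: h_def)
        have "\<Gamma> h h x = \<Gamma> (\<lambda>y. \<theta> * \<xi> k y) (\<lambda>y. \<theta> * \<xi> k y) x" by (simp add: h_def Gam_def)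
        also have "\<dots> = \<theta>\<^sup>2 * \<Gamma> (\<xi> k) (\<xi> k) x" by (simp add: \<Gamma>_bilinear power2_eq_square)
        also have "\<dots> \<le> (\<Theta> + 1)\<^sup>2 * (\<delta> k)\<^sup>2"
          using \<theta>(1) \<theta>\<Theta> by (intro mult_mono \<xi>(5) power_mono) auto
        finally show "\<Gamma> h h x \<le> \<epsilon>\<^sup>2" by (simp add: \<epsilon>_def power_mult_distrib)
      qed (use u \<epsilon> in auto)
      have Fe: "F \<tau> \<in> ell2 G" if "\<tau> > 0" for \<tau>
        using assms(4)
      proof
        assume "bdd_above (range (\<lambda>x. degr G x / m x))"
        then show ?thesis by (rule F_ell2_bounded[OF that])
      next
        assume "complete_graph G \<and> nondegenerate G"
        then show ?thesis by (intro F_ell2_nondegenerate[OF that]) simp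
      qed
      define U where "U = vint (\<lambda>x. (u x)\<^sup>2)"
      have "m z * (u z)\<^sup>2 = (\<Sum>x\<in>{z}. m x * (u x)\<^sup>2)" by simp
      also have "\<dots> \<le> U" unfolding U_def by (rule finite_sum_le_vint) (use u(2) in \<open>auto simp: ell2_iff\<close>)
      finally have U: "U > 0" using m_pos[of z] u(1)[of z] by (smt (verit) mult_pos_pos zero_less_power)
      have "(K/2) * (c - n * K / 2) * U = (K/2) * (c * U - (n * K / 2) * U)" by (simp add: algebra_simps)
      also have "\<dots> \<le> (K/2) * (vint (\<lambda>x. h x * (u x)\<^sup>2) - (n * K / 2) * U)"
        using mean assms(6) by (intro mult_left_mono) (auto simp: h_def U_def)
      also have "\<dots> \<le> (\<epsilon>/4) * (vint (\<Gamma> u u) + U)"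
        unfolding U_def by (rule mean_potential_bound[OF assms(7,5,6) cut Fe])
      also have "\<dots> \<le> (\<epsilon>/4) * (\<Theta> * U + U)"
      proof (intro mult_left_mono add_mono order_refl)
        have "vint (\<Gamma> u u) \<le> \<theta> * U" using u(4) by (simp add: U_def)
        also have "\<dots> \<le> \<Theta> * U" using \<theta>\<Theta> U by (intro mult_right_mono) auto
        finally show "vint (\<Gamma> u u) \<le> \<Theta> * U" .
      qed (use \<epsilon> in simp)
      also have "\<dots> = (\<Theta> + 1)\<^sup>2 * \<delta> k / 4 * U" by (simp add: \<epsilon>_def power2_eq_square algebra_simps)
      finally show ?thesis using U by simp
    qed
    have ev: "\<forall>\<^sub>F k in sequentially. (K/2) * (c - n * K / 2) \<le> (\<Theta> + 1)\<^sup>2 * \<delta> k / 4"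
    proof -
      have "\<forall>\<^sub>F k in sequentially. \<xi> k z > 1/2" by (rule order_tendstoD(1)[OF \<xi>(4)]) simp
      then show ?thesis by eventually_elim (rule step, simp)
    qed
    have "(\<lambda>k. (\<Theta> + 1)\<^sup>2 * \<delta> k / 4) \<longlonglongrightarrow> (\<Theta> + 1)\<^sup>2 * 0 / 4" by (intro tendsto_intros \<xi>(7)) simp
    then have "(K/2) * (c - n * K / 2) \<le> (\<Theta> + 1)\<^sup>2 * 0 / 4"
      by (rule tendsto_lowerbound[OF _ ev]) simp
    then have "c - n * K / 2 \<le> 0" using assms(6) by (simp add: mult_le_0_iff)
    then show ?thesis by (simp add: c_def mult.commute)
  qed
qed

end
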